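(* Let $p$ be a prime number, and let $\overline{\mathbb{Q}}$ be an algebraic closure of $\mathbb{Q}$. For every countable successor ordinal number $\alpha$ there is a field $F\subseteq\overline{\mathbb{Q}}$ such that the integral closure of $\mathbb{Z}_{(p)}$ in $F$ is an almost Dedekind domain of SP-rank $\alpha$ whose set of maximal ideals is countable.
   Context: "Countable" means finite or countably infinite. $\mathbb{Z}_{(p)}$ is the localization of $\mathbb{Z}$ at the prime ideal $(p)$. An integral domain $D$ with quotient field $L$ is almost Dedekind if $D_M$ is a discrete valuation ring for every $M\in\mathrm{Max}(D)$. A maximal ideal $M$ of $D$ is critical if it contains no nonzero finitely generated radical ideal; $\mathrm{Crit}(D)$ is the set of critical maximal ideals. Define recursively: $T_0=D$, $\mathrm{Crit}^0(D)=\mathrm{Max}(D)$; for $\alpha=\beta+1$, $\mathrm{Crit}^\alpha(D)=\{P\in\mathrm{Max}(D): PT_\beta\in\mathrm{Crit}(T_\beta)\}$; for $\alpha$ a limit ordinal, $\mathrm{Crit}^\alpha(D)=\bigcap_{\beta<\alpha}\mathrm{Crit}^\beta(D)$; and in all cases $T_\alpha=\bigcap\{D_M: M\in\mathrm{Crit}^\alpha(D)\}$ (with $T_\alpha=L$ and no critical ideals if $\mathrm{Crit}^\alpha(D)=\emptyset$). The maximal ideals of $T_\alpha$ are exactly the extensions of the elements of $\mathrm{Crit}^\alpha(D)$. The SP-rank of $D$ is the smallest ordinal $\alpha$ such that $\mathrm{Crit}^\alpha(D)=\emptyset$ (it always exists). *)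

theory Defs
  imports
    "HOL-Library.Countable_Set"
    "HOL-Computational_Algebra.Computational_Algebra"
    "HOL-Algebra.Algebra"
    "HOL-Algebra.Algebraic_Closure_Type"
begin

section \<open>Notions for an arbitrary ring\<close>

definition Max_ideals :: "('a, 'b) ring_scheme \<Rightarrow> 'a set set" where
  "Max_ideals R = {M. maximalideal M R}"

definition radical_ideal :: "'a set \<Rightarrow> ('a, 'b) ring_scheme \<Rightarrow> bool" where
  "radical_ideal I R \<longleftrightarrow>
     ideal I R \<and> (\<forall>x\<in>carrier R. \<forall>n::nat. x [^]\<^bsub>R\<^esub> n \<in> I \<longrightarrow> x \<in> I)"

definition fin_gen_ideal :: "'a set \<Rightarrow> ('a, 'b) ring_scheme \<Rightarrow> bool" where
  "fin_gen_ideal I R \<longleftrightarrow> (\<exists>S. finite S \<and> S \<subseteq> carrier R \<and> I = genideal R S)"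

definition Crit :: "('a, 'b) ring_scheme \<Rightarrow> 'a set set" where
  "Crit R = {M \<in> Max_ideals R.
     \<not> (\<exists>I. I \<subseteq> M \<and> I \<noteq> {\<zero>\<^bsub>R\<^esub>} \<and> fin_gen_ideal I R \<and> radical_ideal I R)}"

definition discrete_valuation_ring :: "('a, 'b) ring_scheme \<Rightarrow> bool" where
  "discrete_valuation_ring R \<longleftrightarrow>
     principal_domain R \<and> \<not> Ring.field R \<and> (\<exists>!M. M \<in> Max_ideals R)"

section \<open>Subrings of a field\<close>

text \<open>
  From here on every integral domain is given as a subset of an ambient field \<open>'k\<close>, so
  that its quotient field, its localizations and its overrings are subsets of \<open>'k\<close> too.
\<close>

abbreviation ring_on :: "'k::field set \<Rightarrow> 'k ring" where
  "ring_on D \<equiv> ring_of_type_algebra \<lparr>carrier := D\<rparr>"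

definition localization_at :: "'k::field set \<Rightarrow> 'k set \<Rightarrow> 'k set" where
  "localization_at D P = {a / s | a s. a \<in> D \<and> s \<in> D - P}"

definition quotient_field :: "'k::field set \<Rightarrow> 'k set" where
  "quotient_field D = {a / s | a s. a \<in> D \<and> s \<in> D - {0}}"

definition integral_closure_in :: "'k::field set \<Rightarrow> 'k set \<Rightarrow> 'k set" where
  "integral_closure_in A F =
     {x \<in> F. \<exists>q::'k poly. lead_coeff q = 1 \<and> (\<forall>i. poly.coeff q i \<in> A) \<and> poly q x = 0}"

definition int_localized_at :: "nat \<Rightarrow> 'k::field_char_0 set" where
  "int_localized_at p = localization_at \<int> (genideal (ring_on \<int>) {of_nat p})"

definition almost_dedekind :: "'k::field set \<Rightarrow> bool" where
  "almost_dedekind D \<longleftrightarrow> domain (ring_on D) \<and>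
     (\<forall>M\<in>Max_ideals (ring_on D). discrete_valuation_ring (ring_on (localization_at D M)))"

section \<open>The transfinite sequence of critical ideals and the SP-rank\<close>

text \<open>
  An ordinal is represented by an element \<open>\<alpha>\<close> of some well-ordered type \<open>'o\<close>: the element
  \<open>\<alpha>\<close> stands for the order type of \<open>{..<\<alpha>}\<close>. Every countable ordinal arises in this way
  for a suitable \<open>'o\<close>, the least element stands for 0, and immediate successors in \<open>'o\<close> are
  ordinal successors.
\<close>

definition is_succ_of :: "'o::wellorder \<Rightarrow> 'o \<Rightarrow> bool" where
  "is_succ_of \<alpha> \<beta> \<longleftrightarrow> \<beta> < \<alpha> \<and> \<not> (\<exists>\<gamma>. \<beta> < \<gamma> \<and> \<gamma> < \<alpha>)"

lemma is_succ_of_unique: "is_succ_of \<alpha> \<beta> \<Longrightarrow> is_succ_of \<alpha> \<gamma> \<Longrightarrow> \<beta> = \<gamma>"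
  unfolding is_succ_of_def by (meson linorder_neqE)

definition ord_pred :: "'o::wellorder \<Rightarrow> 'o" where
  "ord_pred \<alpha> = (THE \<beta>. is_succ_of \<alpha> \<beta>)"

lemma ord_pred_eq: "is_succ_of \<alpha> \<beta> \<Longrightarrow> ord_pred \<alpha> = \<beta>"
  unfolding ord_pred_def by (blast intro: is_succ_of_unique)

lemma ord_pred_less: "is_succ_of \<alpha> \<beta> \<Longrightarrow> ord_pred \<alpha> < \<alpha>"
  by (simp add: ord_pred_eq) (simp add: is_succ_of_def)

text \<open>
  The ring \<open>T\<^sub>\<alpha>\<close> belonging to \<open>C = Crit\<^sup>\<alpha>(D)\<close>. Intersecting inside the quotient field makes
  it the quotient field when \<open>C\<close> is empty.
\<close>

definition overring_of :: "'k::field set \<Rightarrow> 'k set set \<Rightarrow> 'k set" where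
  "overring_of D C = {x \<in> quotient_field D. \<forall>M\<in>C. x \<in> localization_at D M}"

text \<open>
  \<open>Crit\<^sup>\<beta>\<^sup>+\<^sup>1(D)\<close> in terms of \<open>C = Crit\<^sup>\<beta>(D)\<close>. The first case is the convention that there are
  no critical ideals beyond an empty \<open>C\<close> (where the zero ideal of the field \<open>T\<^sub>\<beta>\<close> would
  formally be critical).
\<close>

definition crit_step :: "'k::field set \<Rightarrow> 'k set set \<Rightarrow> 'k set set" where
  "crit_step D C =
     (if C = {} then {}
      else {P \<in> Max_ideals (ring_on D).
              genideal (ring_on (overring_of D C)) P \<in> Crit (ring_on (overring_of D C))})"

function Crit_iter :: "'k::field set \<Rightarrow> 'o::wellorder \<Rightarrow> 'k set set" where
  "Crit_iter D \<alpha> =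
     (if \<forall>\<beta>. \<alpha> \<le> \<beta> then Max_ideals (ring_on D)
      else if \<exists>\<beta>. is_succ_of \<alpha> \<beta> then crit_step D (Crit_iter D (ord_pred \<alpha>))
      else (\<Inter>\<beta>\<in>{..<\<alpha>}. Crit_iter D \<beta>))"
  by pat_completeness auto
termination
  by (relation "inv_image {(x, y). x < y} snd")
     (auto intro!: wf_inv_image wf dest: ord_pred_less)

declare Crit_iter.simps [simp del]

lemma Crit_iter_zero:
  assumes "\<And>\<beta>. \<alpha> \<le> \<beta>"
  shows "Crit_iter D \<alpha> = Max_ideals (ring_on D)"
  using assms by (subst Crit_iter.simps) simp

lemma Crit_iter_succ:
  assumes "is_succ_of \<alpha> \<beta>"
  shows "Crit_iter D \<alpha> = crit_step D (Crit_iter D \<beta>)"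
proof -
  have "\<not> (\<forall>\<beta>. \<alpha> \<le> \<beta>)"
    using assms by (auto simp: is_succ_of_def not_le)
  then show ?thesis
    using assms by (subst Crit_iter.simps) (auto simp: ord_pred_eq[OF assms])
qed

lemma Crit_iter_limit:
  assumes "\<beta> < \<alpha>" "\<not> (\<exists>\<beta>. is_succ_of \<alpha> \<beta>)"
  shows "Crit_iter D \<alpha> = (\<Inter>\<beta>\<in>{..<\<alpha>}. Crit_iter D \<beta>)"
proof -
  have "\<not> (\<forall>\<beta>. \<alpha> \<le> \<beta>)"
    using assms(1) by (auto simp: not_le)
  then show ?thesis
    using assms(2) by (subst Crit_iter.simps) auto
qed

text \<open>
  A relation rather than a \<open>LEAST\<close> term, because \<open>'o\<close> may be too short to contain the
  SP-rank of a given domain.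
\<close>

definition has_SP_rank :: "'k::field set \<Rightarrow> 'o::wellorder \<Rightarrow> bool" where
  "has_SP_rank D \<alpha> \<longleftrightarrow> Crit_iter D \<alpha> = {} \<and> (\<forall>\<beta><\<alpha>. Crit_iter D \<beta> \<noteq> {})"

end

theory Submission
  imports Defs
begin

text \<open>
  The ring is a union of a tower of semilocal principal ideal domains \<open>A n\<close>, each obtained from
  the previous one by quadratic extensions. Such a step leaves all primes inert except one prime
  \<open>i\<close>, from which a new prime \<open>j\<close> splits off: \<open>g i\<close> becomes \<open>g i * (g j)\<^sup>2\<close> up to a unit.
  A maximal ideal of the union is a prime that is followed through the tower, and it is critical
  iff infinitely many ramified primes split off from it. Every prime carries an ordinal label; the
  labels drop from a prime to those splitting off from it, and a prime labelled \<open>\<delta>\<close> spawns each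
  smaller label infinitely often. Passing to \<open>T\<^sub>\<gamma>\<close> localizes the tower at the primes with label at
  least \<open>\<gamma>\<close>, which is a tower of the same kind, so \<open>Crit\<^sup>\<gamma>\<close> consists of the ideals with label at
  least \<open>\<gamma>\<close>. Starting with label \<open>\<beta>\<close> gives SP-rank \<open>\<beta> + 1\<close>.
\<close>

section \<open>Subrings of a field\<close>

text \<open>Criticality asks for infinitely many ramified primes around an ideal, whereas discrete
  valuation rings and countably many maximal ideals ask that each branch of primes be unramified
  from some level on. Strictly falling labels reconcile the two: every branch finally keeps one
  index, and an index never ramifies over itself. Each extension adjoins a root of
  \<open>x\<^sup>2 - b * x + c\<close>. Chinese remainders choose the coefficients: at a prime to
  stay inert the polynomial has no root in the residue field, which is finite; at the chosen prime
  \<open>c\<close> has order one, and \<open>b\<close> decides between splitting (\<open>b\<close>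
  is 1 there) and ramification (\<open>b\<close> is 0). A prime of ramification index 2 thus costs a
  splitting followed by a ramification of the new factor. The obstacle is irreducibility: a
  splitting polynomial gives no evidence for it at the chosen prime, so it is read off from an inert
  prime, and some second prime must always be present. At the bottom there is only \<open>p\<close>,
  and the polynomial \<open>x\<^sup>2 - x + p\<close> is irreducible by its discriminant. All this
  is elementary because \<open>A + A \<theta>\<close> is itself again a semilocal principal ideal
  domain.\<close>

definition princ :: "'k::field set \<Rightarrow> 'k \<Rightarrow> 'k set" where
  "princ A x = (\<lambda>z. x * z) ` A"

definition unit_in :: "'k::field set \<Rightarrow> 'k \<Rightarrow> bool" where
  "unit_in A u \<longleftrightarrow> u \<in> A \<and> u \<noteq> 0 \<and> inverse u \<in> A"

lemma ring_of_type_algebra_simps [simp]: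
  "carrier ring_of_type_algebra = UNIV"
  "\<zero>\<^bsub>ring_of_type_algebra\<^esub> = 0" "\<one>\<^bsub>ring_of_type_algebra\<^esub> = 1"
  "x \<oplus>\<^bsub>ring_of_type_algebra\<^esub> y = x + y" "x \<otimes>\<^bsub>ring_of_type_algebra\<^esub> y = x * y"
  by (simp_all add: ring_of_type_algebra_def)

locale field_subring =
  fixes A :: "'k::field set"
  assumes one_mem: "1 \<in> A"
    and diff_mem: "x \<in> A \<Longrightarrow> y \<in> A \<Longrightarrow> x - y \<in> A"
    and mult_mem: "x \<in> A \<Longrightarrow> y \<in> A \<Longrightarrow> x * y \<in> A"
begin

lemma zero_mem: "0 \<in> A"
  using diff_mem[OF one_mem one_mem] by simp

lemma uminus_mem: "x \<in> A \<Longrightarrow> - x \<in> A"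
  using diff_mem[OF zero_mem] by force

lemma add_mem: "x \<in> A \<Longrightarrow> y \<in> A \<Longrightarrow> x + y \<in> A"
  using diff_mem[of x "- y"] uminus_mem by simp

lemma power_mem: "x \<in> A \<Longrightarrow> x ^ n \<in> A"
  by (induction n) (auto intro: one_mem mult_mem)

lemma of_nat_mem: "of_nat n \<in> A"
  by (induction n) (auto intro: one_mem add_mem zero_mem)

lemma of_int_mem: "of_int n \<in> A"
  by (cases n) (auto intro!: uminus_mem of_nat_mem simp del: of_nat_Suc)

lemma sum_mem: "(\<And>i. i \<in> S \<Longrightarrow> f i \<in> A) \<Longrightarrow> sum f S \<in> A"
  by (induction S rule: infinite_finite_induct) (auto intro: zero_mem add_mem)

lemma prod_mem: "(\<And>i. i \<in> S \<Longrightarrow> f i \<in> A) \<Longrightarrow> prod f S \<in> A"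
  by (induction S rule: infinite_finite_induct) (auto intro: one_mem mult_mem)

lemmas closed = zero_mem one_mem add_mem diff_mem mult_mem uminus_mem power_mem

lemma princ_subset: "x \<in> A \<Longrightarrow> princ A x \<subseteq> A"
  by (auto simp: princ_def intro: mult_mem)

lemma princ_self: "x \<in> princ A x"
  unfolding princ_def using one_mem by (auto intro!: image_eqI[of _ _ 1])

lemma princ_zero: "0 \<in> princ A x"
  unfolding princ_def using zero_mem by (auto intro!: image_eqI[of _ _ 0])

lemma princ_multR: "y \<in> A \<Longrightarrow> x * y \<in> princ A x"
  unfolding princ_def by auto

lemma princ_multL: "y \<in> A \<Longrightarrow> y * x \<in> princ A x"
  unfolding princ_def by (auto simp: mult.commute)

lemma princ_add: "y \<in> princ A x \<Longrightarrow> z \<in> princ A x \<Longrightarrow> y + z \<in> princ A x"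
  unfolding princ_def by (auto simp: distrib_left[symmetric] intro: add_mem)

lemma princ_diff: "y \<in> princ A x \<Longrightarrow> z \<in> princ A x \<Longrightarrow> y - z \<in> princ A x"
  unfolding princ_def by (auto simp: right_diff_distrib[symmetric] intro: diff_mem)

lemma princ_uminus: "y \<in> princ A x \<Longrightarrow> - y \<in> princ A x"
  using princ_diff[OF princ_zero, of y] by simp

lemma princ_mult: "z \<in> A \<Longrightarrow> y \<in> princ A x \<Longrightarrow> z * y \<in> princ A x"
  unfolding princ_def by (auto intro!: mult_mem simp: mult.left_commute)

lemma princ_mult': "z \<in> A \<Longrightarrow> y \<in> princ A x \<Longrightarrow> y * z \<in> princ A x"
  by (subst mult.commute) (rule princ_mult)

lemma princ_power: "y \<in> A \<Longrightarrow> y \<in> princ A x \<Longrightarrow> 0 < n \<Longrightarrow> y ^ n \<in> princ A x"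
  by (cases n) (auto intro: princ_mult' power_mem)

lemma princ_trans: "y \<in> princ A x \<Longrightarrow> z \<in> princ A y \<Longrightarrow> z \<in> princ A x"
  unfolding princ_def by (auto simp: mult.assoc intro: mult_mem)

lemma unit_in_one: "unit_in A 1"
  by (simp add: unit_in_def one_mem)

lemma unit_in_mult: "unit_in A u \<Longrightarrow> unit_in A v \<Longrightarrow> unit_in A (u * v)"
  by (auto simp: unit_in_def intro: mult_mem)

lemma unit_in_inverse: "unit_in A u \<Longrightarrow> unit_in A (inverse u)"
  by (auto simp: unit_in_def)

lemma unit_in_power: "unit_in A u \<Longrightarrow> unit_in A (u ^ n)"
  by (induction n) (auto intro: unit_in_one unit_in_mult)

lemma unit_in_prod: "(\<And>i. i \<in> S \<Longrightarrow> unit_in A (f i)) \<Longrightarrow> unit_in A (prod f S)"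
  by (induction S rule: infinite_finite_induct) (auto intro: unit_in_one unit_in_mult)

lemma unit_inI: "u \<in> A \<Longrightarrow> v \<in> A \<Longrightarrow> u * v = 1 \<Longrightarrow> unit_in A u"
  unfolding unit_in_def by (metis inverse_unique mult_zero_left zero_neq_one)

lemma unit_in_factor:
  assumes "x \<in> A" "y \<in> A" "unit_in A (x * y)"
  shows "unit_in A x"
proof (rule unit_inI)
  show "y * inverse (x * y) \<in> A"
    using assms unfolding unit_in_def by (blast intro: mult_mem)
  show "x * (y * inverse (x * y)) = 1"
    unfolding mult.assoc[symmetric] using assms by (intro right_inverse) (simp add: unit_in_def)
qed fact

lemma princ_unit_multL: "unit_in A u \<Longrightarrow> princ A (u * x) = princ A x"
proof
  assume u: "unit_in A u"
  show "princ A (u * x) \<subseteq> princ A x"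
    using u by (auto simp: princ_def unit_in_def mult_ac intro!: image_eqI[of _ _ "u * _"] mult_mem)
  show "princ A x \<subseteq> princ A (u * x)"
    using u by (auto simp: princ_def unit_in_def mult_ac
        intro!: image_eqI[of _ _ "inverse u * _"] mult_mem)
qed

lemma unit_mult_mem_princ_iff:
  assumes "unit_in A u"
  shows "u * y \<in> princ A x \<longleftrightarrow> y \<in> princ A x"
proof -
  have "inverse u * (u * y) = y"
    using assms by (simp add: mult.assoc[symmetric] unit_in_def)
  thus ?thesis
    using princ_mult[of "inverse u" "u * y"] princ_mult[of u y] assms
    unfolding unit_in_def by metis
qed

lemma domain_ring_on: "domain (ring_on A)"
proof -
  have "\<And>x. x \<in> A \<Longrightarrow> \<exists>y\<in>A. y + x = 0"
    using uminus_mem by force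
  moreover from this have "\<And>x. x \<in> A \<Longrightarrow> \<exists>y\<in>A. y + x = 0 \<and> x + y = 0"
    by (metis add.commute)
  ultimately show ?thesis
    by unfold_locales
      (auto simp: algebra_simps Units_def closed)
qed

sublocale R: domain "ring_on A"
  by (rule domain_ring_on)

lemma ring_on_pow [simp]: "x [^]\<^bsub>ring_on A\<^esub> (n::nat) = x ^ n"
  by (induction n) (auto simp: nat_pow_def)

lemma ring_on_uminus: "x \<in> A \<Longrightarrow> \<ominus>\<^bsub>ring_on A\<^esub> x = - x"
  using R.minus_equality[of "- x" x] by (simp add: uminus_mem)

text \<open>Closure conditions on plain sets are what allows ideals of different rings inside one
  field to be compared. Additive inverses come from multiplication by \<open>- 1\<close>.\<close>

lemma ideal_on_iff:
  "ideal J (ring_on A) \<longleftrightarrow>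
     J \<subseteq> A \<and> 0 \<in> J \<and> (\<forall>x\<in>J. \<forall>y\<in>J. x + y \<in> J) \<and> (\<forall>x\<in>A. \<forall>y\<in>J. x * y \<in> J)"
    (is "_ \<longleftrightarrow> ?rhs")
proof
  assume "ideal J (ring_on A)"
  then interpret ideal J "ring_on A" .
  show ?rhs using a_subset additive_subgroup.zero_closed[OF additive_subgroup_axioms] 
      a_closed I_l_closed by auto
next
  assume *: ?rhs
  show "ideal J (ring_on A)"
  proof (intro idealI R.ring_axioms subgroup.intro)
    fix x assume "x \<in> J"
    have "inv\<^bsub>add_monoid (ring_on A)\<^esub> x = - x"
      using ring_on_uminus[of x] \<open>x \<in> J\<close> * unfolding a_inv_def by auto
    moreover have "- 1 * x \<in> J"
      using * \<open>x \<in> J\<close> uminus_mem one_mem by blast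
    ultimately show "inv\<^bsub>add_monoid (ring_on A)\<^esub> x \<in> J" by simp
  next
    fix a x assume "a \<in> J" "x \<in> carrier (ring_on A)"
    thus "x \<otimes>\<^bsub>ring_on A\<^esub> a \<in> J" "a \<otimes>\<^bsub>ring_on A\<^esub> x \<in> J"
      using * by (auto simp: mult.commute[of a])
  qed (use * in auto)
qed

lemma ideal_princ: "x \<in> A \<Longrightarrow> ideal (princ A x) (ring_on A)"
  unfolding ideal_on_iff
  using princ_subset princ_zero princ_add princ_mult by auto

lemma genideal_princ: "x \<in> A \<Longrightarrow> genideal (ring_on A) {x} = princ A x"
proof
  assume x: "x \<in> A"
  show "genideal (ring_on A) {x} \<subseteq> princ A x"
    using R.genideal_minimal[OF ideal_princ[OF x]] princ_self by auto
  have "ideal (genideal (ring_on A) {x}) (ring_on A)"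
    using x by (intro R.genideal_ideal) auto
  moreover have "x \<in> genideal (ring_on A) {x}"
    using x by (intro R.genideal_self') auto
  ultimately show "princ A x \<subseteq> genideal (ring_on A) {x}"
    unfolding ideal_on_iff princ_def by (auto simp: mult.commute)
qed

lemma ideal_one: "ideal J (ring_on A) \<Longrightarrow> 1 \<in> J \<Longrightarrow> J = A"
  unfolding ideal_on_iff by force

text \<open>An ideal properly above \<open>M\<close> contains some \<open>x\<close> with
  \<open>x * y - 1\<close> in \<open>M\<close>, hence contains 1.\<close>

lemma maximalideal_onI:
  assumes "ideal M (ring_on A)" "1 \<notin> M"
    and "\<And>x. x \<in> A \<Longrightarrow> x \<notin> M \<Longrightarrow> \<exists>y\<in>A. x * y - 1 \<in> M"
  shows "maximalideal M (ring_on A)"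
proof (rule maximalidealI)
  fix J assume J: "ideal J (ring_on A)" "M \<subseteq> J" "J \<subseteq> carrier (ring_on A)"
  show "J = M \<or> J = carrier (ring_on A)"
  proof (cases "J \<subseteq> M")
    case False
    then obtain x where x: "x \<in> J" "x \<notin> M" by auto
    moreover have "x \<in> A" using x J by auto
    ultimately obtain y where y: "y \<in> A" "x * y - 1 \<in> M" using assms(3) by blast
    from J have cl: "\<And>a b. a \<in> J \<Longrightarrow> b \<in> J \<Longrightarrow> a + b \<in> J" "\<And>a b. a \<in> A \<Longrightarrow> b \<in> J \<Longrightarrow> a * b \<in> J"
      unfolding ideal_on_iff by auto
    have "y * x + (- 1) * (x * y - 1) \<in> J"
      using x y J by (intro cl) (auto intro: uminus_mem one_mem)
    hence "1 \<in> J" by (simp add: algebra_simps)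
    with ideal_one J show ?thesis by simp
  qed (use J in auto)
qed (use assms one_mem in auto)

lemma maximalideal_onD:
  assumes "maximalideal M (ring_on A)"
  shows "ideal M (ring_on A)" "1 \<notin> M"
    "x \<in> A \<Longrightarrow> y \<in> A \<Longrightarrow> x * y \<in> M \<Longrightarrow> x \<in> M \<or> y \<in> M"
    "ideal J (ring_on A) \<Longrightarrow> M \<subseteq> J \<Longrightarrow> 1 \<notin> J \<Longrightarrow> J = M"
proof -
  interpret maximalideal M "ring_on A" by fact
  show id: "ideal M (ring_on A)" by (rule ideal_axioms)
  show n1: "1 \<notin> M" using I_notcarr ideal_one[OF id] by auto
  interpret primeideal M "ring_on A"
    using R.maximalideal_prime assms by blast
  show "x \<in> A \<Longrightarrow> y \<in> A \<Longrightarrow> x * y \<in> M \<Longrightarrow> x \<in> M \<or> y \<in> M"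
    using I_prime by simp
  show "ideal J (ring_on A) \<Longrightarrow> M \<subseteq> J \<Longrightarrow> 1 \<notin> J \<Longrightarrow> J = M"
    using I_maximal[of J] one_mem unfolding ideal_on_iff by auto
qed

lemma quotient_field_memI: "a \<in> A \<Longrightarrow> s \<in> A \<Longrightarrow> s \<noteq> 0 \<Longrightarrow> a / s \<in> quotient_field A"
  unfolding quotient_field_def by blast

lemma subset_quotient_field: "A \<subseteq> quotient_field A"
  using quotient_field_memI[OF _ one_mem] by force

lemma subfield_quotient_field: "subfield (quotient_field A) ring_of_type_algebra"
proof (rule field.subfieldI')
  let ?K = "ring_of_type_algebra :: 'k ring"
  show fld: "field ?K" by (rule field_from_type_algebra)
  interpret K: field ?K by fact
  have neg: "\<ominus>\<^bsub>?K\<^esub> x = - x" for x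
    using K.minus_equality[of "- x" x] by simp
  have inv: "inv\<^bsub>?K\<^esub> x = inverse x" if "x \<noteq> 0" for x
    using that by (intro K.comm_inv_char) auto
  show "subring (quotient_field A) ?K"
  proof (rule ring.subringI)
    show "\<one>\<^bsub>?K\<^esub> \<in> quotient_field A"
      using subset_quotient_field one_mem by auto
    fix x y assume "x \<in> quotient_field A" "y \<in> quotient_field A"
    then obtain a s b t where
      *: "x = a / s" "y = b / t" "a \<in> A" "b \<in> A" "s \<in> A" "t \<in> A" "s \<noteq> 0" "t \<noteq> 0"
      unfolding quotient_field_def by blast
    have "x * y = (a * b) / (s * t)" "x + y = (a * t + b * s) / (s * t)" "- x = (- a) / s"
      using * by (auto simp: field_simps)
    moreover have "(- a) / s \<in> quotient_field A"
      using * by (intro quotient_field_memI closed)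
    ultimately show "\<ominus>\<^bsub>?K\<^esub> x \<in> quotient_field A" "x \<otimes>\<^bsub>?K\<^esub> y \<in> quotient_field A"
      "x \<oplus>\<^bsub>?K\<^esub> y \<in> quotient_field A"
      unfolding neg using * by (auto simp del: minus_divide_left intro!: quotient_field_memI closed)
  qed (auto simp: K.ring_axioms)
  fix x assume "x \<in> quotient_field A - {\<zero>\<^bsub>?K\<^esub>}"
  then obtain a s where "x = a / s" "a \<in> A" "s \<in> A" "s \<noteq> 0" "a \<noteq> 0"
    unfolding quotient_field_def by auto
  thus "inv\<^bsub>?K\<^esub> x \<in> quotient_field A"
    by (subst inv) (auto intro: quotient_field_memI)
qed

end

section \<open>Semilocal principal ideal domains\<close>

text \<open>A nonzero generator of a maximal ideal, with maximality phrased as invertibility modulo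
  \<open>q\<close>. In this form it passes to localizations and quadratic extensions by exhibiting
  inverses.\<close>

definition max_element :: "'k::field set \<Rightarrow> 'k \<Rightarrow> bool" where
  "max_element A q \<longleftrightarrow> q \<in> A \<and> q \<noteq> 0 \<and> 1 \<notin> princ A q \<and>
     (\<forall>x\<in>A. x \<notin> princ A q \<longrightarrow> (\<exists>y\<in>A. x * y - 1 \<in> princ A q))"

lemma max_elementD:
  assumes "max_element A q"
  shows "q \<in> A" "q \<noteq> 0" "1 \<notin> princ A q"
    "\<And>x. x \<in> A \<Longrightarrow> x \<notin> princ A q \<Longrightarrow> \<exists>y\<in>A. x * y - 1 \<in> princ A q"
  using assms by (auto simp: max_element_def)

lemma prod_power_Suc:
  assumes "finite J" "j \<in> J"
  shows "(\<Prod>i\<in>J. h i ^ (k(j := Suc (k j))) i) = h j * (\<Prod>i\<in>J. h i ^ k i :: 'a::comm_monoid_mult)"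
proof -
  have "(\<Prod>i\<in>J. h i ^ (k(j := Suc (k j))) i) = h j ^ Suc (k j) * (\<Prod>i\<in>J - {j}. h i ^ k i)"
    using assms by (subst prod.remove[of _ j]) (auto intro!: prod.cong)
  also have "\<dots> = h j * (h j ^ k j * (\<Prod>i\<in>J - {j}. h i ^ k i))"
    by (simp add: mult_ac)
  also have "\<dots> = h j * (\<Prod>i\<in>J. h i ^ k i)"
    using assms by (subst prod.remove[of J j]) auto
  finally show ?thesis .
qed

context field_subring
begin

lemma max_element_prime:
  assumes "max_element A q" "x \<in> A" "y \<in> A" "x * y \<in> princ A q"
  shows "x \<in> princ A q \<or> y \<in> princ A q"
proof (rule ccontr)
  assume *: "\<not> ?thesis"
  then obtain z where z: "z \<in> A" "x * z - 1 \<in> princ A q"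
    using max_elementD[OF assms(1)] assms(2) by blast
  have "z * (x * y) - y * (x * z - 1) \<in> princ A q"
    by (rule princ_diff[OF princ_mult[OF z(1) assms(4)] princ_mult[OF assms(3) z(2)]])
  hence "y \<in> princ A q" by (simp add: algebra_simps)
  with * show False by simp
qed

lemma max_element_prime_prod:
  assumes "max_element A q" "finite S" "\<And>i. i \<in> S \<Longrightarrow> f i \<in> A" "prod f S \<in> princ A q"
  shows "\<exists>i\<in>S. f i \<in> princ A q"
  using assms(2,3,4)
proof (induction S rule: finite_induct)
  case empty
  thus ?case using max_elementD(3)[OF assms(1)] by simp
next
  case (insert j S)
  thus ?case using max_element_prime[OF assms(1), of "f j" "prod f S"] prod_mem[of S f] by auto
qed

lemma max_element_prime_power:
  "max_element A q \<Longrightarrow> x \<in> A \<Longrightarrow> x ^ n \<in> princ A q \<Longrightarrow> x \<in> princ A q"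
  by (induction n) (use max_element_prime[of q x, OF _ _ power_mem] in \<open>auto simp: max_elementD(3)\<close>)

text \<open>Were \<open>r\<close> outside \<open>princ A q\<close>, an inverse of \<open>r\<close>
  modulo \<open>q\<close> would put 1 into \<open>princ A r\<close>.\<close>

lemma max_element_princ_eq:
  assumes "max_element A q" "max_element A r" "q \<in> princ A r"
  shows "r \<in> princ A q"
proof (rule ccontr)
  assume "r \<notin> princ A q"
  then obtain y where y: "y \<in> A" "r * y - 1 \<in> princ A q"
    using max_elementD[OF assms(1)] max_elementD(1)[OF assms(2)] by blast
  have "r * y - (r * y - 1) \<in> princ A r"
    by (rule princ_diff[OF princ_multR[OF y(1)] princ_trans[OF assms(3) y(2)]])
  thus False using max_elementD(3)[OF assms(2)] by simp
qed

lemma max_element_unit_mult: "max_element A q \<Longrightarrow> unit_in A u \<Longrightarrow> max_element A (u * q)"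
  unfolding max_element_def by (auto simp: princ_unit_multL intro: mult_mem) (auto simp: unit_in_def intro: mult_mem)

end

text \<open>Factorization up to units stands in for the principal ideal property, since it can be
  checked by computation in an extension. The index set is abstract so that a prime keeps its name
  while its generator changes.\<close>

locale semilocal = field_subring A for A :: "'k::field set" +
  fixes I :: "'i set" and g :: "'i \<Rightarrow> 'k"
  assumes fin: "finite I"
    and max_el: "i \<in> I \<Longrightarrow> max_element A (g i)"
    and distinct: "i \<in> I \<Longrightarrow> j \<in> I \<Longrightarrow> i \<noteq> j \<Longrightarrow> g j \<notin> princ A (g i)"
    and factor: "x \<in> A \<Longrightarrow> x \<noteq> 0 \<Longrightarrow> \<exists>u k. unit_in A u \<and> x = u * (\<Prod>i\<in>I. g i ^ k i)"
begin

lemmas g_mem = max_elementD(1)[OF max_el]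
lemmas g_nz = max_elementD(2)[OF max_el]
lemmas g_prime = max_element_prime[OF max_el]

lemma prod_g_mem: "S \<subseteq> I \<Longrightarrow> (\<Prod>i\<in>S. g i ^ k i) \<in> A"
  by (intro prod_mem power_mem g_mem) auto

lemma prod_g_nz: "S \<subseteq> I \<Longrightarrow> (\<Prod>i\<in>S. g i ^ k i) \<noteq> 0"
  by (cases "finite S") (auto simp: prod_zero_iff dest: g_nz)

lemma factor_mem_princ_iff:
  assumes "unit_in A u" "i \<in> I"
  shows "u * (\<Prod>i\<in>I. g i ^ k i) \<in> princ A (g i) \<longleftrightarrow> k i > 0"
proof -
  have "(\<Prod>i\<in>I. g i ^ k i) \<in> princ A (g i) \<longleftrightarrow> k i > 0"
  proof
    assume "(\<Prod>i\<in>I. g i ^ k i) \<in> princ A (g i)"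
    then obtain j where j: "j \<in> I" "g j ^ k j \<in> princ A (g i)"
      using max_element_prime_prod[OF max_el[OF assms(2)] fin, of "\<lambda>i. g i ^ k i"]
      by (auto intro: power_mem g_mem)
    hence "g j \<in> princ A (g i)"
      using max_element_prime_power[OF max_el[OF assms(2)] g_mem[OF j(1)]] by blast
    hence "j = i" using distinct[OF assms(2) j(1)] by auto
    with j max_elementD(3)[OF max_el[OF assms(2)]] show "k i > 0"
      by (cases "k i") auto
  next
    assume "k i > 0"
    hence "g i ^ k i * (\<Prod>i\<in>I - {i}. g i ^ k i) \<in> princ A (g i)"
      using assms by (intro princ_mult' princ_power prod_g_mem g_mem princ_self) auto
    thus "(\<Prod>i\<in>I. g i ^ k i) \<in> princ A (g i)"
      using fin assms by (subst prod.remove[of _ i]) auto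
  qed
  thus ?thesis by (simp add: unit_mult_mem_princ_iff assms)
qed

lemma unit_if_no_factor:
  assumes "x \<in> A" "x \<noteq> 0" "\<And>i. i \<in> I \<Longrightarrow> x \<notin> princ A (g i)"
  shows "unit_in A x"
proof -
  obtain u k where uk: "unit_in A u" "x = u * (\<Prod>i\<in>I. g i ^ k i)"
    using factor assms by blast
  hence "\<And>i. i \<in> I \<Longrightarrow> k i = 0" using assms(3) factor_mem_princ_iff by auto
  with uk show ?thesis by simp
qed

lemma extract_power:
  assumes "x \<in> A" "x \<noteq> 0" "i \<in> I"
  shows "\<exists>k t. t \<in> A \<and> t \<notin> princ A (g i) \<and> x = g i ^ k * t"
proof -
  obtain u k where uk: "unit_in A u" "x = u * (\<Prod>i\<in>I. g i ^ k i)"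
    using factor assms by blast
  define t where "t = u * (\<Prod>j\<in>I. g j ^ (k(i := 0)) j)"
  have "t = u * (\<Prod>i\<in>I-{i}. g i ^ k i)"
    unfolding t_def prod.remove[OF fin assms(3)] by (auto intro!: prod.cong)
  hence "x = g i ^ k i * t"
    unfolding uk(2) prod.remove[OF fin assms(3)] by (simp add: mult_ac)
  moreover have "t \<notin> princ A (g i)"
    unfolding t_def using factor_mem_princ_iff[OF uk(1) assms(3)] by simp
  moreover have "t \<in> A"
    unfolding t_def using uk by (intro mult_mem prod_g_mem) (auto simp: unit_in_def)
  ultimately show ?thesis by blast
qed

lemma reduced_fraction:
  assumes "x \<in> quotient_field A"
  shows "\<exists>a s. a \<in> A \<and> s \<in> A \<and> s \<noteq> 0 \<and> x = a / s \<and>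
           (\<forall>i\<in>I. a \<in> princ A (g i) \<longrightarrow> s \<notin> princ A (g i))"
proof -
  obtain a s where as: "a \<in> A" "s \<in> A" "s \<noteq> 0" "x = a / s"
    using assms by (auto simp: quotient_field_def)
  show ?thesis
  proof (cases "a = 0")
    \<comment> \<open>Zero has no factorization; \<open>0 / 1\<close> is reduced because 1 lies in
      no maximal ideal.\<close>
    case True
    thus ?thesis using max_elementD(3)[OF max_el] as
      by (intro exI[of _ 0] exI[of _ 1]) (auto simp: closed)
  next
    case False
    obtain u k where uk: "unit_in A u" "a = u * (\<Prod>i\<in>I. g i ^ k i)"
      using factor[OF as(1) False] by blast
    obtain v l where vl: "unit_in A v" "s = v * (\<Prod>i\<in>I. g i ^ l i)"
      using factor[OF as(2,3)] by blast
    \<comment> \<open>Truncated subtraction removes the minimum of \<open>k i\<close> and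
      \<open>l i\<close> from both exponents; the fractions agree because \<open>k + (l - k)\<close>
      and \<open>l + (k - l)\<close> are both the maximum.\<close>
    define a' s' where "a' = u * (\<Prod>i\<in>I. g i ^ (k i - l i))" and "s' = v * (\<Prod>i\<in>I. g i ^ (l i - k i))"
    have "a * s' = u * v * (\<Prod>i\<in>I. g i ^ (k i + (l i - k i)))"
      by (simp add: uk s'_def power_add prod.distrib)
    also have "(\<lambda>i. k i + (l i - k i)) = (\<lambda>i. l i + (k i - l i))" by auto
    also have "u * v * (\<Prod>i\<in>I. g i ^ (l i + (k i - l i))) = s * a'"
      by (simp add: vl a'_def power_add prod.distrib)
    finally have "a * s' = s * a'" .
    moreover have "s' \<noteq> 0" using vl prod_g_nz[of I] by (auto simp: s'_def unit_in_def)
    ultimately have "x = a' / s'" using as by (simp add: frac_eq_eq mult.commute)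
    moreover have "a' \<in> A" "s' \<in> A" using uk vl prod_g_mem[of I]
      by (auto simp: a'_def s'_def unit_in_def intro!: mult_mem)
    moreover have "\<forall>i\<in>I. a' \<in> princ A (g i) \<longrightarrow> s' \<notin> princ A (g i)"
      by (auto simp: a'_def s'_def factor_mem_princ_iff uk vl)
    ultimately show ?thesis using \<open>s' \<noteq> 0\<close> by blast
  qed
qed

text \<open>The rational root argument: clearing denominators for a reduced fraction
  \<open>a / s\<close> puts \<open>a ^ n\<close> into \<open>princ A s\<close>, so a prime dividing
  \<open>s\<close> would divide \<open>a\<close>. Hence \<open>s\<close> is a unit.\<close>

lemma integrally_closed:
  assumes "x \<in> quotient_field A" "lead_coeff q = 1" "\<And>i. coeff q i \<in> A" "poly q x = 0"
  shows "x \<in> A"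
proof -
  obtain a s where as: "a \<in> A" "s \<in> A" "s \<noteq> 0" "x = a / s"
    and red: "\<And>i. i \<in> I \<Longrightarrow> a \<in> princ A (g i) \<Longrightarrow> s \<notin> princ A (g i)"
    using reduced_fraction[OF assms(1)] by blast
  define n where "n = degree q"
  have "0 = s ^ n * (\<Sum>i\<le>n. coeff q i * x ^ i)"
    using assms(4) by (simp add: poly_altdef n_def)
  also have "\<dots> = (\<Sum>i\<le>n. coeff q i * a ^ i * s ^ (n - i))"
    unfolding sum_distrib_left using as
    by (intro sum.cong) (auto simp: field_simps power_diff)
  also have "\<dots> = a ^ n + (\<Sum>i<n. coeff q i * a ^ i * s ^ (n - i))"
    using assms(2) by (simp add: lessThan_Suc_atMost[symmetric] n_def)
  finally have an: "a ^ n = - (\<Sum>i<n. coeff q i * a ^ i * s ^ (n - i))"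
    by (simp add: eq_neg_iff_add_eq_0)
  have "s \<notin> princ A (g i)" if i: "i \<in> I" for i
  proof
    assume s: "s \<in> princ A (g i)"
    have "(\<Sum>i<n. coeff q i * a ^ i * s ^ (n - i)) \<in> princ A s"
    proof -
      have "(\<Sum>i<n. coeff q i * a ^ i * s ^ (n - i))
              = s * (\<Sum>i<n. coeff q i * a ^ i * s ^ (n - i - 1))"
        unfolding sum_distrib_left
        by (intro sum.cong) (auto simp: Suc_diff_Suc[symmetric] simp del: Suc_diff_Suc)
      thus ?thesis using assms(3) as
        by (auto intro!: princ_multR sum_mem mult_mem power_mem)
    qed
    hence "a ^ n \<in> princ A (g i)" using princ_trans[OF s] an princ_uminus by simp
    hence "a \<in> princ A (g i)" using max_element_prime_power[OF max_el[OF i] as(1)] by blast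
    thus False using red i s by blast
  qed
  hence "unit_in A s" using unit_if_no_factor as by blast
  thus ?thesis using as by (auto simp: unit_in_def divide_inverse intro: mult_mem)
qed

end

text \<open>Induction on the number of prime factors: each \<open>g j\<close> divides
  \<open>x\<close> or \<open>y\<close> and can be cancelled there. It stands outside the locale
  because it serves to establish the factorization axiom.\<close>

lemma divisor_of_factored:
  assumes "field_subring A" "finite I" "\<And>i. i \<in> I \<Longrightarrow> max_element A (g i)"
    and "x \<in> A" "y \<in> A" "x * y = u * (\<Prod>i\<in>I. g i ^ k i)" "unit_in A u"
  shows "\<exists>v l. unit_in A v \<and> x = v * (\<Prod>i\<in>I. g i ^ l i)"
  using assms(4-6)
proof (induction "sum k I" arbitrary: k x y)
  case 0
  interpret field_subring A by fact
  have "x * y = u" using 0 assms(2) by simp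
  hence "unit_in A (x * y)" using assms(7) by simp
  hence "unit_in A x" using unit_in_factor 0 by blast
  thus ?case by (intro exI[of _ x] exI[of _ "\<lambda>_. 0"]) auto
next
  case (Suc n)
  interpret field_subring A by fact
  have "\<exists>j\<in>I. k j > 0" using Suc(2) assms(2) by (metis neq0_conv sum.neutral nat.simps(3))
  then obtain j where j: "j \<in> I" "k j > 0" by blast
  define k' where "k' = k(j := k j - 1)"
  have k: "k = k'(j := Suc (k' j))" using j by (auto simp: k'_def)
  have eq: "x * y = g j * (u * (\<Prod>i\<in>I. g i ^ k' i))"
    unfolding Suc(5) by (subst k, subst prod_power_Suc) (use j assms(2) in auto)
  have n: "sum k' I = n"
    using Suc(2) sum.cong[of "I - {j}" "I - {j}" k k'] unfolding sum.remove[OF assms(2) j(1)]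
    by (auto simp: k)
  have mx: "max_element A (g j)" using assms(3) j by blast
  have "(\<Prod>i\<in>I. g i ^ k' i) \<in> A" using assms(3) 
    by (intro prod_mem power_mem) (auto simp: max_element_def)
  hence "x * y \<in> princ A (g j)"
    unfolding eq using assms(7) by (intro princ_multR mult_mem) (auto simp: unit_in_def)
  then consider z where "z \<in> A" "x = g j * z" | z where "z \<in> A" "y = g j * z"
    using max_element_prime[OF mx Suc(3,4)] by (auto simp: princ_def)
  thus ?case
  proof cases
    case 1
    hence "z * y = u * (\<Prod>i\<in>I. g i ^ k' i)" using eq max_elementD(2)[OF mx] by simp
    with Suc(1)[OF n[symmetric] 1(1) Suc(4)] obtain v l where
      "unit_in A v" "z = v * (\<Prod>i\<in>I. g i ^ l i)" by blast
    thus ?thesis using 1 prod_power_Suc[OF assms(2) j(1), of g l]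
      by (intro exI[of _ v] exI[of _ "l(j := Suc (l j))"]) auto
  next
    case 2
    hence "x * z = u * (\<Prod>i\<in>I. g i ^ k' i)" using eq max_elementD(2)[OF mx] by simp
    with Suc(1)[OF n[symmetric] Suc(3) 2(1)] show ?thesis by blast
  qed
qed

text \<open>Asks only for some factored multiple of each nonzero element. In a quadratic extension
  that multiple is the norm, in a semilocal localization the numerator.\<close>

lemma semilocalI:
  fixes g :: "'i \<Rightarrow> 'k::field"
  assumes "field_subring A" "finite I" "\<And>i. i \<in> I \<Longrightarrow> max_element A (g i)"
    and "\<And>i j. i \<in> I \<Longrightarrow> j \<in> I \<Longrightarrow> i \<noteq> j \<Longrightarrow> g j \<notin> princ A (g i)"
    and "\<And>x. x \<in> A \<Longrightarrow> x \<noteq> 0 \<Longrightarrow>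
           \<exists>y\<in>A. \<exists>u k. unit_in A u \<and> x * y = u * (\<Prod>i\<in>I. g i ^ k i)"
  shows "semilocal A I g"
proof -
  interpret field_subring A by fact
  show ?thesis
  proof
    fix x assume x: "x \<in> A" "x \<noteq> 0"
    then obtain y u k where "y \<in> A" "unit_in A u" "x * y = u * (\<Prod>i\<in>I. g i ^ k i)"
      using assms(5) by blast
    with x show "\<exists>u k. unit_in A u \<and> x = u * (\<Prod>i\<in>I. g i ^ k i)"
      using divisor_of_factored[where g = g, OF assms(1-3)] by blast
  qed (use assms in blast)+
qed

section \<open>Localizations\<close>

definition frac_ring :: "'k::field set \<Rightarrow> 'k set \<Rightarrow> 'k set" where
  "frac_ring A S = {a / s | a s. a \<in> A \<and> s \<in> S}"

context field_subring
begin

lemma frac_ring_memI: "a \<in> A \<Longrightarrow> s \<in> S \<Longrightarrow> a / s \<in> frac_ring A S"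
  unfolding frac_ring_def by blast

lemma subset_frac_ring: "1 \<in> S \<Longrightarrow> A \<subseteq> frac_ring A S"
  using frac_ring_memI[of _ 1] by force

lemma field_subring_frac_ring:
  assumes "S \<subseteq> A" "1 \<in> S" "0 \<notin> S" "\<And>s t. s \<in> S \<Longrightarrow> t \<in> S \<Longrightarrow> s * t \<in> S"
  shows "field_subring (frac_ring A S)"
proof
  show "1 \<in> frac_ring A S" using subset_frac_ring[OF assms(2)] one_mem by auto
  fix x y assume "x \<in> frac_ring A S" "y \<in> frac_ring A S"
  then obtain a s b t where *: "x = a / s" "y = b / t" "a \<in> A" "b \<in> A" "s \<in> S" "t \<in> S"
    unfolding frac_ring_def by blast
  hence nz: "s \<noteq> 0" "t \<noteq> 0" using assms by auto
  have "x - y = (a * t - b * s) / (s * t)" "x * y = (a * b) / (s * t)"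
    using * nz by (auto simp: field_simps)
  thus "x - y \<in> frac_ring A S" "x * y \<in> frac_ring A S"
    using * assms(1,4) by (auto intro!: frac_ring_memI diff_mem mult_mem)
qed

text \<open>The denominators avoid the prime ideal \<open>princ A q\<close>, so they can be
  cancelled from a divisibility by \<open>q\<close>. If \<open>y\<close> inverts \<open>a\<close>
  modulo \<open>q\<close>, then \<open>s * y\<close> inverts \<open>a / s\<close>.\<close>

lemma max_element_frac_ring:
  assumes "S \<subseteq> A" "1 \<in> S" "0 \<notin> S" "\<And>s t. s \<in> S \<Longrightarrow> t \<in> S \<Longrightarrow> s * t \<in> S"
    and q: "max_element A q" and disj: "S \<inter> princ A q = {}"
  shows "x \<in> A \<Longrightarrow> x \<in> princ (frac_ring A S) q \<longleftrightarrow> x \<in> princ A q"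
    and "max_element (frac_ring A S) q"
proof -
  interpret F: field_subring "frac_ring A S"
    by (rule field_subring_frac_ring[OF assms(1-4)])
  have mem_iff: "x \<in> princ (frac_ring A S) q \<longleftrightarrow> x \<in> princ A q" if x: "x \<in> A" for x
  proof
    assume "x \<in> princ (frac_ring A S) q"
    then obtain a s where as: "x = q * (a / s)" "a \<in> A" "s \<in> S"
      by (auto simp: princ_def frac_ring_def)
    hence "s * x = q * a" using assms(3) by auto
    hence "s * x \<in> princ A q" using as princ_multR by auto
    thus "x \<in> princ A q" using max_element_prime[OF q] disj as x assms(1) by blast
  next
    assume "x \<in> princ A q"
    thus "x \<in> princ (frac_ring A S) q" using subset_frac_ring[OF assms(2)] by (auto simp: princ_def)
  qed
  thus "x \<in> A \<Longrightarrow> x \<in> princ (frac_ring A S) q \<longleftrightarrow> x \<in> princ A q" .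
  show "max_element (frac_ring A S) q"
    unfolding max_element_def
  proof (intro conjI ballI impI)
    show "q \<in> frac_ring A S" "q \<noteq> 0" "1 \<notin> princ (frac_ring A S) q"
      using max_elementD[OF q] subset_frac_ring[OF assms(2)] mem_iff one_mem by auto
    fix x assume x: "x \<in> frac_ring A S" "x \<notin> princ (frac_ring A S) q"
    then obtain a s where as: "x = a / s" "a \<in> A" "s \<in> S" by (auto simp: frac_ring_def)
    have "a \<notin> princ A q"
    proof
      assume "a \<in> princ A q"
      then obtain b where "b \<in> A" "a = q * b" by (auto simp: princ_def)
      hence "x = q * (b / s)" using as by simp
      with x show False using F.princ_multR[of "b / s" q] frac_ring_memI \<open>b \<in> A\<close> as by auto
    qed
    then obtain y where y: "y \<in> A" "a * y - 1 \<in> princ A q"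
      using max_elementD(4)[OF q] as by blast
    have "s * y \<in> A" using y as assms(1) mult_mem by auto
    moreover have "x * (s * y) = a * y" using as assms(3) by auto
    moreover have "a * y - 1 \<in> A" using y as by (auto intro: closed)
    ultimately show "\<exists>y\<in>frac_ring A S. x * y - 1 \<in> princ (frac_ring A S) q"
      using mem_iff y subset_frac_ring[OF assms(2)] by (intro bexI[of _ "s * y"]) (auto simp: mult.assoc)
  qed
qed

lemma cgenideal_eq_princ: "cgenideal (ring_on A) x = princ A x"
  by (auto simp: cgenideal_def princ_def mult.commute image_def)

end

lemma localization_at_eq_frac_ring: "localization_at D P = frac_ring D (D - P)"
  by (simp add: localization_at_def frac_ring_def)

text \<open>With a single prime \<open>t\<close> every nonzero element is a unit times a power of
  \<open>t\<close>, so a nonzero ideal is generated by the least power of \<open>t\<close> in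
  it.\<close>

lemma discrete_valuation_ringI:
  assumes "semilocal A {i} g"
  shows "discrete_valuation_ring (ring_on A)"
proof -
  interpret semilocal A "{i}" g by fact
  define t where "t = g i"
  have t: "max_element A t" using max_el by (simp add: t_def)
  have mx: "maximalideal (princ A t) (ring_on A)"
    using max_elementD[OF t] by (intro maximalideal_onI ideal_princ) auto
  have nonunit: "x \<in> princ A t" if "x \<in> A" "\<not> unit_in A x" for x
    using unit_if_no_factor[of x] that princ_zero by (auto simp: t_def)
  have "principal_domain (ring_on A)"
  proof
    fix J assume J: "ideal J (ring_on A)"
    hence J': "J \<subseteq> A" "0 \<in> J" "\<And>a b. a \<in> A \<Longrightarrow> b \<in> J \<Longrightarrow> a * b \<in> J" unfolding ideal_on_iff by auto
    have "\<exists>a\<in>A. J = princ A a"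
    proof (cases "J = {0}")
      case True
      thus ?thesis using zero_mem by (intro bexI[of _ 0]) (auto simp: princ_def image_iff)
    next
      case False
      have *: "\<exists>k. t ^ k \<in> J \<and> x \<in> princ A (t ^ k)" if x: "x \<in> J" "x \<noteq> 0" for x
      proof -
        obtain u k where "unit_in A u" "x = u * (\<Prod>i\<in>{i}. g i ^ k i)"
          using factor x J' by blast
        hence u: "unit_in A u" "x = u * t ^ k i" by (auto simp: t_def)
        hence "inverse u * x = t ^ k i" by (simp add: unit_in_def field_simps)
        moreover have "inverse u * x \<in> J" using u x J' by (auto simp: unit_in_def)
        moreover have "x \<in> princ A (t ^ k i)" using u by (auto simp: unit_in_def intro: princ_multL)
        ultimately show ?thesis by auto
      qed
      define n where "n = (LEAST k. t ^ k \<in> J)"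
      have "\<exists>k. t ^ k \<in> J" using * False J' by blast
      hence n: "t ^ n \<in> J" "\<And>k. t ^ k \<in> J \<Longrightarrow> n \<le> k"
        unfolding n_def by (auto intro: LeastI Least_le)
      have "J = princ A (t ^ n)"
      proof
        show "princ A (t ^ n) \<subseteq> J" using n J' by (auto simp: princ_def mult.commute)
        show "J \<subseteq> princ A (t ^ n)"
        proof
          fix x assume x: "x \<in> J"
          show "x \<in> princ A (t ^ n)"
          proof (cases "x = 0")
            case False
            then obtain k where k: "t ^ k \<in> J" "x \<in> princ A (t ^ k)" using * x by blast
            hence "t ^ k = t ^ n * t ^ (k - n)" using n(2) by (simp add: power_add[symmetric])
            moreover have "t ^ n * t ^ (k - n) \<in> princ A (t ^ n)"
              using max_elementD(1)[OF t] by (intro princ_multR power_mem)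
            ultimately have "t ^ k \<in> princ A (t ^ n)" by simp
            thus ?thesis using princ_trans k by blast
          qed (auto simp: princ_zero)
        qed
      qed
      moreover have "t ^ n \<in> A" using max_elementD(1)[OF t] power_mem by blast
      ultimately show ?thesis by blast
    qed
    thus "\<exists>a\<in>carrier (ring_on A). J = cgenideal (ring_on A) a"
      by (simp add: cgenideal_eq_princ)
  qed
  moreover have "\<not> Ring.field (ring_on A)"
  proof
    assume "Ring.field (ring_on A)"
    hence "maximalideal {0} (ring_on A)" using field.zeromaximalideal[of "ring_on A"] by simp
    hence "princ A t = {0}"
      using maximalideal_onD(1,2)[OF mx] princ_zero by (intro maximalideal_onD(4)) auto
    thus False using max_elementD(2)[OF t] princ_self[of t] by auto
  qed
  moreover have "N = princ A t" if N: "maximalideal N (ring_on A)" for N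
  proof (rule maximalideal_onD(4)[OF N, symmetric])
    show "ideal (princ A t) (ring_on A)" "1 \<notin> princ A t" using maximalideal_onD[OF mx] by auto
    show "N \<subseteq> princ A t"
    proof
      fix x assume x: "x \<in> N"
      have NA: "N \<subseteq> A" "\<And>a b. a \<in> A \<Longrightarrow> b \<in> N \<Longrightarrow> a * b \<in> N"
        using maximalideal_onD(1)[OF N] unfolding ideal_on_iff by auto
      have "\<not> unit_in A x"
        using NA(2)[of "inverse x" x] x maximalideal_onD(2)[OF N] by (auto simp: unit_in_def)
      thus "x \<in> princ A t" using x NA nonunit by auto
    qed
  qed
  ultimately show ?thesis
    unfolding discrete_valuation_ring_def Max_ideals_def using mx by auto
qed

context field_subring
begin

lemma complement_maximalideal:
  assumes "maximalideal N (ring_on A)"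
  shows "A - N \<subseteq> A" "1 \<in> A - N" "0 \<notin> A - N"
    "\<And>s t. s \<in> A - N \<Longrightarrow> t \<in> A - N \<Longrightarrow> s * t \<in> A - N"
  using maximalideal_onD[OF assms] unfolding ideal_on_iff by (auto intro: one_mem mult_mem)

text \<open>\<open>t\<close> is a uniformizer: by \<open>*\<close> every nonzero element is a power
  of \<open>t\<close> up to factors outside \<open>N\<close>, and those become units in the
  localization.\<close>

lemma discrete_valuation_ring_localization_at:
  assumes N: "maximalideal N (ring_on A)" and t: "t \<in> N" "t \<noteq> 0"
    and *: "\<And>x. x \<in> A \<Longrightarrow> x \<noteq> 0 \<Longrightarrow> \<exists>k. \<exists>r\<in>A - N. \<exists>s\<in>A - N. x * s = t ^ k * r"
  shows "discrete_valuation_ring (ring_on (localization_at A N))"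
proof -
  define L where "L = frac_ring A (A - N)"
  note cmp = complement_maximalideal[OF N]
  interpret L: field_subring L
    unfolding L_def by (rule field_subring_frac_ring[OF cmp])
  have AL: "A \<subseteq> L" unfolding L_def by (rule subset_frac_ring[OF cmp(2)])
  have tA: "t \<in> A" and NA: "\<And>a b. a \<in> A \<Longrightarrow> b \<in> N \<Longrightarrow> a * b \<in> N"
    using maximalideal_onD(1)[OF N] t unfolding ideal_on_iff by auto
  have unit: "unit_in L (r / s)" if "r \<in> A - N" "s \<in> A - N" for r s
    using that frac_ring_memI[of r s "A - N"] frac_ring_memI[of s r "A - N"] cmp(3)
    unfolding unit_in_def L_def by auto
  have fac: "\<exists>k u. unit_in L u \<and> y = t ^ k * u" if y: "y \<in> L" "y \<noteq> 0" for y
  proof -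
    obtain a w where aw: "y = a / w" "a \<in> A" "w \<in> A - N"
      using y unfolding L_def frac_ring_def by blast
    then obtain k r s where krs: "r \<in> A - N" "s \<in> A - N" "a * s = t ^ k * r"
      using * y by force
    have "w * s \<in> A - N" using cmp(4) aw krs by blast
    moreover have "y = t ^ k * (r / (w * s))"
    proof -
      have "s \<noteq> 0" "w \<noteq> 0" using krs aw cmp(3) by auto
      thus ?thesis using krs aw by (simp add: field_simps)
    qed
    ultimately show ?thesis using unit krs by blast
  qed
  have t1: "1 \<notin> princ L t"
  proof
    assume "1 \<in> princ L t"
    then obtain a s where "a \<in> A" "s \<in> A - N" "1 = t * (a / s)"
      unfolding princ_def L_def frac_ring_def by blast
    hence "s = a * t" using cmp(3) by (auto simp: field_simps)
    thus False using \<open>s \<in> A - N\<close> NA[OF \<open>a \<in> A\<close> t(1)] by auto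
  qed
  have "semilocal L {()} (\<lambda>_. t)"
  proof (rule semilocalI)
    show "max_element L t"
      unfolding max_element_def
    proof (intro conjI ballI impI)
      fix x assume x: "x \<in> L" "x \<notin> princ L t"
      hence "x \<noteq> 0" using L.princ_zero by auto
      then obtain k u where ku: "unit_in L u" "x = t ^ k * u" using fac x by blast
      have "k = 0"
      proof (rule ccontr)
        assume "k \<noteq> 0"
        hence "t ^ k * u \<in> princ L t" using ku tA AL
          by (intro L.princ_mult' L.princ_power L.princ_self) (auto simp: unit_in_def)
        thus False using x ku by simp
      qed
      thus "\<exists>y\<in>L. x * y - 1 \<in> princ L t" using ku L.princ_zero
        by (intro bexI[of _ "inverse u"]) (auto simp: unit_in_def)
    qed (use tA AL t t1 in auto)
    fix x assume "x \<in> L" "x \<noteq> 0"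
    then obtain k u where "unit_in L u" "x = t ^ k * u" using fac by blast
    thus "\<exists>y\<in>L. \<exists>u k. unit_in L u \<and> x * y = u * (\<Prod>i\<in>{()}. t ^ k i)"
      by (intro bexI[of _ 1] exI[of _ u] exI[of _ "\<lambda>_. k"]) (auto simp: L.one_mem)
  qed (auto simp: L.field_subring_axioms)
  thus ?thesis
    unfolding localization_at_eq_frac_ring L_def[symmetric] by (rule discrete_valuation_ringI)
qed

lemma maximalideal_prod:
  assumes "maximalideal N (ring_on A)" "finite S" "\<And>i. i \<in> S \<Longrightarrow> f i \<in> A"
    "(\<Prod>i\<in>S. f i ^ k i) \<in> N"
  shows "\<exists>i\<in>S. f i \<in> N"
  using assms(2-)
proof (induction S rule: finite_induct)
  case empty
  thus ?case using maximalideal_onD(2)[OF assms(1)] by simp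
next
  case (insert j S)
  have pow: "x ^ n \<in> N \<Longrightarrow> x \<in> A \<Longrightarrow> x \<in> N" for x n
    by (induction n) (use maximalideal_onD(2,3)[OF assms(1)] power_mem in auto)
  have "f j ^ k j * (\<Prod>i\<in>S. f i ^ k i) \<in> N" using insert by simp
  hence "f j ^ k j \<in> N \<or> (\<Prod>i\<in>S. f i ^ k i) \<in> N"
    using insert by (intro maximalideal_onD(3)[OF assms(1)] power_mem prod_mem) auto
  thus ?case using insert pow by auto
qed

end

context semilocal
begin

text \<open>The complement of a union of primes, the multiplicative set whose ring of fractions
  keeps just the primes indexed by \<open>J\<close>.\<close>

definition avoid :: "'i set \<Rightarrow> 'k set" where
  "avoid J = {s \<in> A. \<forall>j\<in>J. s \<notin> princ A (g j)}"

lemma avoid_props: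
  assumes "J \<subseteq> I" "J \<noteq> {}"
  shows "avoid J \<subseteq> A" "1 \<in> avoid J" "0 \<notin> avoid J"
    "\<And>s t. s \<in> avoid J \<Longrightarrow> t \<in> avoid J \<Longrightarrow> s * t \<in> avoid J"
proof -
  show "avoid J \<subseteq> A" "0 \<notin> avoid J" using assms princ_zero by (auto simp: avoid_def)
  show "1 \<in> avoid J" using assms max_elementD(3)[OF max_el] one_mem by (auto simp: avoid_def)
  fix s t assume "s \<in> avoid J" "t \<in> avoid J"
  thus "s * t \<in> avoid J" using assms by (auto simp: avoid_def mult_mem dest!: g_prime[rotated 3])
qed

lemma avoid_disjoint: "j \<in> J \<Longrightarrow> avoid J \<inter> princ A (g j) = {}"
  by (auto simp: avoid_def)

lemma frac_avoid_mem_princ_iff: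
  assumes "J \<subseteq> I" "J \<noteq> {}" "j \<in> J" "x \<in> A"
  shows "x \<in> princ (frac_ring A (avoid J)) (g j) \<longleftrightarrow> x \<in> princ A (g j)"
  using assms by (intro max_element_frac_ring avoid_props avoid_disjoint max_el) auto

lemma unit_in_frac_avoid:
  assumes "J \<subseteq> I" "J \<noteq> {}" "s \<in> avoid J"
  shows "unit_in (frac_ring A (avoid J)) s"
proof -
  have "s / 1 \<in> frac_ring A (avoid J)" "1 / s \<in> frac_ring A (avoid J)" "s \<noteq> 0"
    using assms avoid_props[OF assms(1,2)] one_mem by (auto simp del: div_by_1 intro: frac_ring_memI)
  thus ?thesis by (auto simp: unit_in_def inverse_eq_divide)
qed

lemma g_mem_avoid: "J \<subseteq> I \<Longrightarrow> i \<in> I - J \<Longrightarrow> g i \<in> avoid J"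
  unfolding avoid_def using distinct g_mem by auto

text \<open>Generators with index outside \<open>J\<close> lie in \<open>avoid J\<close> by
  distinctness and turn into units, so only the part over \<open>J\<close> of a factorization
  survives.\<close>

lemma semilocal_frac_avoid:
  assumes "J \<subseteq> I" "J \<noteq> {}"
  shows "semilocal (frac_ring A (avoid J)) J g"
proof (rule semilocalI)
  note av = avoid_props[OF assms]
  let ?F = "frac_ring A (avoid J)"
  show F: "field_subring ?F" by (rule field_subring_frac_ring[OF av])
  interpret F: field_subring ?F by fact
  show "finite J" using assms fin finite_subset by blast
  fix i assume i: "i \<in> J"
  show "max_element ?F (g i)"
    using assms i by (intro max_element_frac_ring av avoid_disjoint max_el) auto
  fix j assume "j \<in> J" "i \<noteq> j"
  thus "g j \<notin> princ ?F (g i)"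
    using assms i distinct[of i j] frac_avoid_mem_princ_iff[OF assms i] g_mem by auto
next
  note av = avoid_props[OF assms]
  let ?F = "frac_ring A (avoid J)"
  interpret F: field_subring ?F by (rule field_subring_frac_ring[OF av])
  fix x assume "x \<in> ?F" "x \<noteq> 0"
  then obtain a s where as: "x = a / s" "a \<in> A" "s \<in> avoid J" "a \<noteq> 0"
    by (auto simp: frac_ring_def)
  then obtain u k where uk: "unit_in A u" "a = u * (\<Prod>i\<in>I. g i ^ k i)" using factor by blast
  have AF: "A \<subseteq> ?F" by (rule subset_frac_ring[OF av(2)])
  have "s \<noteq> 0" using as av(3) by auto
  moreover have "I = (I - J) \<union> J" using assms by auto
  hence "(\<Prod>i\<in>I. g i ^ k i) = (\<Prod>i\<in>I - J. g i ^ k i) * (\<Prod>i\<in>J. g i ^ k i)"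
    using fin finite_subset[OF assms(1) fin] by (metis prod.subset_diff assms(1))
  ultimately have "x * s = (u * (\<Prod>i\<in>I - J. g i ^ k i)) * (\<Prod>i\<in>J. g i ^ k i)"
    using uk as by simp
  moreover have "unit_in ?F (u * (\<Prod>i\<in>I - J. g i ^ k i))"
    using uk(1) AF g_mem_avoid[OF assms(1)] unit_in_frac_avoid[OF assms]
    by (intro F.unit_in_mult F.unit_in_prod F.unit_in_power) (auto simp: unit_in_def)
  ultimately show "\<exists>y\<in>?F. \<exists>u k. unit_in ?F u \<and> x * y = u * (\<Prod>i\<in>J. g i ^ k i)"
    using as av(1) AF by blast
qed

end

section \<open>Towers of semilocal rings\<close>

text \<open>
  A prime keeps its index from level to level. An index \<open>j\<close> that is new at a level has split off,
  with ramification index 2, from the prime \<open>par j\<close>; \<open>par\<close> is irrelevant on \<open>I 0\<close>.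
\<close>

locale tower =
  fixes A :: "nat \<Rightarrow> 'k::field set" and I :: "nat \<Rightarrow> 'i set" and g :: "nat \<Rightarrow> 'i \<Rightarrow> 'k"
    and par :: "'i \<Rightarrow> 'i" and lab :: "'i \<Rightarrow> 'o::wellorder"
  assumes level: "semilocal (A n) (I n) (g n)"
    and ring_step: "A n \<subseteq> A (Suc n)"
    and index_step: "I n \<subseteq> I (Suc n)"
    and index_nonempty: "I 0 \<noteq> {}"
    and par_mem: "j \<in> I (Suc n) - I n \<Longrightarrow> par j \<in> I n"
    and lab_par: "j \<in> I (Suc n) - I n \<Longrightarrow> lab j < lab (par j)"
    and gen_step: "i \<in> I n \<Longrightarrow> \<exists>u. unit_in (A (Suc n)) u \<and>
       g n i = u * g (Suc n) i * (\<Prod>j\<in>{j \<in> I (Suc n) - I n. par j = i}. (g (Suc n) j)\<^sup>2)"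
begin

sublocale L: semilocal "A n" "I n" "g n" for n
  by (rule level)

definition D :: "'k set" where "D = (\<Union>n. A n)"

definition ids :: "'i set" where "ids = (\<Union>n. I n)"

text \<open>The level at which membership is tested does not matter, since the prime
  \<open>i\<close> of a later level contracts to the prime \<open>i\<close> of an earlier
  one.\<close>

definition max_at :: "'i \<Rightarrow> 'k set" where
  "max_at i = {x. \<exists>n. i \<in> I n \<and> x \<in> princ (A n) (g n i)}"

text \<open>For \<open>j\<close> in \<open>I (Suc n)\<close>, the index of the prime of level
  \<open>n\<close> below \<open>j\<close>. The primes over \<open>i\<close> are thus
  \<open>i\<close> itself and the new \<open>j\<close> with \<open>par j = i\<close>.\<close>

definition anc :: "nat \<Rightarrow> 'i \<Rightarrow> 'i" where
  "anc n j = (if j \<in> I n then j else par j)"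

lemma ring_mono: "n \<le> m \<Longrightarrow> A n \<subseteq> A m"
  by (rule lift_Suc_mono_le[of A]) (auto intro: ring_step[THEN subsetD])

lemma index_mono: "n \<le> m \<Longrightarrow> I n \<subseteq> I m"
  by (rule lift_Suc_mono_le[of I]) (auto intro: index_step[THEN subsetD])

lemma level_subset_D: "A n \<subseteq> D"
  unfolding D_def by auto

lemma common_level:
  assumes "x \<in> D" "y \<in> D"
  obtains n where "n0 \<le> n" "x \<in> A n" "y \<in> A n"
proof -
  obtain a b where "x \<in> A a" "y \<in> A b" using assms by (auto simp: D_def)
  thus ?thesis using ring_mono[of a "max n0 (max a b)"] ring_mono[of b "max n0 (max a b)"]
    by (intro that[of "max n0 (max a b)"]) (auto simp: le_max_iff_disj)
qed

lemma common_level_ids: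
  assumes "x \<in> D" "i \<in> ids"
  obtains n where "n0 \<le> n" "x \<in> A n" "i \<in> I n"
proof -
  obtain a b where "x \<in> A a" "i \<in> I b" using assms by (auto simp: D_def ids_def)
  thus ?thesis using ring_mono[of a "max n0 (max a b)"] index_mono[of b "max n0 (max a b)"]
    by (intro that[of "max n0 (max a b)"]) (auto simp: le_max_iff_disj)
qed

lemma finite_level:
  assumes "finite S" "S \<subseteq> D"
  obtains n where "n0 \<le> n" "S \<subseteq> A n"
  using assms
proof (induction S arbitrary: thesis rule: finite_induct)
  case empty
  thus ?case by blast
next
  case (insert x S)
  obtain n where n: "n0 \<le> n" "S \<subseteq> A n" using insert by auto
  obtain m where m: "n \<le> m" "x \<in> A m" using common_level[of x x n] insert(5) by auto
  show ?case using insert(4)[of m] n m ring_mono[of n m] by auto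
qed

sublocale D: field_subring D
proof
  show "1 \<in> D" using L.one_mem[of 0] level_subset_D by blast
  fix x y assume "x \<in> D" "y \<in> D"
  then obtain n where "x \<in> A n" "y \<in> A n" using common_level by blast
  thus "x - y \<in> D" "x * y \<in> D" using L.diff_mem L.mult_mem level_subset_D by blast+
qed

lemma princ_mono: "n \<le> m \<Longrightarrow> princ (A n) x \<subseteq> princ (A m) x"
  using ring_mono by (auto simp: princ_def)

lemma princ_level_subset_D: "princ (A n) x \<subseteq> princ D x"
  using level_subset_D by (auto simp: princ_def)

section \<open>Lying over and contraction between levels\<close>

lemma anc_mem: "j \<in> I (Suc n) \<Longrightarrow> anc n j \<in> I n"
  using par_mem by (auto simp: anc_def)

lemma gen_dvd_anc:
  assumes "j \<in> I (Suc n)"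
  shows "g n (anc n j) \<in> princ (A (Suc n)) (g (Suc n) j)"
proof -
  obtain u where u: "unit_in (A (Suc n)) u" "g n (anc n j) = u * g (Suc n) (anc n j) *
      (\<Prod>j\<in>{l \<in> I (Suc n) - I n. par l = anc n j}. (g (Suc n) j)\<^sup>2)" (is "_ = _ * _ * prod _ ?S")
    using gen_step[OF anc_mem[OF assms]] by blast
  have gA: "g (Suc n) j \<in> A (Suc n)" if "j \<in> I (Suc n)" for j using L.g_mem that by blast
  have anc: "anc n j \<in> I (Suc n)" using anc_mem[OF assms] index_step by blast
  show ?thesis
  proof (cases "j \<in> I n")
    case True
    hence "anc n j = j" by (simp add: anc_def)
    moreover have "u * g (Suc n) j \<in> princ (A (Suc n)) (g (Suc n) j)"
      using u(1) by (intro L.princ_multL) (simp add: unit_in_def)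
    moreover have "prod (\<lambda>j. (g (Suc n) j)\<^sup>2) ?S \<in> A (Suc n)"
      by (intro L.prod_mem L.power_mem gA) auto
    ultimately show ?thesis unfolding u(2) using L.princ_mult' by presburger
  next
    case False
    hence j: "j \<in> ?S" using assms by (auto simp: anc_def)
    have fin: "finite ?S" by (rule finite_subset[OF _ L.fin[of "Suc n"]]) auto
    have "(g (Suc n) j)\<^sup>2 \<in> princ (A (Suc n)) (g (Suc n) j)"
      by (intro L.princ_power[OF gA[OF assms] L.princ_self]) simp
    moreover have "prod (\<lambda>j. (g (Suc n) j)\<^sup>2) (?S - {j}) \<in> A (Suc n)"
      by (intro L.prod_mem L.power_mem gA) auto
    ultimately have "prod (\<lambda>j. (g (Suc n) j)\<^sup>2) ?S \<in> princ (A (Suc n)) (g (Suc n) j)"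
      unfolding prod.remove[OF fin j] using L.princ_mult' by blast
    thus ?thesis unfolding u(2) using u(1) gA[OF anc]
      by (intro L.princ_mult[rotated] L.mult_mem) (auto simp: unit_in_def)
  qed
qed

text \<open>One inclusion is divisibility. For the other, the ideal below is maximal: an element
  outside it is invertible modulo it, hence also modulo \<open>g (Suc n) j\<close>, and cannot lie
  in that proper ideal.\<close>

lemma contract_step:
  assumes "j \<in> I (Suc n)" "x \<in> A n"
  shows "x \<in> princ (A (Suc n)) (g (Suc n) j) \<longleftrightarrow> x \<in> princ (A n) (g n (anc n j))"
proof
  have sub: "princ (A n) (g n (anc n j)) \<subseteq> princ (A (Suc n)) (g (Suc n) j)"
    using L.princ_trans[OF gen_dvd_anc[OF assms(1)]] princ_mono[of n "Suc n" "g n (anc n j)"] by auto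
  thus "x \<in> princ (A n) (g n (anc n j)) \<Longrightarrow> x \<in> princ (A (Suc n)) (g (Suc n) j)" by blast
  assume x: "x \<in> princ (A (Suc n)) (g (Suc n) j)"
  show "x \<in> princ (A n) (g n (anc n j))"
  proof (rule ccontr)
    assume "x \<notin> princ (A n) (g n (anc n j))"
    then obtain y where y: "y \<in> A n" "x * y - 1 \<in> princ (A n) (g n (anc n j))"
      using max_elementD(4)[OF L.max_el[OF anc_mem[OF assms(1)]]] assms by blast
    hence "x * y - 1 \<in> princ (A (Suc n)) (g (Suc n) j)" "y \<in> A (Suc n)"
      using sub ring_step by blast+
    hence "x * y - (x * y - 1) \<in> princ (A (Suc n)) (g (Suc n) j)"
      using L.princ_diff[OF L.princ_mult'[OF _ x]] by blast
    thus False using max_elementD(3)[OF L.max_el[OF assms(1)]] by simp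
  qed
qed

lemma contract_same:
  assumes "n \<le> m" "i \<in> I n" "x \<in> A n"
  shows "x \<in> princ (A m) (g m i) \<longleftrightarrow> x \<in> princ (A n) (g n i)"
  using assms
proof (induction m rule: dec_induct)
  case (step m)
  have im: "i \<in> I m" using index_mono[of n m] step by auto
  hence "anc m i = i" "i \<in> I (Suc m)" using index_step by (auto simp: anc_def)
  thus ?case using step contract_step[of i m x] ring_mono[of n m] by auto
qed auto

text \<open>Iterates \<open>contract_step\<close> down to level \<open>n\<close>; every change of
  index on the way down raises the label.\<close>

lemma ancestor:
  assumes "n \<le> m" "i \<in> I m"
  shows "\<exists>j\<in>I n. lab i \<le> lab j \<and> (i \<notin> I n \<longrightarrow> lab i < lab j) \<and>
           (\<forall>x\<in>A n. x \<in> princ (A m) (g m i) \<longleftrightarrow> x \<in> princ (A n) (g n j))"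
  using assms
proof (induction m arbitrary: i rule: dec_induct)
  case base
  thus ?case by auto
next
  case (step m)
  define i' where "i' = anc m i"
  have i': "i' \<in> I m" "lab i \<le> lab i'" "i' \<noteq> i \<Longrightarrow> lab i < lab i'"
    using anc_mem[OF step(4)] lab_par[of i m] step(4) by (auto simp: i'_def anc_def intro: less_imp_le)
  obtain j where j: "j \<in> I n" "lab i' \<le> lab j" "i' \<notin> I n \<Longrightarrow> lab i' < lab j"
    "\<And>x. x \<in> A n \<Longrightarrow> x \<in> princ (A m) (g m i') \<longleftrightarrow> x \<in> princ (A n) (g n j)"
    using step(3)[OF i'(1)] by blast
  have "\<forall>x\<in>A n. x \<in> princ (A (Suc m)) (g (Suc m) i) \<longleftrightarrow> x \<in> princ (A n) (g n j)"
    using contract_step[OF step(4)] j(4) ring_mono[OF step(1)] unfolding i'_def by blast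
  thus ?case using i' j by (intro bexI[of _ j]) (auto dest: less_le_trans le_less_trans)
qed

section \<open>Maximal ideals of the union\<close>

lemma mem_max_at_iff:
  assumes "i \<in> I n" "x \<in> A n"
  shows "x \<in> max_at i \<longleftrightarrow> x \<in> princ (A n) (g n i)"
proof
  assume "x \<in> max_at i"
  then obtain m where m: "i \<in> I m" "x \<in> princ (A m) (g m i)" by (auto simp: max_at_def)
  have "x \<in> A m" using m L.princ_subset L.g_mem by blast
  thus "x \<in> princ (A n) (g n i)"
    using contract_same[of n m i x] contract_same[of m n i x] m assms by (cases "n \<le> m") auto
qed (use assms in \<open>auto simp: max_at_def\<close>)

lemma g_mem_max_at: "i \<in> I n \<Longrightarrow> g n i \<in> max_at i"
  using L.princ_self by (auto simp: max_at_def)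

lemma max_at_subset: "max_at i \<subseteq> D"
  unfolding max_at_def using L.princ_subset L.g_mem level_subset_D by blast

lemma one_notin_max_at: "1 \<notin> max_at i"
  unfolding max_at_def using max_elementD(3)[OF L.max_el] by blast

lemma ideal_max_at:
  assumes "i \<in> ids"
  shows "ideal (max_at i) (ring_on D)"
  unfolding D.ideal_on_iff
proof (intro conjI ballI)
  obtain n where "i \<in> I n" using assms by (auto simp: ids_def)
  thus "0 \<in> max_at i" using L.princ_zero by (auto simp: max_at_def)
  show "x + y \<in> max_at i" if "x \<in> max_at i" "y \<in> max_at i" for x y
  proof -
    have "x \<in> D" "y \<in> D" using that max_at_subset by auto
    then obtain a where a: "x \<in> A a" "y \<in> A a" using common_level[of x y 0] by blast
    then obtain n where n: "a \<le> n" "x \<in> A n" "i \<in> I n"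
      using common_level_ids[of x i a] assms level_subset_D by blast
    have "y \<in> A n" using a ring_mono[OF n(1)] by auto
    with n that show ?thesis
      using L.princ_add[of x n "g n i" y] L.add_mem[of x n y] by (simp add: mem_max_at_iff)
  qed
  show "x * y \<in> max_at i" if "x \<in> D" "y \<in> max_at i" for x y
  proof -
    have "x \<in> D" "y \<in> D" using that max_at_subset by auto
    then obtain a where a: "x \<in> A a" "y \<in> A a" using common_level[of x y 0] by blast
    then obtain n where n: "a \<le> n" "x \<in> A n" "i \<in> I n"
      using common_level_ids[of x i a] assms level_subset_D by blast
    have "y \<in> A n" using a ring_mono[OF n(1)] by auto
    with n that show ?thesis
      using L.princ_mult[of x n y "g n i"] L.mult_mem[of x n y] by (simp add: mem_max_at_iff)
  qed
qed (rule max_at_subset)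

lemma maximalideal_max_at:
  assumes "i \<in> ids"
  shows "maximalideal (max_at i) (ring_on D)"
proof (rule D.maximalideal_onI[OF ideal_max_at[OF assms] one_notin_max_at])
  fix x assume x: "x \<in> D" "x \<notin> max_at i"
  obtain n where n: "x \<in> A n" "i \<in> I n" using common_level_ids x assms by blast
  hence "x \<notin> princ (A n) (g n i)" using x mem_max_at_iff by auto
  then obtain y where y: "y \<in> A n" "x * y - 1 \<in> princ (A n) (g n i)"
    using max_elementD(4)[OF L.max_el] n by blast
  thus "\<exists>y\<in>D. x * y - 1 \<in> max_at i" using n level_subset_D by (auto simp: max_at_def)
qed

lemma max_at_inj: "inj_on max_at ids"
proof (rule inj_onI, rule ccontr)
  fix i j assume ij: "i \<in> ids" "j \<in> ids" "max_at i = max_at j" "i \<noteq> j"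
  obtain n where n: "i \<in> I n" using ij by (auto simp: ids_def)
  obtain m where m: "n \<le> m" "j \<in> I m" using common_level_ids[of 0 j n] ij D.zero_mem by blast
  hence "i \<in> I m" using n index_mono by blast
  moreover have "g m j \<in> max_at i" using g_mem_max_at m ij by auto
  ultimately have "g m j \<in> princ (A m) (g m i)" using mem_max_at_iff m L.g_mem by auto
  thus False using L.distinct \<open>i \<in> I m\<close> m ij by blast
qed

lemma maximalideal_nonzero:
  assumes "maximalideal N (ring_on D)"
  shows "\<exists>x\<in>N. x \<noteq> 0"
proof (rule ccontr)
  assume *: "\<not> ?thesis"
  obtain i where i: "i \<in> I 0" using index_nonempty by blast
  hence id: "i \<in> ids" by (auto simp: ids_def)
  have "N \<subseteq> max_at i" using * ideal_max_at[OF id] unfolding D.ideal_on_iff by auto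
  hence "max_at i = N"
    using D.maximalideal_onD(4)[OF assms ideal_max_at[OF id]] one_notin_max_at by blast
  thus False using g_mem_max_at[OF i] * L.g_nz[OF i] by auto
qed

text \<open>From some level on \<open>N\<close> contains exactly one generator per level, and these
  form a path compatible with \<open>anc\<close>. A change of index along the path lowers the label,
  which a well-order permits only finitely often. So infinite branches create no further maximal
  ideals, and their number stays countable.\<close>

lemma maximalideal_eq_max_at:
  assumes N: "maximalideal N (ring_on D)"
  shows "\<exists>i\<in>ids. N = max_at i"
proof -
  have Nid: "N \<subseteq> D" "\<And>x y. x \<in> D \<Longrightarrow> y \<in> N \<Longrightarrow> x * y \<in> N"
    "\<And>x y. x \<in> N \<Longrightarrow> y \<in> N \<Longrightarrow> x + y \<in> N"
    using D.maximalideal_onD(1)[OF N] unfolding D.ideal_on_iff by auto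
  obtain x where x: "x \<in> N" "x \<noteq> 0" using maximalideal_nonzero[OF N] by blast
  then obtain n0 where n0: "x \<in> A n0" using Nid by (auto simp: D_def)
  have ex: "\<exists>i\<in>I n. g n i \<in> N" if "n0 \<le> n" for n
  proof -
    have "x \<in> A n" using ring_mono that n0 by blast
    then obtain u k where uk: "unit_in (A n) u" "x = u * (\<Prod>i\<in>I n. g n i ^ k i)"
      using L.factor x by blast
    have "(\<Prod>i\<in>I n. g n i ^ k i) \<in> A n" by (rule L.prod_g_mem) auto
    hence "inverse u * x = (\<Prod>i\<in>I n. g n i ^ k i)" using uk by (simp add: unit_in_def field_simps)
    moreover have "inverse u * x \<in> N" using uk level_subset_D by (intro Nid x) (auto simp: unit_in_def)
    ultimately show ?thesis
      using D.maximalideal_prod[OF N L.fin, of n "g n" k] L.g_mem[of _ n] level_subset_D[of n] by auto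
  qed
  \<comment> \<open>Different generators of one level are comaximal, so a proper ideal cannot
    contain both.\<close>
  have uniq: "i = j" if ij: "i \<in> I n" "j \<in> I n" "g n i \<in> N" "g n j \<in> N" for i j n
  proof (rule ccontr)
    assume "i \<noteq> j"
    hence "g n j \<notin> princ (A n) (g n i)" using L.distinct ij by blast
    then obtain y z where yz: "y \<in> A n" "z \<in> A n" "g n j * y - 1 = g n i * z"
      using max_elementD(4)[OF L.max_el[OF ij(1)] L.g_mem[OF ij(2)]] by (auto simp: princ_def)
    have "y * g n j + (- z) * g n i \<in> N"
      using yz ij level_subset_D L.uminus_mem by (intro Nid) blast+
    moreover have "y * g n j + (- z) * g n i = 1" using yz by (simp add: algebra_simps)
    ultimately show False using D.maximalideal_onD(2)[OF N] by simp
  qed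
  define f where "f n = (SOME i. i \<in> I n \<and> g n i \<in> N)" for n
  have f: "f n \<in> I n" "g n (f n) \<in> N" if "n0 \<le> n" for n
    using someI_ex[of "\<lambda>i. i \<in> I n \<and> g n i \<in> N"] ex[OF that] by (auto simp: f_def)
  have anc_f: "anc n (f (Suc n)) = f n" if nn: "n0 \<le> n" for n
  proof (rule uniq)
    obtain z where "z \<in> A (Suc n)" "g n (anc n (f (Suc n))) = g (Suc n) (f (Suc n)) * z"
      using gen_dvd_anc[of "f (Suc n)" n] f(1)[of "Suc n"] nn by (auto simp: princ_def)
    thus "g n (anc n (f (Suc n))) \<in> N"
      using Nid(2)[of z "g (Suc n) (f (Suc n))"] f nn level_subset_D by (auto simp: mult.commute)
  qed (use f nn anc_mem in auto)
  \<comment> \<open>The least label on the path is attained at some level \<open>m\<close>; a change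
    of index after \<open>m\<close> would fall below it.\<close>
  define l where "l = (LEAST l. \<exists>n\<ge>n0. lab (f n) = l)"
  have "\<exists>n\<ge>n0. lab (f n) = l" unfolding l_def by (rule LeastI[of _ "lab (f n0)"]) auto
  then obtain m where m: "m \<ge> n0" "lab (f m) = l" by blast
  have l: "l \<le> lab (f n)" if "n0 \<le> n" for n
    unfolding l_def using that by (intro Least_le) auto
  have const: "f n = f m" if "m \<le> n" for n
    using that
  proof (induction n rule: dec_induct)
    case (step n)
    have "f (Suc n) \<in> I n"
    proof (rule ccontr)
      assume "f (Suc n) \<notin> I n"
      moreover from this have "par (f (Suc n)) = f n"
        using anc_f[of n] step m by (auto simp: anc_def)
      ultimately have "lab (f (Suc n)) < l"
        using lab_par[of "f (Suc n)" n] f(1)[of "Suc n"] step m by auto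
      thus False using l[of "Suc n"] step m by auto
    qed
    thus ?case using anc_f[of n] step m by (auto simp: anc_def)
  qed auto
  have id: "f m \<in> ids" using f m by (auto simp: ids_def)
  have "max_at (f m) \<subseteq> N"
  proof
    fix y assume y: "y \<in> max_at (f m)"
    then obtain a where "y \<in> A a" using max_at_subset by (auto simp: D_def)
    hence ya: "y \<in> A (max a m)" using ring_mono by (meson max.cobounded1 subsetD)
    have fi: "f m \<in> I (max a m)" "g (max a m) (f m) \<in> N"
      using f[of "max a m"] const[of "max a m"] m by auto
    hence "y \<in> princ (A (max a m)) (g (max a m) (f m))" using mem_max_at_iff ya y by auto
    then obtain z where "z \<in> A (max a m)" "y = g (max a m) (f m) * z" by (auto simp: princ_def)
    thus "y \<in> N" using Nid(2)[OF _ fi(2), of z] level_subset_D by (auto simp: mult.commute)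
  qed
  hence "N = max_at (f m)"
    using D.maximalideal_onD[OF maximalideal_max_at[OF id]] D.maximalideal_onD[OF N] by blast
  thus ?thesis using id by blast
qed

lemma Max_ideals_D: "Max_ideals (ring_on D) = max_at ` ids"
  unfolding Max_ideals_def using maximalideal_max_at maximalideal_eq_max_at by blast

text \<open>Along a fixed index the tower is unramified, so a single generator serves all later levels.\<close>

lemma gen_unramified:
  assumes "n \<le> m" "i \<in> I n"
  shows "\<exists>s\<in>A m. s \<notin> princ (A m) (g m i) \<and> g n i = g m i * s"
  using assms
proof (induction m rule: dec_induct)
  case base
  thus ?case using L.one_mem[of n] max_elementD(3)[OF L.max_el[of i n]]
    by (intro bexI[of _ 1]) simp_all
next
  case (step m)
  have im: "i \<in> I m" "i \<in> I (Suc m)" using index_mono[of n m] index_mono[of n "Suc m"] step(1,4) by auto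
  obtain s where s: "s \<in> A m" "s \<notin> princ (A m) (g m i)" "g n i = g m i * s" using step(3)[OF step(4)] by blast
  let ?S = "{j \<in> I (Suc m) - I m. par j = i}"
  obtain u where u: "unit_in (A (Suc m)) u"
    "g m i = u * g (Suc m) i * (\<Prod>j\<in>?S. (g (Suc m) j)\<^sup>2)"
    using gen_step[OF im(1)] by blast
  define t where "t = u * (\<Prod>j\<in>?S. (g (Suc m) j)\<^sup>2)"
  have "(\<Prod>j\<in>?S. (g (Suc m) j)\<^sup>2) \<in> A (Suc m)"
    by (intro L.prod_mem L.power_mem L.g_mem) auto
  hence t: "t \<in> A (Suc m)" "g m i = g (Suc m) i * t"
    using u(1) L.mult_mem[of u "Suc m"] unfolding t_def u(2) by (simp_all add: unit_in_def)
  \<comment> \<open>Apart from a unit, \<open>t\<close> is a product of squares of newly born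
    primes, and none of these is the old index \<open>i\<close>.\<close>
  have "t \<notin> princ (A (Suc m)) (g (Suc m) i)"
  proof
    assume "t \<in> princ (A (Suc m)) (g (Suc m) i)"
    hence pr: "(\<Prod>j\<in>?S. (g (Suc m) j)\<^sup>2) \<in> princ (A (Suc m)) (g (Suc m) i)"
      unfolding t_def L.unit_mult_mem_princ_iff[OF u(1)] .
    have "\<exists>j\<in>?S. (g (Suc m) j)\<^sup>2 \<in> princ (A (Suc m)) (g (Suc m) i)"
    proof (rule L.max_element_prime_prod[OF L.max_el[OF im(2)] _ _ pr])
      show "finite ?S" by (rule finite_subset[OF _ L.fin[of "Suc m"]]) auto
      show "(g (Suc m) j)\<^sup>2 \<in> A (Suc m)" if "j \<in> ?S" for j
        using that by (intro L.power_mem L.g_mem) auto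
    qed
    then obtain j where j: "j \<in> ?S" "(g (Suc m) j)\<^sup>2 \<in> princ (A (Suc m)) (g (Suc m) i)"
      by (rule bexE)
    have "j \<in> I (Suc m)" "j \<noteq> i" using j(1) im(1) by auto
    moreover have "g (Suc m) j \<in> princ (A (Suc m)) (g (Suc m) i)"
      by (rule L.max_element_prime_power[OF L.max_el[OF im(2)] L.g_mem j(2)]) fact
    ultimately show False using L.distinct[OF im(2), of j] by blast
  qed
  moreover have "s \<notin> princ (A (Suc m)) (g (Suc m) i)"
    using contract_same[of m "Suc m" i s] im(1) s(1,2) by simp
  moreover have sA: "s \<in> A (Suc m)" using s ring_step by blast
  ultimately have "t * s \<notin> princ (A (Suc m)) (g (Suc m) i)"
    using L.g_prime[OF im(2) t(1)] by blast
  moreover have "t * s \<in> A (Suc m)" using t(1) sA by (rule L.mult_mem)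
  ultimately show ?case using s(3) t(2) by (intro bexI[of _ "t * s"]) simp_all
qed

text \<open>The generator \<open>g n i\<close> of one fixed level is a uniformizer at
  \<open>max_at i\<close>: in a factorization \<open>x = g m i ^ k * r\<close> of a later level,
  \<open>g m i\<close> is traded for \<open>g n i\<close> at the cost of a factor prime to
  \<open>i\<close>.\<close>

lemma almost_dedekind_D: "almost_dedekind D"
  unfolding almost_dedekind_def
proof (intro conjI ballI)
  show "domain (ring_on D)" by (rule D.domain_ring_on)
  fix N assume "N \<in> Max_ideals (ring_on D)"
  then obtain i where i: "i \<in> ids" "N = max_at i" using Max_ideals_D by blast
  then obtain n where n: "i \<in> I n" by (auto simp: ids_def)
  show "discrete_valuation_ring (ring_on (localization_at D N))"
  proof (rule D.discrete_valuation_ring_localization_at)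
    show N: "maximalideal N (ring_on D)" using i maximalideal_max_at by simp
    show "g n i \<in> N" "g n i \<noteq> 0" using i n g_mem_max_at L.g_nz by auto
    fix x assume x: "x \<in> D" "x \<noteq> 0"
    obtain m where m: "n \<le> m" "x \<in> A m" using common_level[of x x n] x by blast
    have im: "i \<in> I m" using index_mono m n by blast
    obtain k r where r: "r \<in> A m" "r \<notin> princ (A m) (g m i)" "x = g m i ^ k * r"
      using L.extract_power[OF m(2) x(2) im] by blast
    obtain s where s: "s \<in> A m" "s \<notin> princ (A m) (g m i)" "g n i = g m i * s"
      using gen_unramified[OF m(1) n] by blast
    have "s ^ k \<notin> princ (A m) (g m i)" "s ^ k \<in> A m"
      using L.max_element_prime_power[OF L.max_el[OF im]] s L.power_mem by blast+
    hence "s ^ k \<in> D - N" "r \<in> D - N" "x * s ^ k = g n i ^ k * r"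
      using r s i mem_max_at_iff[OF im] level_subset_D by (auto simp: power_mult_distrib mult_ac)
    thus "\<exists>k. \<exists>r\<in>D - N. \<exists>s\<in>D - N. x * s = g n i ^ k * r" by blast
  qed
qed

end

section \<open>Critical ideals of a tower\<close>

context tower
begin

text \<open>Indices of level 0 are nobody's children, whatever value \<open>par\<close> takes there;
  hence the clause about birth.\<close>

definition children :: "'i \<Rightarrow> 'i set" where
  "children i = {j. par j = i \<and> (\<exists>n. j \<in> I (Suc n) - I n)}"

lemma birth:
  assumes "j \<in> ids - I n"
  obtains m where "n \<le> m" "j \<in> I (Suc m) - I m"
proof -
  obtain k where k: "j \<in> I k" using assms by (auto simp: ids_def)
  define m where "m = (LEAST k. j \<in> I k)"
  have m: "j \<in> I m" unfolding m_def using k by (rule LeastI)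
  have "n < m" using m assms index_mono[of m n] by (cases "n < m") auto
  then obtain l where l: "m = Suc l" by (cases m) auto
  have "j \<notin> I l" using not_less_Least[of l "\<lambda>k. j \<in> I k"] l unfolding m_def by simp
  thus ?thesis using that[of l] m l \<open>n < m\<close> by simp
qed

lemma children_eq: "children i = {j \<in> ids - I 0. par j = i}"
proof (intro subset_antisym subsetI)
  fix j assume "j \<in> children i"
  then obtain n where "j \<in> I (Suc n) - I n" "par j = i" by (auto simp: children_def)
  thus "j \<in> {j \<in> ids - I 0. par j = i}" using index_mono[of 0 n] by (auto simp: ids_def)
next
  fix j assume j: "j \<in> {j \<in> ids - I 0. par j = i}"
  then obtain m where "j \<in> I (Suc m) - I m" using birth[of j 0] by blast
  thus "j \<in> children i" using j by (auto simp: children_def)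
qed

text \<open>With no child born after level \<open>n\<close> the product in \<open>gen_step\<close>
  is empty, so the generator changes by units only.\<close>

lemma gen_eq_if_childless:
  assumes "n \<le> m" "i \<in> I n" "children i \<subseteq> I n"
  shows "\<exists>u. unit_in (A m) u \<and> g n i = u * g m i"
  using assms
proof (induction m rule: dec_induct)
  case base
  thus ?case using L.unit_in_one by (intro exI[of _ 1]) simp
next
  case (step m)
  have im: "i \<in> I m" using index_mono[of n m] step(1,4) by auto
  obtain u where u: "unit_in (A m) u" "g n i = u * g m i" using step(3-5) by blast
  have *: "{j \<in> I (Suc m) - I m. par j = i} = {}"
    using step(5) index_mono[OF step(1)] by (auto simp: children_def)
  obtain v where v: "unit_in (A (Suc m)) v" "g m i = v * g (Suc m) i"
    using gen_step[OF im] unfolding * prod.empty mult_1_right by blast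
  have "unit_in (A (Suc m)) u" using u(1) ring_step unfolding unit_in_def by blast
  hence "unit_in (A (Suc m)) (u * v)" using v(1) by (rule L.unit_in_mult)
  thus ?case using u(2) v(2) by (intro exI[of _ "u * v"]) simp
qed

text \<open>Once all children are born, a single \<open>g n i\<close> generates
  \<open>max_at i\<close> in \<open>D\<close>; this maximal ideal is then itself a nonzero finitely
  generated radical ideal.\<close>

lemma not_Crit_if_finite_children:
  assumes i: "i \<in> ids" and fin: "finite (children i)"
  shows "max_at i \<notin> Crit (ring_on D)"
proof -
  obtain k where k: "i \<in> I k" using i by (auto simp: ids_def)
  have "\<exists>n\<ge>k. C \<subseteq> I n" if "finite C" "C \<subseteq> ids" for C
    using that
  proof (induction C rule: finite_induct)
    case (insert j C)
    then obtain n a where n: "k \<le> n" "C \<subseteq> I n" "j \<in> I a" by (auto simp: ids_def)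
    thus ?case using index_mono[of n "max n a"] index_mono[of a "max n a"]
      by (intro exI[of _ "max n a"]) auto
  qed auto
  moreover have "children i \<subseteq> ids" unfolding children_eq by auto
  ultimately obtain n where n: "k \<le> n" "children i \<subseteq> I n" using fin by blast
  have iIn: "i \<in> I n" using k n index_mono by blast
  define t where "t = g n i"
  have tD: "t \<in> D" using L.g_mem[OF iIn] level_subset_D by (auto simp: t_def)
  have "max_at i = princ D t"
  proof
    show "max_at i \<subseteq> princ D t"
    proof
      fix x assume x: "x \<in> max_at i"
      then obtain m where m: "n \<le> m" "x \<in> A m" using common_level[of x x n] max_at_subset by blast
      have im: "i \<in> I m" using index_mono[OF m(1)] iIn by blast
      obtain u where u: "unit_in (A m) u" "t = u * g m i"
        using gen_eq_if_childless[OF m(1) iIn n(2)] by (auto simp: t_def)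
      have "x \<in> princ (A m) (g m i)" using mem_max_at_iff[OF im m(2)] x by simp
      hence "x \<in> princ (A m) t" unfolding u(2) L.princ_unit_multL[OF u(1)] .
      thus "x \<in> princ D t" using princ_level_subset_D by blast
    qed
    have "t \<in> max_at i" using g_mem_max_at[OF iIn] by (simp add: t_def)
    thus "princ D t \<subseteq> max_at i"
      using ideal_max_at[OF i] unfolding D.ideal_on_iff princ_def by (auto simp: mult.commute)
  qed
  moreover have "fin_gen_ideal (princ D t) (ring_on D)"
    unfolding fin_gen_ideal_def using D.genideal_princ[OF tD] tD by (intro exI[of _ "{t}"]) auto
  moreover have "radical_ideal (max_at i) (ring_on D)"
    unfolding radical_ideal_def
  proof (intro conjI ballI allI impI ideal_max_at[OF i])
    fix x and e :: nat assume x: "x \<in> carrier (ring_on D)" "x [^]\<^bsub>ring_on D\<^esub> e \<in> max_at i"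
    have "(\<Prod>j\<in>{i}. x ^ e) \<in> max_at i" using x by simp
    thus "x \<in> max_at i"
      using D.maximalideal_prod[OF maximalideal_max_at[OF i], of "{i}" "\<lambda>_. x" "\<lambda>_. e"] x by simp
  qed
  moreover have "max_at i \<noteq> {0}" using g_mem_max_at[OF iIn] L.g_nz[OF iIn] by auto
  ultimately show ?thesis unfolding Crit_def by auto
qed

text \<open>A child of \<open>i\<close> doubles the multiplicity of every element of \<open>max_at i\<close> from
  the previous level, which is incompatible with lying in a radical ideal.\<close>

lemma Crit_if_infinite_children:
  assumes i: "i \<in> ids" and inf: "infinite (children i)"
  shows "max_at i \<in> Crit (ring_on D)"
  unfolding Crit_def
proof (intro CollectI conjI notI)
  show "max_at i \<in> Max_ideals (ring_on D)" using i Max_ideals_D by blast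
  assume "\<exists>J\<subseteq>max_at i. J \<noteq> {\<zero>\<^bsub>ring_on D\<^esub>} \<and> fin_gen_ideal J (ring_on D) \<and> radical_ideal J (ring_on D)"
  then obtain J S where J: "J \<subseteq> max_at i" "J \<noteq> {0}" "radical_ideal J (ring_on D)"
    and S: "finite S" "S \<subseteq> D" "J = genideal (ring_on D) S"
    unfolding fin_gen_ideal_def by auto
  have SJ: "S \<subseteq> J" unfolding S(3) using S(2) by (intro D.R.genideal_self) auto
  have minJ: "J \<subseteq> K" if "ideal K (ring_on D)" "S \<subseteq> K" for K
    unfolding S(3) using that by (rule D.R.genideal_minimal)
  obtain k where k: "i \<in> I k" using i by (auto simp: ids_def)
  \<comment> \<open>All generators of \<open>J\<close> live at one level, while infinitely many
    children leave one, \<open>j\<close>, that is born later.\<close>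
  obtain n where n: "k \<le> n" "S \<subseteq> A n" using finite_level[OF S(1,2)] by blast
  have "\<not> children i \<subseteq> I n" using inf L.fin finite_subset by blast
  then obtain j where j: "j \<in> children i" "j \<notin> I n" by blast
  hence "j \<in> ids - I n" "par j = i" by (auto simp: children_eq)
  then obtain m where m: "n \<le> m" "j \<in> I (Suc m) - I m" using birth by blast
  have im: "i \<in> I m" using index_mono k n(1) m(1) by (meson order_trans subsetD)
  let ?B = "A (Suc m)"
  define q where "q = g (Suc m) j"
  have q: "max_element ?B q" using L.max_el m by (auto simp: q_def)
  have qB: "q \<in> ?B" "q \<noteq> 0" using max_elementD[OF q] by auto
  have qD: "q \<in> D" using qB level_subset_D by blast
  have q2: "g m i \<in> princ ?B (q\<^sup>2)"
  proof -
    let ?C = "{j \<in> I (Suc m) - I m. par j = i}"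
    obtain u where u: "unit_in ?B u" "g m i = u * g (Suc m) i * (\<Prod>j\<in>?C. (g (Suc m) j)\<^sup>2)"
      using gen_step[OF im] by blast
    have jC: "j \<in> ?C" and finC: "finite ?C"
      using m \<open>par j = i\<close> finite_subset[OF _ L.fin[of "Suc m"], of ?C] by auto
    have eq: "g m i = q\<^sup>2 * (u * g (Suc m) i * (\<Prod>j\<in>?C - {j}. (g (Suc m) j)\<^sup>2))"
      unfolding u(2) prod.remove[OF finC jC] q_def by (simp add: mult_ac)
    have "u * g (Suc m) i * (\<Prod>j\<in>?C - {j}. (g (Suc m) j)\<^sup>2) \<in> ?B"
      using u(1) im index_step
      by (intro L.mult_mem L.prod_mem L.power_mem L.g_mem) (auto simp: unit_in_def)
    thus ?thesis unfolding eq by (rule L.princ_multR)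
  qed
  have SB: "S \<subseteq> ?B" using n(2) ring_mono[of n "Suc m"] m(1) by auto
  have Sq: "s \<in> princ ?B (q\<^sup>2)" if "s \<in> S" for s
  proof -
    have "s \<in> A m" "s \<in> max_at i" using that n(2) ring_mono[OF m(1)] SJ J(1) by auto
    hence "s \<in> princ (A m) (g m i)" using mem_max_at_iff im by auto
    hence "s \<in> princ ?B (g m i)" using princ_mono[of m "Suc m"] by auto
    thus ?thesis using L.princ_trans[OF q2] by blast
  qed
  \<comment> \<open>\<open>P e\<close> says that some generator of \<open>J\<close> has exact order
    \<open>e\<close> at the new prime \<open>q\<close>. The least such \<open>e\<close> is the order
    of \<open>J\<close> at \<open>q\<close>, and it is at least 2 because \<open>q\<^sup>2\<close>
    divides \<open>g m i\<close>.\<close>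
  define P where "P e \<longleftrightarrow> (\<exists>s\<in>S. \<exists>t\<in>?B. t \<notin> princ ?B q \<and> s = q ^ e * t)" for e
  have ex: "\<exists>e. P e \<and> s \<in> princ ?B (q ^ e)" if s: "s \<in> S" "s \<noteq> 0" for s
  proof -
    have jI: "j \<in> I (Suc m)" and sB: "s \<in> ?B" using m(2) s SB by auto
    obtain e t where et: "t \<in> ?B" "t \<notin> princ ?B q" "s = q ^ e * t"
      using L.extract_power[OF sB s(2) jI] unfolding q_def by blast
    hence "P e" unfolding P_def using s(1) by blast
    moreover have "s \<in> princ ?B (q ^ e)" unfolding et(3) by (rule L.princ_multR[OF et(1)])
    ultimately show ?thesis by blast
  qed
  have "\<not> S \<subseteq> {0}"
  proof
    assume "S \<subseteq> {0}"
    hence "J \<subseteq> {0}" by (intro minJ) (auto simp: D.ideal_on_iff D.zero_mem)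
    moreover have "0 \<in> J" using J(3) unfolding radical_ideal_def D.ideal_on_iff by blast
    ultimately show False using J(2) by blast
  qed
  then obtain e' where "P e'" using ex by blast
  define e where "e = (LEAST e. P e)"
  have "P e" and le: "\<And>l. P l \<Longrightarrow> e \<le> l"
    unfolding e_def using \<open>P e'\<close> by (auto intro: LeastI Least_le)
  then obtain s t where st: "s \<in> S" "t \<in> ?B" "t \<notin> princ ?B q" "s = q ^ e * t"
    unfolding P_def by blast
  have e2: "2 \<le> e"
  proof (rule ccontr)
    assume "\<not> 2 \<le> e"
    hence e: "e = 0 \<or> e = 1" by auto
    obtain y where y: "y \<in> ?B" "s = q\<^sup>2 * y" using Sq[OF st(1)] by (auto simp: princ_def)
    have "q ^ e * t = q * (q * y)"
      using y(2) st(4) by (simp add: power2_eq_square mult.assoc)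
    hence "t = q * (q * y) \<or> t = q * y" using e qB(2) by auto
    moreover have "q * y \<in> ?B" using qB(1) y(1) by (rule L.mult_mem)
    ultimately have "t \<in> princ ?B q" using y(1) by (auto simp: princ_def)
    thus False using st(3) by simp
  qed
  have "J \<subseteq> princ D (q ^ e)"
  proof (rule minJ)
    show "ideal (princ D (q ^ e)) (ring_on D)"
      using D.power_mem[OF qD] by (rule D.ideal_princ)
    show "S \<subseteq> princ D (q ^ e)"
    proof
      fix s assume s: "s \<in> S"
      show "s \<in> princ D (q ^ e)"
      proof (cases "s = 0")
        case False
        then obtain l where l: "P l" "s \<in> princ ?B (q ^ l)" using ex s by blast
        have "q ^ l = q ^ e * q ^ (l - e)" using le[OF l(1)] by (simp add: power_add[symmetric])
        moreover have "q ^ e * q ^ (l - e) \<in> princ D (q ^ e)"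
          by (rule D.princ_multR[OF D.power_mem[OF qD]])
        ultimately have "q ^ l \<in> princ D (q ^ e)" by simp
        moreover have "s \<in> princ D (q ^ l)" using l(2) princ_level_subset_D by blast
        ultimately show ?thesis by (rule D.princ_trans)
      qed (simp add: D.princ_zero)
    qed
  qed
  \<comment> \<open>Radicality enters here: \<open>(q * t) ^ e\<close> is a multiple of
    \<open>s = q ^ e * t\<close>, so \<open>J\<close> contains an element of order one at
    \<open>q\<close>, against \<open>J \<subseteq> princ D (q ^ e)\<close>.\<close>
  moreover have "q * t \<in> J"
  proof -
    have tD: "t \<in> D" using st(2) level_subset_D by blast
    have "t ^ (e - 1) * s \<in> J"
      using J(3) SJ st(1) D.power_mem[OF tD] unfolding radical_ideal_def D.ideal_on_iff by blast
    moreover have "t ^ e = t ^ (e - 1) * t" using e2 by (cases e) auto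
    hence "t ^ (e - 1) * s = (q * t) ^ e"
      unfolding st(4) by (simp add: power_mult_distrib mult_ac)
    ultimately have "(q * t) [^]\<^bsub>ring_on D\<^esub> e \<in> J" by simp
    moreover have "q * t \<in> carrier (ring_on D)" using D.mult_mem[OF qD tD] by simp
    ultimately show ?thesis using J(3) unfolding radical_ideal_def by blast
  qed
  ultimately obtain z where z: "z \<in> D" "q * t = q ^ e * z" by (auto simp: princ_def)
  obtain d where d: "e = 2 + d" using le_Suc_ex[OF e2] by blast
  hence "q * t = q * (q * (q ^ d * z))"
    using z(2) by (simp only: power_add power2_eq_square mult.assoc)
  hence t: "t = q * (q ^ d * z)" using qB(2) by simp
  \<comment> \<open>The divisibility of \<open>t\<close> by \<open>q\<close> is known only in
    \<open>D\<close>; \<open>max_at j\<close> carries it back to level \<open>Suc m\<close>, where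
    \<open>t\<close> was chosen prime to \<open>q\<close>.\<close>
  have jids: "j \<in> ids" and jI: "j \<in> I (Suc m)" using m by (auto simp: ids_def)
  have "q \<in> max_at j" unfolding q_def by (rule g_mem_max_at[OF jI])
  moreover have "q ^ d * z \<in> D" using z(1) D.power_mem[OF qD] D.mult_mem by blast
  ultimately have "(q ^ d * z) * q \<in> max_at j"
    using ideal_max_at[OF jids] unfolding D.ideal_on_iff by blast
  hence "t \<in> max_at j" unfolding t by (simp only: mult.commute)
  hence "t \<in> princ ?B q" using mem_max_at_iff[OF jI st(2)] by (simp add: q_def)
  with st(3) show False by simp
qed

lemma Crit_D_iff: "i \<in> ids \<Longrightarrow> max_at i \<in> Crit (ring_on D) \<longleftrightarrow> infinite (children i)"
  using Crit_if_infinite_children not_Crit_if_finite_children by blast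

lemma quotient_field_level:
  assumes "x \<in> quotient_field D"
  shows "\<exists>n. x \<in> quotient_field (A n)"
proof -
  obtain a s where as: "a \<in> D" "s \<in> D" "s \<noteq> 0" "x = a / s"
    using assms by (auto simp: quotient_field_def)
  obtain n where "a \<in> A n" "s \<in> A n" using common_level[OF as(1,2)] by blast
  thus ?thesis using L.quotient_field_memI as by blast
qed

text \<open>An equation over \<open>A 0\<close> is one over the level at which \<open>x\<close>
  becomes a fraction, and that level is integrally closed.\<close>

lemma integrally_closed_D:
  assumes "x \<in> quotient_field D" "lead_coeff q = 1" "\<And>i. coeff q i \<in> A 0" "poly q x = 0"
  shows "x \<in> D"
proof -
  obtain n where "x \<in> quotient_field (A n)" using quotient_field_level[OF assms(1)] by blast
  moreover have "coeff q i \<in> A n" for i using assms(3) ring_mono[of 0 n] by auto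
  ultimately have "x \<in> A n" using L.integrally_closed assms by blast
  thus ?thesis using level_subset_D by blast
qed

section \<open>Localizing a tower at the primes with label at least \<gamma>\<close>

context
  fixes \<gamma> :: 'o
  assumes root: "\<exists>i\<in>I 0. \<gamma> \<le> lab i"
begin

text \<open>The restriction is closed under taking parents, because a parent has a larger label than
  its child; this is what makes the localized data a tower again.\<close>

definition idx :: "nat \<Rightarrow> 'i set" where
  "idx n = {i \<in> I n. \<gamma> \<le> lab i}"

definition loc :: "nat \<Rightarrow> 'k set" where
  "loc n = frac_ring (A n) (L.avoid n (idx n))"

lemma idx_props: "idx n \<subseteq> I n" "idx n \<noteq> {}"
  using root index_mono[of 0 n] by (auto simp: idx_def)

text \<open>Passing to \<open>anc\<close> does not lower labels, so a kept prime of level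
  \<open>Suc n\<close> lies over a kept prime of level \<open>n\<close>, and admissible denominators
  stay admissible.\<close>

lemma avoid_step: "L.avoid n (idx n) \<subseteq> L.avoid (Suc n) (idx (Suc n))"
proof
  fix s assume s: "s \<in> L.avoid n (idx n)"
  hence sA: "s \<in> A n" by (simp add: L.avoid_def)
  have "s \<notin> princ (A (Suc n)) (g (Suc n) i)" if i: "i \<in> idx (Suc n)" for i
  proof -
    have iI: "i \<in> I (Suc n)" "\<gamma> \<le> lab i" using i by (auto simp: idx_def)
    have "lab i \<le> lab (anc n i)" using lab_par[of i n] iI by (auto simp: anc_def intro: less_imp_le)
    hence "anc n i \<in> idx n" using anc_mem[OF iI(1)] iI(2) by (auto simp: idx_def)
    thus ?thesis using contract_step[OF iI(1) sA] s by (auto simp: L.avoid_def)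
  qed
  thus "s \<in> L.avoid (Suc n) (idx (Suc n))" using sA ring_step by (auto simp: L.avoid_def)
qed

lemma avoid_mono: "n \<le> m \<Longrightarrow> L.avoid n (idx n) \<subseteq> L.avoid m (idx m)"
  by (rule lift_Suc_mono_le[of "\<lambda>n. L.avoid n (idx n)"]) (use avoid_step in auto)

lemma level_subset_loc: "A n \<subseteq> loc n"
  unfolding loc_def by (rule L.subset_frac_ring[OF L.avoid_props(2)[OF idx_props]])

text \<open>Discarded primes become units, and the squares of discarded children are absorbed into
  the unit of \<open>gen_step\<close>.\<close>

interpretation T: tower loc idx g par lab
proof (rule tower.intro)
  show "semilocal (loc n) (idx n) (g n)" for n
    unfolding loc_def by (rule L.semilocal_frac_avoid[OF idx_props])
  show "loc n \<subseteq> loc (Suc n)" for n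
    using avoid_step[of n] ring_step[of n] unfolding loc_def frac_ring_def by blast
  show "idx n \<subseteq> idx (Suc n)" for n using index_step by (auto simp: idx_def)
  show "idx 0 \<noteq> {}" by (rule idx_props)
  fix j n assume j: "j \<in> idx (Suc n) - idx n"
  hence jI: "j \<in> I (Suc n) - I n" "\<gamma> \<le> lab j" by (auto simp: idx_def)
  show "lab j < lab (par j)" by (rule lab_par[OF jI(1)])
  thus "par j \<in> idx n" using par_mem[OF jI(1)] jI(2) by (auto simp: idx_def)
next
  fix i n assume i: "i \<in> idx n"
  hence iI: "i \<in> I n" by (auto simp: idx_def)
  interpret T: semilocal "loc k" "idx k" "g k" for k
    unfolding loc_def by (rule L.semilocal_frac_avoid[OF idx_props])
  let ?S = "{j \<in> I (Suc n) - I n. par j = i}" and ?S' = "{j \<in> idx (Suc n) - idx n. par j = i}"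
  obtain u where u: "unit_in (A (Suc n)) u" "g n i = u * g (Suc n) i * (\<Prod>j\<in>?S. (g (Suc n) j)\<^sup>2)"
    using gen_step[OF iI] by blast
  have fin: "finite ?S" by (rule finite_subset[OF _ L.fin[of "Suc n"]]) auto
  have sub: "?S' \<subseteq> ?S" by (auto simp: idx_def)
  have unit: "unit_in (loc (Suc n)) (g (Suc n) j)" if "j \<in> ?S - ?S'" for j
  proof -
    have "j \<in> I (Suc n) - idx (Suc n)" using that by (auto simp: idx_def)
    thus ?thesis unfolding loc_def
      by (intro L.unit_in_frac_avoid[OF idx_props] L.g_mem_avoid[OF idx_props(1)])
  qed
  have "unit_in (loc (Suc n)) (u * (\<Prod>j\<in>?S - ?S'. (g (Suc n) j)\<^sup>2))"
    using u(1) level_subset_loc unit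
    by (intro T.unit_in_mult T.unit_in_prod T.unit_in_power) (auto simp: unit_in_def)
  moreover have "g n i = u * (\<Prod>j\<in>?S - ?S'. (g (Suc n) j)\<^sup>2) * g (Suc n) i *
      (\<Prod>j\<in>?S'. (g (Suc n) j)\<^sup>2)"
    unfolding u(2) prod.subset_diff[OF sub fin] by (simp add: mult_ac)
  ultimately show "\<exists>u. unit_in (loc (Suc n)) u \<and> g n i = u * g (Suc n) i *
      (\<Prod>j\<in>?S'. (g (Suc n) j)\<^sup>2)" by blast
qed

lemma T_ids: "T.ids = {i \<in> ids. \<gamma> \<le> lab i}"
  by (auto simp: T.ids_def ids_def idx_def)

text \<open>For the inclusion into \<open>T.D\<close> the fraction is taken reduced: if a kept prime
  divided the denominator, membership in the localization there would make it divide the numerator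
  too.\<close>

lemma overring_of_max_at: "overring_of D (max_at ` {i \<in> ids. \<gamma> \<le> lab i}) = T.D"
proof
  show "T.D \<subseteq> overring_of D (max_at ` {i \<in> ids. \<gamma> \<le> lab i})"
  proof
    fix x assume "x \<in> T.D"
    then obtain n a s where as: "x = a / s" "a \<in> A n" "s \<in> L.avoid n (idx n)"
      unfolding T.D_def loc_def frac_ring_def by blast
    have s: "s \<in> A n" "s \<noteq> 0" using as(3) L.avoid_props(3)[OF idx_props, of n] by (auto simp: L.avoid_def)
    have "x \<in> localization_at D (max_at i)" if i: "i \<in> ids" "\<gamma> \<le> lab i" for i
    proof -
      \<comment> \<open>The index \<open>i\<close> may be born after level \<open>n\<close>;
        \<open>avoid_mono\<close> moves the denominator to a level where \<open>i\<close>
        exists.\<close>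
      obtain m where m: "n \<le> m" "i \<in> I m" using common_level_ids[OF D.zero_mem i(1), of n] by blast
      have "s \<in> L.avoid m (idx m)" using avoid_mono[OF m(1)] as(3) by blast
      hence "s \<in> A m" "s \<notin> princ (A m) (g m i)" using m(2) i(2) by (auto simp: L.avoid_def idx_def)
      hence "s \<in> D - max_at i" using mem_max_at_iff[OF m(2)] level_subset_D by blast
      thus ?thesis using as(1,2) level_subset_D unfolding localization_at_def by blast
    qed
    moreover have "x \<in> quotient_field D"
      using as s level_subset_D D.quotient_field_memI by blast
    ultimately show "x \<in> overring_of D (max_at ` {i \<in> ids. \<gamma> \<le> lab i})"
      unfolding overring_of_def by blast
  qed
  show "overring_of D (max_at ` {i \<in> ids. \<gamma> \<le> lab i}) \<subseteq> T.D"
  proof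
    fix x assume x: "x \<in> overring_of D (max_at ` {i \<in> ids. \<gamma> \<le> lab i})"
    then obtain n where "x \<in> quotient_field (A n)"
      using quotient_field_level by (auto simp: overring_of_def)
    then obtain a s where as: "a \<in> A n" "s \<in> A n" "s \<noteq> 0" "x = a / s"
      and red: "\<And>i. i \<in> I n \<Longrightarrow> a \<in> princ (A n) (g n i) \<Longrightarrow> s \<notin> princ (A n) (g n i)"
      using L.reduced_fraction by blast
    have "s \<notin> princ (A n) (g n i)" if i: "i \<in> idx n" for i
    proof
      assume s: "s \<in> princ (A n) (g n i)"
      have iI: "i \<in> I n" "\<gamma> \<le> lab i" using i by (auto simp: idx_def)
      hence id: "i \<in> ids" by (auto simp: ids_def)
      have "x \<in> localization_at D (max_at i)" using x iI(2) id by (auto simp: overring_of_def)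
      then obtain b t where bt: "b \<in> D" "t \<in> D" "t \<notin> max_at i" "x = b / t"
        unfolding localization_at_def by blast
      have idl: "0 \<in> max_at i" "\<And>x y. x \<in> D \<Longrightarrow> y \<in> max_at i \<Longrightarrow> x * y \<in> max_at i"
        using ideal_max_at[OF id] unfolding D.ideal_on_iff by auto
      hence "t \<noteq> 0" using bt by auto
      hence "a * t = b * s" using bt(4) as(3,4) by (simp add: frac_eq_eq)
      moreover have "s \<in> max_at i" using mem_max_at_iff[OF iI(1) as(2)] s by simp
      ultimately have "a * t \<in> max_at i" using idl(2) bt(1) by simp
      hence "a \<in> max_at i"
        using D.maximalideal_onD(3)[OF maximalideal_max_at[OF id]] bt as(1) level_subset_D by blast
      hence "a \<in> princ (A n) (g n i)" using mem_max_at_iff[OF iI(1) as(1)] by simp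
      thus False using red[OF iI(1)] s by blast
    qed
    hence "s \<in> L.avoid n (idx n)" using as(2) by (simp add: L.avoid_def)
    hence "x \<in> loc n" unfolding loc_def as(4) using as(1) by (intro L.frac_ring_memI)
    thus "x \<in> T.D" unfolding T.D_def by blast
  qed
qed

lemma D_subset_T: "D \<subseteq> T.D"
  unfolding D_def T.D_def using level_subset_loc by blast

text \<open>A discarded prime contains some \<open>g n i\<close> that is a unit of
  \<open>loc n\<close>. For a kept prime, both ideals are generated by the elements
  \<open>g n i\<close>.\<close>

lemma genideal_max_at:
  assumes "i \<in> ids"
  shows "genideal (ring_on T.D) (max_at i) = (if \<gamma> \<le> lab i then T.max_at i else T.D)"
proof -
  have sub: "max_at i \<subseteq> T.D" using max_at_subset D_subset_T by blast
  have gen: "ideal (genideal (ring_on T.D) (max_at i)) (ring_on T.D)"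
    "max_at i \<subseteq> genideal (ring_on T.D) (max_at i)"
    using T.D.R.genideal_ideal[of "max_at i"] T.D.R.genideal_self[of "max_at i"] sub by auto
  hence gen': "x \<in> T.D \<Longrightarrow> y \<in> max_at i \<Longrightarrow> x * y \<in> genideal (ring_on T.D) (max_at i)" for x y
    unfolding T.D.ideal_on_iff by blast
  show ?thesis
  proof (cases "\<gamma> \<le> lab i")
    case True
    hence id: "i \<in> T.ids" using assms T_ids by simp
    have "max_at i \<subseteq> T.max_at i"
    proof
      fix x assume "x \<in> max_at i"
      then obtain n where n: "i \<in> I n" "x \<in> princ (A n) (g n i)" by (auto simp: max_at_def)
      hence "i \<in> idx n" "x \<in> princ (loc n) (g n i)"
        using True level_subset_loc by (auto simp: idx_def princ_def)
      thus "x \<in> T.max_at i" by (auto simp: T.max_at_def)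
    qed
    hence "genideal (ring_on T.D) (max_at i) \<subseteq> T.max_at i"
      using T.D.R.genideal_minimal[OF T.ideal_max_at[OF id]] by blast
    moreover have "T.max_at i \<subseteq> genideal (ring_on T.D) (max_at i)"
    proof
      fix x assume "x \<in> T.max_at i"
      then obtain n z where n: "i \<in> idx n" "z \<in> loc n" "x = z * g n i"
        by (auto simp: T.max_at_def princ_def mult.commute)
      have "g n i \<in> max_at i" using n(1) by (intro g_mem_max_at) (auto simp: idx_def)
      moreover have "z \<in> T.D" using n(2) by (auto simp: T.D_def)
      ultimately show "x \<in> genideal (ring_on T.D) (max_at i)" unfolding n(3) by (intro gen')
    qed
    ultimately show ?thesis using True by auto
  next
    case False
    obtain n where n: "i \<in> I n" using assms by (auto simp: ids_def)
    hence "i \<in> I n - idx n" using False by (auto simp: idx_def)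
    hence "unit_in (loc n) (g n i)" unfolding loc_def
      by (intro L.unit_in_frac_avoid[OF idx_props] L.g_mem_avoid[OF idx_props(1)])
    hence "inverse (g n i) \<in> T.D" "g n i \<noteq> 0" unfolding unit_in_def T.D_def by auto
    hence "1 \<in> genideal (ring_on T.D) (max_at i)"
      using gen'[OF _ g_mem_max_at[OF n], of "inverse (g n i)"] by simp
    thus ?thesis using T.D.ideal_one[OF gen(1)] False by simp
  qed
qed

text \<open>The children criterion is applied to the localized tower, whose union is the overring
  and whose children are the old ones with label at least \<gamma>. Discarded primes drop out
  because they extend to the unit ideal.\<close>

lemma crit_step_max_at:
  "crit_step D (max_at ` {i \<in> ids. \<gamma> \<le> lab i}) =
     max_at ` {i \<in> ids. \<gamma> \<le> lab i \<and> infinite {j \<in> ids - I 0. par j = i \<and> \<gamma> \<le> lab j}}"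
proof -
  have ch: "T.children i = {j \<in> ids - I 0. par j = i \<and> \<gamma> \<le> lab j}" for i
    unfolding T.children_eq T_ids by (auto simp: idx_def)
  have "T.D \<notin> Crit (ring_on T.D)"
    using T.D.maximalideal_onD(2)[of T.D] T.D.one_mem by (auto simp: Crit_def Max_ideals_def)
  hence "genideal (ring_on T.D) (max_at i) \<in> Crit (ring_on T.D) \<longleftrightarrow>
      \<gamma> \<le> lab i \<and> infinite {j \<in> ids - I 0. par j = i \<and> \<gamma> \<le> lab j}" if "i \<in> ids" for i
    using that genideal_max_at[OF that] T.Crit_D_iff[of i] T_ids ch by auto
  moreover have "max_at ` {i \<in> ids. \<gamma> \<le> lab i} \<noteq> {}" using root by (auto simp: ids_def)
  ultimately show ?thesis
    unfolding crit_step_def overring_of_max_at Max_ideals_D by auto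
qed

end

end

section \<open>Quadratic extensions of semilocal rings\<close>

definition finite_residue :: "'k::field set \<Rightarrow> 'k \<Rightarrow> bool" where
  "finite_residue A q \<longleftrightarrow> (\<exists>R. finite R \<and> R \<subseteq> A \<and> (\<forall>a\<in>A. \<exists>r\<in>R. a - r \<in> princ A q))"

text \<open>The condition of \<open>integral_closure_in\<close> detached from the field
  \<open>F\<close>, so that it can be descended through the tower before \<open>F\<close> is
  known.\<close>

definition integral_root :: "'k::field set \<Rightarrow> 'k \<Rightarrow> bool" where
  "integral_root A x \<longleftrightarrow> (\<exists>q. lead_coeff q = 1 \<and> (\<forall>i. coeff q i \<in> A) \<and> poly q x = 0)"

lemma integral_root_self:
  assumes "field_subring A" "x \<in> A"
  shows "integral_root A x"
proof -
  interpret field_subring A by fact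
  have "coeff [:- x, 1:] i \<in> A" for i
    using assms(2) uminus_mem zero_mem one_mem by (auto simp: coeff_pCons split: nat.splits)
  thus ?thesis unfolding integral_root_def by (intro exI[of _ "[:- x, 1:]"]) simp
qed

text \<open>On the finite set of residue classes the map \<open>x - x\<^sup>2\<close> sends 0 and 1
  to the same class; not being injective, it misses some class \<open>c\<close>. The linear term
  makes this work in residue characteristic 2, where squaring on a finite field is
  bijective.\<close>

lemma (in field_subring) no_root_exists:
  assumes q: "1 \<notin> princ A q" and fin: "finite_residue A q"
  shows "\<exists>c\<in>A. \<forall>x\<in>A. x\<^sup>2 - x + c \<notin> princ A q"
proof (rule ccontr)
  assume *: "\<not> ?thesis"
  define cls where "cls a = {x \<in> A. x - a \<in> princ A q}" for a
  have cls_eq: "cls a = cls b" if "a - b \<in> princ A q" for a b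
    using princ_add[OF _ that] princ_diff[OF _ that] unfolding cls_def by fastforce
  have cls_self: "a \<in> cls a" if "a \<in> A" for a
    using that princ_zero by (simp add: cls_def)
  \<comment> \<open>The induced map on classes, computed at a chosen representative; the fact
    \<open>F\<close> shows that the choice does not matter.\<close>
  define F where "F U = (let a = SOME a. a \<in> U in cls (a - a\<^sup>2))" for U
  have F: "F (cls x) = cls (x - x\<^sup>2)" if x: "x \<in> A" for x
  proof -
    define a where "a = (SOME a. a \<in> cls x)"
    have "a \<in> cls x" unfolding a_def using cls_self[OF x] by (rule someI)
    hence a: "a \<in> A" "a - x \<in> princ A q" by (auto simp: cls_def)
    have "(1 - a - x) * (a - x) \<in> princ A q"
      using a x by (intro princ_mult diff_mem one_mem)
    also have "(1 - a - x) * (a - x) = (a - a\<^sup>2) - (x - x\<^sup>2)"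
      by (simp add: algebra_simps power2_eq_square)
    finally show ?thesis using cls_eq by (simp add: F_def a_def)
  qed
  obtain R where R: "finite R" "\<forall>a\<in>A. \<exists>r\<in>R. a - r \<in> princ A q"
    using fin by (auto simp: finite_residue_def)
  have "cls ` A \<subseteq> cls ` R"
  proof
    fix U assume "U \<in> cls ` A"
    then obtain a where a: "a \<in> A" "U = cls a" by blast
    then obtain r where "r \<in> R" "a - r \<in> princ A q" using R by blast
    thus "U \<in> cls ` R" using cls_eq a by blast
  qed
  hence finQ: "finite (cls ` A)" using R finite_surj by blast
  have "cls ` A \<subseteq> F ` (cls ` A)"
  proof
    fix U assume "U \<in> cls ` A"
    then obtain c where c: "c \<in> A" "U = cls c" by blast
    then obtain x where x: "x \<in> A" "x\<^sup>2 - x + c \<in> princ A q" using * by blast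
    have "cls c = cls (x - x\<^sup>2)" using x(2) by (intro cls_eq) (simp add: algebra_simps)
    thus "U \<in> F ` (cls ` A)" using F[OF x(1)] c x by (auto simp: image_iff)
  qed
  hence "inj_on F (cls ` A)" using finQ by (rule finite_surj_inj[rotated])
  moreover have "F (cls 0) = F (cls 1)" using F[OF zero_mem] F[OF one_mem] by simp
  ultimately have "cls 0 = cls 1" using zero_mem one_mem by (blast dest: inj_onD)
  hence "1 \<in> cls 0" using cls_self[OF one_mem] by simp
  thus False using q by (simp add: cls_def)
qed

section \<open>Chinese remainders and norm forms\<close>

context semilocal
begin

text \<open>The moduli are squares so that an element congruent to \<open>g i\<close> gets order
  exactly one at \<open>i\<close>.\<close>

lemma chinese_remainder:
  assumes "\<And>i. i \<in> I \<Longrightarrow> r i \<in> A"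
  shows "\<exists>c\<in>A. \<forall>i\<in>I. c - r i \<in> princ A ((g i)\<^sup>2)"
proof -
  have "\<exists>c\<in>A. \<forall>i\<in>S. c - r i \<in> princ A ((g i)\<^sup>2)" if "finite S" "S \<subseteq> I" for S
    using that
  proof (induction S rule: finite_induct)
    case empty
    thus ?case using zero_mem by blast
  next
    case (insert j S)
    then obtain c where c: "c \<in> A" "\<And>i. i \<in> S \<Longrightarrow> c - r i \<in> princ A ((g i)\<^sup>2)" by auto
    have j: "j \<in> I" and SI: "S \<subseteq> I" using insert by auto
    define P where "P = (\<Prod>i\<in>S. (g i)\<^sup>2)"
    have PA: "P \<in> A" unfolding P_def using SI by (rule prod_g_mem)
    have "P \<notin> princ A (g j)"
    proof
      assume P: "P \<in> princ A (g j)"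
      have "\<exists>i\<in>S. (g i)\<^sup>2 \<in> princ A (g j)"
        using P SI unfolding P_def
        by (intro max_element_prime_prod[OF max_el[OF j] insert(1)]) (auto intro: power_mem g_mem)
      then obtain i where i: "i \<in> S" "(g i)\<^sup>2 \<in> princ A (g j)" by blast
      have iI: "i \<in> I" "i \<noteq> j" using i insert SI by auto
      have "g i \<in> princ A (g j)" by (rule max_element_prime_power[OF max_el[OF j] g_mem[OF iI(1)] i(2)])
      thus False using distinct[OF j iI(1)] iI(2) by blast
    qed
    then obtain y w where y: "y \<in> A" "w \<in> A" "P * y - 1 = g j * w"
      using max_elementD(4)[OF max_el[OF j] PA] by (auto simp: princ_def)
    \<comment> \<open>A Newton step from an inverse \<open>y\<close> of \<open>P\<close> modulo
      \<open>g j\<close> to one modulo its square: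
      \<open>1 - P * t = (1 - P * y)\<^sup>2\<close>.\<close>
    define t where "t = 2 * y - P * y\<^sup>2"
    have two: "2 \<in> A" using add_mem[OF one_mem one_mem] by simp
    have tA: "t \<in> A" unfolding t_def using PA y two by (intro closed)
    have "P * t - 1 = - ((P * y - 1)\<^sup>2)" by (simp add: t_def algebra_simps power2_eq_square)
    also have "\<dots> = (g j)\<^sup>2 * (- (w\<^sup>2))" unfolding y(3) by (simp add: power_mult_distrib)
    finally have Pt: "P * t - 1 \<in> princ A ((g j)\<^sup>2)"
      using princ_multR[of "- (w\<^sup>2)"] uminus_mem power_mem y(2) by simp
    define d where "d = c + P * t * (r j - c)"
    have rj: "r j - c \<in> A" using assms[OF j] c(1) by (rule diff_mem)
    have "d \<in> A" unfolding d_def using c(1) PA tA rj by (intro add_mem mult_mem)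
    moreover have "d - r j \<in> princ A ((g j)\<^sup>2)"
    proof -
      have "d - r j = (r j - c) * (P * t - 1)" by (simp add: d_def algebra_simps)
      thus ?thesis using princ_mult[OF rj Pt] by simp
    qed
    moreover have "d - r i \<in> princ A ((g i)\<^sup>2)" if i: "i \<in> S" for i
    proof -
      have "P = (g i)\<^sup>2 * (\<Prod>i\<in>S - {i}. (g i)\<^sup>2)" unfolding P_def using insert(1) i by (rule prod.remove)
      moreover have "(\<Prod>i\<in>S - {i}. (g i)\<^sup>2) \<in> A" using SI by (intro prod_g_mem) auto
      ultimately have "P \<in> princ A ((g i)\<^sup>2)" using princ_multR by simp
      hence "P * (t * (r j - c)) \<in> princ A ((g i)\<^sup>2)"
        using mult_mem[OF tA rj] by (intro princ_mult')
      hence "(c - r i) + P * (t * (r j - c)) \<in> princ A ((g i)\<^sup>2)" using c(2)[OF i] by (intro princ_add)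
      moreover have "d - r i = (c - r i) + P * (t * (r j - c))" by (simp add: d_def mult.assoc)
      ultimately show ?thesis by (simp only:)
    qed
    ultimately show ?case by blast
  qed
  thus ?thesis using fin by blast
qed

text \<open>The form is the norm of \<open>x + y * \<theta>\<close> for a root \<theta> of the
  polynomial. If \<open>y\<close> had an inverse \<open>z\<close> modulo \<open>g i\<close>, then
  \<open>- (x * z)\<close> would be a root modulo \<open>g i\<close>; so \<open>g i\<close> divides
  \<open>y\<close>, hence also \<open>x\<^sup>2\<close>.\<close>

lemma norm_form_inert:
  assumes i: "i \<in> I" and bc: "b \<in> A" "c \<in> A"
    and inert: "\<And>x. x \<in> A \<Longrightarrow> x\<^sup>2 - b * x + c \<notin> princ A (g i)"
    and xy: "x \<in> A" "y \<in> A" and N: "x\<^sup>2 + b * x * y + c * y\<^sup>2 \<in> princ A (g i)"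
  shows "x \<in> princ A (g i) \<and> y \<in> princ A (g i)"
proof -
  have y: "y \<in> princ A (g i)"
  proof (rule ccontr)
    assume "y \<notin> princ A (g i)"
    then obtain z where z: "z \<in> A" "y * z - 1 \<in> princ A (g i)"
      using max_elementD(4)[OF max_el[OF i] xy(2)] by blast
    have m: "b * x * z + c * (y * z + 1) \<in> A" "z\<^sup>2 \<in> A" using bc xy z(1) by (auto intro!: closed)
    have "z\<^sup>2 * (x\<^sup>2 + b * x * y + c * y\<^sup>2) - (b * x * z + c * (y * z + 1)) * (y * z - 1)
            \<in> princ A (g i)"
      by (rule princ_diff[OF princ_mult[OF m(2) N] princ_mult[OF m(1) z(2)]])
    also have "z\<^sup>2 * (x\<^sup>2 + b * x * y + c * y\<^sup>2) - (b * x * z + c * (y * z + 1)) * (y * z - 1)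
        = (- (x * z))\<^sup>2 - b * (- (x * z)) + c"
      by (simp add: algebra_simps power2_eq_square)
    finally show False using inert[of "- (x * z)"] xy z(1) by (auto intro: closed)
  qed
  have m: "b * x + c * y \<in> A" using bc xy by (auto intro!: closed)
  have "(x\<^sup>2 + b * x * y + c * y\<^sup>2) - (b * x + c * y) * y \<in> princ A (g i)"
    by (rule princ_diff[OF N princ_mult[OF m y]])
  hence "x\<^sup>2 \<in> princ A (g i)" by (simp add: algebra_simps power2_eq_square)
  thus ?thesis using max_element_prime_power[OF max_el[OF i] xy(1)] y by blast
qed

text \<open>Descent at one inert prime: a zero of the form has both coordinates divisible by
  \<open>g i\<close>, and dividing by \<open>g i\<close> lowers the order of \<open>y\<close>. So
  one inert prime proves that the polynomial has no root in the quotient field.\<close>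

lemma norm_form_anisotropic:
  assumes i: "i \<in> I" and bc: "b \<in> A" "c \<in> A"
    and inert: "\<And>x. x \<in> A \<Longrightarrow> x\<^sup>2 - b * x + c \<notin> princ A (g i)"
    and xy: "x \<in> A" "y \<in> A" "y \<noteq> 0"
  shows "x\<^sup>2 + b * x * y + c * y\<^sup>2 \<noteq> 0"
proof -
  obtain k t where t: "t \<in> A" "t \<notin> princ A (g i)" "y = g i ^ k * t"
    using extract_power[OF xy(2,3) i] by blast
  have "x\<^sup>2 + b * x * (g i ^ k * t) + c * (g i ^ k * t)\<^sup>2 \<noteq> 0" if "x \<in> A" for x
    using that
  proof (induction k arbitrary: x)
    case 0
    thus ?case using norm_form_inert[OF i bc inert 0 t(1)] princ_zero t(2) by auto
  next
    case (Suc k)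
    have m: "g i ^ k * t \<in> A" using t(1) g_mem[OF i] by (intro mult_mem power_mem)
    show ?case
    proof
      assume *: "x\<^sup>2 + b * x * (g i ^ Suc k * t) + c * (g i ^ Suc k * t)\<^sup>2 = 0"
      have "g i ^ Suc k * t \<in> A" using t(1) g_mem[OF i] by (intro mult_mem power_mem)
      hence "x \<in> princ A (g i)" using norm_form_inert[OF i bc inert Suc(2)] * princ_zero by metis
      then obtain w where w: "w \<in> A" "x = g i * w" by (auto simp: princ_def)
      have "(g i)\<^sup>2 * (w\<^sup>2 + b * w * (g i ^ k * t) + c * (g i ^ k * t)\<^sup>2) = 0"
        using * unfolding w(2) by (simp add: algebra_simps power2_eq_square)
      thus False using Suc(1)[OF w(1)] g_nz[OF i] by simp
    qed
  qed
  thus ?thesis using t(3) xy(1) by simp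
qed

end

text \<open>\<open>anisotropic\<close> expresses irreducibility over the quotient field and makes 1
  and \<theta> independent over \<open>A\<close>. It is assumed, not derived from an inert prime,
  because the first extension of the base ring has none.\<close>

locale quadratic = semilocal A I g for A :: "'k::field set" and I :: "'i set" and g +
  fixes b c \<theta> :: 'k
  assumes b_mem: "b \<in> A" and c_mem: "c \<in> A" and root: "\<theta>\<^sup>2 = b * \<theta> - c"
    and anisotropic: "x \<in> A \<Longrightarrow> y \<in> A \<Longrightarrow> y \<noteq> 0 \<Longrightarrow> x\<^sup>2 + b * x * y + c * y\<^sup>2 \<noteq> 0"
begin

definition adj :: "'k set" where
  "adj = {x + y * \<theta> | x y. x \<in> A \<and> y \<in> A}"

lemma adjI: "x \<in> A \<Longrightarrow> y \<in> A \<Longrightarrow> x + y * \<theta> \<in> adj"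
  unfolding adj_def by blast

lemma adjE:
  assumes "z \<in> adj"
  obtains x y where "x \<in> A" "y \<in> A" "z = x + y * \<theta>"
  using assms unfolding adj_def by blast

lemma root': "\<theta> * \<theta> = b * \<theta> - c" "\<theta> * (\<theta> * z) = (b * \<theta> - c) * z"
  using root by (simp_all add: power2_eq_square mult.assoc[symmetric])

lemma norm_eq: "(x + y * \<theta>) * (x + y * (b - \<theta>)) = x\<^sup>2 + b * x * y + c * y\<^sup>2"
  by (simp add: algebra_simps root' power2_eq_square)

lemma coords_zero:
  assumes "x \<in> A" "y \<in> A" "x + y * \<theta> = 0"
  shows "x = 0" "y = 0"
proof -
  show "y = 0" using norm_eq[of x y] anisotropic[OF assms(1,2)] assms(3) by auto
  thus "x = 0" using assms(3) by simp
qed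

lemma coords_eq:
  assumes "x \<in> A" "y \<in> A" "x' \<in> A" "y' \<in> A" "x + y * \<theta> = x' + y' * \<theta>"
  shows "x = x'" "y = y'"
proof -
  have "(x - x') + (y - y') * \<theta> = 0" using assms(5) by (simp add: algebra_simps)
  thus "x = x'" "y = y'" using coords_zero[of "x - x'" "y - y'"] assms by (auto intro: diff_mem)
qed

lemma A_subset_adj: "A \<subseteq> adj"
  using adjI[OF _ zero_mem] by auto

lemma theta_mem: "\<theta> \<in> adj"
  using adjI[OF zero_mem one_mem] by simp

lemma field_subring_adj: "field_subring adj"
proof
  show "1 \<in> adj" using A_subset_adj one_mem by blast
  fix z w assume "z \<in> adj" "w \<in> adj"
  then obtain x y x' y' where *: "x \<in> A" "y \<in> A" "x' \<in> A" "y' \<in> A" "z = x + y * \<theta>" "w = x' + y' * \<theta>"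
    by (auto elim!: adjE)
  have "z - w = (x - x') + (y - y') * \<theta>" using * by (simp add: algebra_simps)
  moreover have "z * w = (x * x' - y * y' * c) + (x * y' + y * x' + y * y' * b) * \<theta>"
    using * by (simp add: algebra_simps root')
  moreover have "x - x' \<in> A" "y - y' \<in> A" "x * x' - y * y' * c \<in> A" "x * y' + y * x' + y * y' * b \<in> A"
    using * b_mem c_mem by (auto intro!: closed)
  ultimately show "z - w \<in> adj" "z * w \<in> adj" using adjI by auto
qed

sublocale B: field_subring adj
  by (rule field_subring_adj)

lemma conj_mem: "b - \<theta> \<in> adj"
  using theta_mem b_mem A_subset_adj by (intro B.diff_mem) auto

text \<open>With \<open>adj_conj\<close>, this makes every fact about \<theta> available for the
  conjugate root by a second interpretation over the same ring.\<close>

lemma quadratic_conj: "quadratic A I g b c (b - \<theta>)"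
  by unfold_locales
    (use b_mem c_mem anisotropic root in \<open>auto simp: algebra_simps power2_eq_square root'\<close>)

lemma adj_conj: "quadratic.adj A (b - \<theta>) = adj"
proof -
  interpret C: quadratic A I g b c "b - \<theta>" by (rule quadratic_conj)
  show ?thesis
  proof
    show "C.adj \<subseteq> adj"
      using conj_mem A_subset_adj by (auto elim!: C.adjE intro!: B.add_mem B.mult_mem)
    have "\<theta> \<in> C.adj" using C.conj_mem by simp
    thus "adj \<subseteq> C.adj"
      using C.A_subset_adj by (auto elim!: adjE intro!: C.B.add_mem C.B.mult_mem)
  qed
qed

lemma mem_princ_adj_iff:
  assumes "x \<in> A" "y \<in> A" "a \<in> A"
  shows "x + y * \<theta> \<in> princ adj a \<longleftrightarrow> x \<in> princ A a \<and> y \<in> princ A a"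
proof
  assume "x + y * \<theta> \<in> princ adj a"
  then obtain z where "z \<in> adj" "x + y * \<theta> = a * z" by (auto simp: princ_def)
  then obtain x' y' where *: "x' \<in> A" "y' \<in> A" "x + y * \<theta> = a * x' + (a * y') * \<theta>"
    by (auto elim!: adjE simp: algebra_simps)
  hence "x = a * x'" "y = a * y'" using coords_eq[OF assms(1,2) _ _ *(3)] assms(3) mult_mem by blast+
  thus "x \<in> princ A a \<and> y \<in> princ A a" using * princ_multR by blast
next
  assume "x \<in> princ A a \<and> y \<in> princ A a"
  then obtain x' y' where *: "x' \<in> A" "y' \<in> A" "x = a * x'" "y = a * y'" by (auto simp: princ_def)
  hence "x + y * \<theta> = a * (x' + y' * \<theta>)" by (simp add: algebra_simps)
  thus "x + y * \<theta> \<in> princ adj a" using B.princ_multR[OF adjI[OF *(1,2)]] by simp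
qed

lemma A_mem_princ_adj_iff:
  assumes "x \<in> A" "a \<in> A"
  shows "x \<in> princ adj a \<longleftrightarrow> x \<in> princ A a"
  using mem_princ_adj_iff[OF assms(1) zero_mem assms(2)] princ_zero by auto

text \<open>The cofactor is the conjugate; the product is the norm, which is nonzero by
  anisotropy.\<close>

lemma divides_base:
  assumes "z \<in> adj" "z \<noteq> 0"
  shows "\<exists>w\<in>adj. z * w \<in> A \<and> z * w \<noteq> 0"
proof -
  obtain x y where xy: "x \<in> A" "y \<in> A" "z = x + y * \<theta>" using assms by (auto elim: adjE)
  have w: "x + y * (b - \<theta>) \<in> adj"
    using xy conj_mem A_subset_adj by (intro B.add_mem B.mult_mem) auto
  have N: "z * (x + y * (b - \<theta>)) = x\<^sup>2 + b * x * y + c * y\<^sup>2" unfolding xy(3) by (rule norm_eq)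
  moreover have "x\<^sup>2 + b * x * y + c * y\<^sup>2 \<in> A" using xy b_mem c_mem by (auto intro!: closed)
  moreover have "x\<^sup>2 + b * x * y + c * y\<^sup>2 \<noteq> 0"
    using anisotropic[OF xy(1,2)] xy(3) assms(2) by (cases "y = 0") auto
  ultimately show ?thesis using w by (intro bexI[of _ "x + y * (b - \<theta>)"]) simp_all
qed

text \<open>If \<open>g i\<close> does not divide \<open>z\<close>, it does not divide the norm
  \<open>N\<close> either; the conjugate of \<open>z\<close> times an inverse of \<open>N\<close>
  inverts \<open>z\<close> modulo \<open>g i\<close>.\<close>

lemma max_element_inert:
  assumes i: "i \<in> I" and inert: "\<And>x. x \<in> A \<Longrightarrow> x\<^sup>2 - b * x + c \<notin> princ A (g i)"
  shows "max_element adj (g i)"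
  unfolding max_element_def
proof (intro conjI ballI impI)
  have gi: "g i \<in> A" using g_mem i by blast
  thus "g i \<in> adj" using A_subset_adj by blast
  show "g i \<noteq> 0" using g_nz i by blast
  show "1 \<notin> princ adj (g i)"
    using A_mem_princ_adj_iff[OF one_mem gi] max_elementD(3)[OF max_el[OF i]] by simp
  fix z assume z: "z \<in> adj" "z \<notin> princ adj (g i)"
  obtain x y where xy: "x \<in> A" "y \<in> A" "z = x + y * \<theta>" using z by (auto elim: adjE)
  define N where "N = x\<^sup>2 + b * x * y + c * y\<^sup>2"
  have NA: "N \<in> A" unfolding N_def using xy b_mem c_mem by (auto intro!: closed)
  have "N \<notin> princ A (g i)"
    using norm_form_inert[OF i b_mem c_mem inert xy(1,2)] z(2) mem_princ_adj_iff[OF xy(1,2) gi]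
    unfolding N_def xy(3) by blast
  then obtain a where a: "a \<in> A" "N * a - 1 \<in> princ A (g i)"
    using max_elementD(4)[OF max_el[OF i] NA] by blast
  have w: "(x + y * (b - \<theta>)) * a \<in> adj"
    using xy a(1) conj_mem A_subset_adj by (intro B.add_mem B.mult_mem) auto
  have "z * ((x + y * (b - \<theta>)) * a) = N * a"
    unfolding xy(3) N_def mult.assoc[symmetric] norm_eq ..
  moreover have "N * a - 1 \<in> princ adj (g i)"
    using A_mem_princ_adj_iff[OF _ gi] a NA by (simp add: closed)
  ultimately have "z * ((x + y * (b - \<theta>)) * a) - 1 \<in> princ adj (g i)" by metis
  thus "\<exists>w\<in>adj. z * w - 1 \<in> princ adj (g i)" using w by blast
qed

lemma finite_residue_inert:
  assumes "a \<in> A" "finite_residue A a"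
  shows "finite_residue adj a"
proof -
  obtain R where R: "finite R" "R \<subseteq> A" "\<And>x. x \<in> A \<Longrightarrow> \<exists>r\<in>R. x - r \<in> princ A a"
    using assms(2) by (auto simp: finite_residue_def)
  have "\<exists>t\<in>(\<lambda>(r, s). r + s * \<theta>) ` (R \<times> R). z - t \<in> princ adj a" if z: "z \<in> adj" for z
  proof -
    obtain x y where xy: "x \<in> A" "y \<in> A" "z = x + y * \<theta>" using z by (auto elim: adjE)
    obtain r s where rs: "r \<in> R" "s \<in> R" "x - r \<in> princ A a" "y - s \<in> princ A a" using R(3) xy by blast
    have "(x - r) + (y - s) * \<theta> \<in> princ adj a"
      using rs R(2) xy assms(1) by (subst mem_princ_adj_iff) (auto intro: diff_mem)
    hence "z - (r + s * \<theta>) \<in> princ adj a" unfolding xy(3) by (simp add: algebra_simps)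
    thus ?thesis using rs by auto
  qed
  moreover have "(\<lambda>(r, s). r + s * \<theta>) ` (R \<times> R) \<subseteq> adj" using R(2) by (auto intro!: adjI)
  ultimately show ?thesis unfolding finite_residue_def using R(1)
    by (intro exI[of _ "(\<lambda>(r, s). r + s * \<theta>) ` (R \<times> R)"]) auto
qed

lemma conj_product: "\<theta> * (b - \<theta>) = c"
  by (simp add: algebra_simps root')

text \<open>In coordinates a multiple of \<theta> is
  \<open>- (c * v) + (u + v * b) * \<theta>\<close>, whose first coordinate is divisible by
  \<open>c\<close>; conversely \<theta> divides \<open>c\<close>, its product with the
  conjugate.\<close>

lemma A_mem_princ_theta_iff:
  assumes "x \<in> A"
  shows "x \<in> princ adj \<theta> \<longleftrightarrow> x \<in> princ A c"
proof
  assume "x \<in> princ adj \<theta>"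
  then obtain z where "z \<in> adj" "x = \<theta> * z" by (auto simp: princ_def)
  then obtain u v where uv: "u \<in> A" "v \<in> A" "x = u * \<theta> + v * (b * \<theta> - c)"
    by (auto elim!: adjE simp: algebra_simps root')
  have "x + 0 * \<theta> = - (c * v) + (u + v * b) * \<theta>" using uv(3) by (simp add: algebra_simps)
  moreover have "- (c * v) \<in> A" "u + v * b \<in> A" using uv b_mem c_mem by (auto intro!: closed)
  ultimately have "x = - (c * v)" using coords_eq(1)[OF assms zero_mem] by blast
  thus "x \<in> princ A c" using princ_uminus[OF princ_multR[OF uv(2)]] by simp
next
  assume "x \<in> princ A c"
  then obtain a where "a \<in> A" "x = \<theta> * ((b - \<theta>) * a)"
    using conj_product by (auto simp: princ_def mult.assoc[symmetric])
  thus "x \<in> princ adj \<theta>" using B.princ_multR[OF B.mult_mem[OF conj_mem]] A_subset_adj by blast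
qed

text \<open>Modulo \<theta> every \<open>x + y * \<theta>\<close> reduces to \<open>x\<close>, so
  the residue ring is that of \<open>A\<close> modulo \<open>c\<close>.\<close>

lemma max_element_theta:
  assumes "max_element A c"
  shows "max_element adj \<theta>"
  unfolding max_element_def
proof (intro conjI ballI impI theta_mem)
  show "\<theta> \<noteq> 0" using conj_product max_elementD(2)[OF assms] by auto
  show "1 \<notin> princ adj \<theta>"
    using A_mem_princ_theta_iff[OF one_mem] max_elementD(3)[OF assms] by simp
  fix z assume z: "z \<in> adj" "z \<notin> princ adj \<theta>"
  obtain x y where xy: "x \<in> A" "y \<in> A" "z = x + y * \<theta>" using z by (auto elim: adjE)
  have yt: "a * \<theta> \<in> princ adj \<theta>" if "a \<in> A" for a
    using that A_subset_adj by (intro B.princ_multL) auto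
  have "x \<notin> princ adj \<theta>" using z(2) B.princ_add[OF _ yt[OF xy(2)]] xy(3) by blast
  then obtain a where a: "a \<in> A" "x * a - 1 \<in> princ A c"
    using max_elementD(4)[OF assms xy(1)] A_mem_princ_theta_iff[OF xy(1)] by blast
  have "x * a - 1 \<in> princ adj \<theta>"
    using A_mem_princ_theta_iff a xy by (simp add: closed)
  hence "(x * a - 1) + (y * a) * \<theta> \<in> princ adj \<theta>"
    using yt[of "y * a"] a xy by (intro B.princ_add) (auto intro: mult_mem)
  hence "z * a - 1 \<in> princ adj \<theta>" unfolding xy(3) by (simp add: algebra_simps)
  thus "\<exists>w\<in>adj. z * w - 1 \<in> princ adj \<theta>" using a A_subset_adj by blast
qed

lemma finite_residue_theta:
  assumes "finite_residue A c"
  shows "finite_residue adj \<theta>"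
proof -
  obtain R where R: "finite R" "R \<subseteq> A" "\<And>x. x \<in> A \<Longrightarrow> \<exists>r\<in>R. x - r \<in> princ A c"
    using assms(1) by (auto simp: finite_residue_def)
  have "\<exists>r\<in>R. z - r \<in> princ adj \<theta>" if z: "z \<in> adj" for z
  proof -
    obtain x y where xy: "x \<in> A" "y \<in> A" "z = x + y * \<theta>" using z by (auto elim: adjE)
    obtain r where r: "r \<in> R" "x - r \<in> princ A c" using R(3) xy by blast
    hence "x - r \<in> princ adj \<theta>" using A_mem_princ_theta_iff[of "x - r"] R(2) xy(1) by (auto intro: diff_mem)
    moreover have "y * \<theta> \<in> princ adj \<theta>" using xy A_subset_adj by (intro B.princ_multL) auto
    ultimately have "(x - r) + y * \<theta> \<in> princ adj \<theta>" by (rule B.princ_add)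
    thus ?thesis using r(1) unfolding xy(3) by (intro bexI[of _ r]) (simp_all add: algebra_simps)
  qed
  thus ?thesis unfolding finite_residue_def using R A_subset_adj by (intro exI[of _ R]) auto
qed

text \<open>A monic polynomial over \<open>adj\<close> times its conjugate is a monic polynomial over \<open>A\<close>.\<close>

lemma integral_root_descend:
  assumes "integral_root adj z"
  shows "integral_root A z"
proof -
  obtain q where q: "lead_coeff q = 1" "\<And>i. coeff q i \<in> adj" "poly q z = 0"
    using assms by (auto simp: integral_root_def)
  have "\<exists>x y. x \<in> A \<and> y \<in> A \<and> coeff q i = x + y * \<theta>" for i
    using q(2)[of i] by (auto elim: adjE)
  then obtain U V where UV: "\<And>i. U i \<in> A" "\<And>i. V i \<in> A" "\<And>i. coeff q i = U i + V i * \<theta>"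
    by metis
  have high: "U i = 0" "V i = 0" if "i > degree q" for i
    using coords_zero[OF UV(1,2), of i] UV(3)[of i] coeff_eq_0[OF that] by auto
  have top: "U (degree q) = 1" "V (degree q) = 0"
    using coords_eq[OF UV(1,2) one_mem zero_mem, of "degree q"] UV(3)[of "degree q"] q(1) by auto
  define r where "r = Abs_poly U"
  define s where "s = Abs_poly V"
  have "\<forall>\<^sub>\<infinity>i. U i = 0" "\<forall>\<^sub>\<infinity>i. V i = 0"
    using high by (auto simp: MOST_nat intro!: exI[of _ "degree q"])
  hence cr: "coeff r = U" "coeff s = V" by (simp_all add: r_def s_def Abs_poly_inverse)
  have q_eq: "q = r + smult \<theta> s" by (rule poly_eqI) (simp add: UV(3) cr mult.commute)
  define q' where "q' = r + smult (b - \<theta>) s"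
  have "degree q' \<le> degree q" by (rule degree_le) (simp add: q'_def cr high)
  moreover have "coeff q' (degree q) = 1" by (simp add: q'_def cr top)
  ultimately have lead': "lead_coeff q' = 1" by (metis le_degree le_antisym zero_neq_one)
  \<comment> \<open>Only the trace \<open>b\<close> and the norm \<open>c\<close> of \<theta> occur
    in the expansion, which brings the coefficients back into \<open>A\<close>.\<close>
  have "q * q' = r * r + smult b (r * s) + smult c (s * s)"
    unfolding q_eq q'_def
    by (rule poly_eqI) (simp add: algebra_simps smult_add_right[symmetric] flip: conj_product)
  moreover have "coeff (r * r + smult b (r * s) + smult c (s * s)) i \<in> A" for i
    using UV(1,2) b_mem c_mem unfolding cr coeff_add coeff_smult coeff_mult
    by (intro closed sum_mem)
  moreover have "lead_coeff (q * q') = 1" using q(1) lead' by (simp add: lead_coeff_mult)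
  moreover have "poly (q * q') z = 0" using q(3) by simp
  ultimately show ?thesis unfolding integral_root_def by (metis (no_types, lifting))
qed

end

section \<open>Splitting and ramifying one prime\<close>

definition factored :: "'k::field set \<Rightarrow> 'i set \<Rightarrow> ('i \<Rightarrow> 'k) \<Rightarrow> 'k \<Rightarrow> bool" where
  "factored A I g x \<longleftrightarrow> (\<exists>u k. unit_in A u \<and> x = u * (\<Prod>i\<in>I. g i ^ k i))"

context field_subring
begin

lemma factored_unit: "unit_in A u \<Longrightarrow> factored A I g u"
  unfolding factored_def by (intro exI[of _ u] exI[of _ "\<lambda>_. 0"]) simp

lemma factored_mult:
  assumes "factored A I g x" "factored A I g y"
  shows "factored A I g (x * y)"
proof -
  obtain u k v l where "unit_in A u" "x = u * (\<Prod>i\<in>I. g i ^ k i)"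
    "unit_in A v" "y = v * (\<Prod>i\<in>I. g i ^ l i)"
    using assms unfolding factored_def by blast
  hence "unit_in A (u * v)" "x * y = u * v * (\<Prod>i\<in>I. g i ^ (k i + l i))"
    by (auto simp: power_add prod.distrib mult_ac intro: unit_in_mult)
  thus ?thesis unfolding factored_def by (intro exI conjI)
qed

lemma factored_power: "factored A I g x \<Longrightarrow> factored A I g (x ^ n)"
  by (induction n) (auto intro: factored_mult factored_unit unit_in_one)

lemma factored_prod: "(\<And>s. s \<in> S \<Longrightarrow> factored A I g (f s)) \<Longrightarrow> factored A I g (prod f S)"
  by (induction S rule: infinite_finite_induct) (auto intro: factored_mult factored_unit unit_in_one)

lemma factored_gen:
  assumes "finite I" "i \<in> I"
  shows "factored A I g (g i)"
proof -
  have "(\<Prod>l\<in>I. g l ^ (if l = i then 1 else 0)) = (\<Prod>l\<in>I. if l = i then g l else 1)"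
    by (intro prod.cong) auto
  also have "\<dots> = g i" using assms by (simp add: prod.delta)
  finally have "g i = 1 * (\<Prod>l\<in>I. g l ^ (if l = i then 1 else 0))" by simp
  thus ?thesis unfolding factored_def using unit_in_one by (intro exI conjI)
qed

end

text \<open>Finiteness of the residue rings is carried along because it supplies the rootless
  polynomials of the next step.\<close>

definition semilocal_finite :: "'k::field set \<Rightarrow> 'i set \<Rightarrow> ('i \<Rightarrow> 'k) \<Rightarrow> bool" where
  "semilocal_finite A I g \<longleftrightarrow> semilocal A I g \<and> (\<forall>i\<in>I. finite_residue A (g i))"

context quadratic
begin

lemma unit_in_adj: "unit_in A u \<Longrightarrow> unit_in adj u"
  using A_subset_adj unfolding unit_in_def by blast

text \<open>Every nonzero element divides its norm, which factors over \<open>A\<close>; so only the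
  old generators have to be factored anew.\<close>

lemma semilocal_adjI:
  assumes "finite J" "\<And>j. j \<in> J \<Longrightarrow> max_element adj (h j)"
    and "\<And>i j. i \<in> J \<Longrightarrow> j \<in> J \<Longrightarrow> i \<noteq> j \<Longrightarrow> h j \<notin> princ adj (h i)"
    and "\<And>i. i \<in> I \<Longrightarrow> factored adj J h (g i)"
  shows "semilocal adj J h"
proof (rule semilocalI[OF field_subring_adj assms(1-3)])
  fix z assume "z \<in> adj" "z \<noteq> 0"
  then obtain w where w: "w \<in> adj" "z * w \<in> A" "z * w \<noteq> 0" using divides_base by blast
  obtain u k where u: "unit_in A u" "z * w = u * (\<Prod>i\<in>I. g i ^ k i)" using factor[OF w(2,3)] by blast
  have "factored adj J h (z * w)"
    unfolding u(2) using assms(4)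
    by (intro B.factored_mult[OF B.factored_unit[OF unit_in_adj[OF u(1)]]] B.factored_prod B.factored_power)
  thus "\<exists>y\<in>adj. \<exists>u k. unit_in adj u \<and> z * y = u * (\<Prod>i\<in>J. h i ^ k i)"
    using w(1) unfolding factored_def by blast
qed

section \<open>Extensions in which every prime except possibly \<open>i0\<close> is inert\<close>

context
  fixes i0 :: 'i and u :: 'k
  assumes i0: "i0 \<in> I" and u: "unit_in A u" and c_eq: "c = u * g i0"
    and inert: "\<And>i x. i \<in> I - {i0} \<Longrightarrow> x \<in> A \<Longrightarrow> x\<^sup>2 - b * x + c \<notin> princ A (g i)"
begin

lemma princ_c: "princ A c = princ A (g i0)"
  unfolding c_eq by (rule princ_unit_multL[OF u])

lemma max_element_c: "max_element A c"
  unfolding c_eq by (rule max_element_unit_mult[OF max_el[OF i0] u])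

lemma gen_eq_conj_product: "g i0 = inverse u * (\<theta> * (b - \<theta>))" "unit_in adj (inverse u)"
  using u unit_in_adj[OF unit_in_inverse[OF u]] unfolding conj_product c_eq
  by (auto simp: unit_in_def)

lemma theta_distinct:
  assumes "i \<in> I - {i0}"
  shows "g i \<notin> princ adj \<theta>" "\<theta> \<notin> princ adj (g i)"
proof -
  have i: "i \<in> I" "i \<noteq> i0" using assms by auto
  show "g i \<notin> princ adj \<theta>"
    using distinct[OF i0 i(1)] i(2) A_mem_princ_theta_iff[OF g_mem[OF i(1)]] princ_c by simp
  have "1 \<notin> princ A (g i)" using max_elementD(3)[OF max_el[OF i(1)]] .
  thus "\<theta> \<notin> princ adj (g i)"
    using mem_princ_adj_iff[OF zero_mem one_mem g_mem[OF i(1)]] by simp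
qed

lemma gen_distinct:
  assumes "i \<in> I - {i0}" "j \<in> I - {i0}" "i \<noteq> j"
  shows "g j \<notin> princ adj (g i)"
  using distinct[of i j] assms A_mem_princ_adj_iff[OF g_mem g_mem, of j i] by auto

text \<open>\<open>g i0\<close> is associated to \<open>\<theta> * (b - \<theta>)\<close>, and
  neither factor divides the other, since their sum \<open>b\<close> is 1 modulo
  \<open>g i0\<close>. The old index passes to \<theta>, the new one to the conjugate.\<close>

lemma semilocal_finite_split:
  assumes b: "b - 1 \<in> princ A (g i0)" and j: "j \<notin> I" and res: "\<forall>i\<in>I. finite_residue A (g i)"
  shows "semilocal_finite adj (insert j I) (g(i0 := \<theta>, j := b - \<theta>))"
proof -
  interpret C: quadratic A I g b c "b - \<theta>" by (rule quadratic_conj)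
  note C = C.theta_distinct[OF i0 u c_eq inert, unfolded adj_conj]
  let ?h = "g(i0 := \<theta>, j := b - \<theta>)"
  have ji: "j \<noteq> i0" using i0 j by auto
  have h: "?h i0 = \<theta>" "?h j = b - \<theta>" "i \<in> I - {i0} \<Longrightarrow> ?h i = g i" for i using ji j by auto
  have mx: "max_element adj \<theta>" "max_element adj (b - \<theta>)"
    using max_element_theta[OF max_element_c] C.max_element_theta[OF max_element_c] adj_conj by auto
  have bnot: "b \<notin> princ A c"
  proof
    assume "b \<in> princ A c"
    hence "b - (b - 1) \<in> princ A (g i0)" using b unfolding princ_c by (rule princ_diff)
    thus False using max_elementD(3)[OF max_el[OF i0]] by simp
  qed
  have "semilocal adj (insert j I) ?h"
  proof (rule semilocal_adjI)
    show fin': "finite (insert j I)" using fin by simp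
    show "max_element adj (?h i)" if "i \<in> insert j I" for i
    proof -
      have mi: "max_element adj (g i)" if "i \<in> I - {i0}"
        using max_element_inert[of i] inert that by blast
      consider "i = i0" | "i = j" | "i \<in> I - {i0}" using \<open>i \<in> insert j I\<close> by blast
      thus ?thesis by cases (simp_all only: h mx mi)
    qed
    have tt: "b - \<theta> \<notin> princ adj \<theta>"
    proof
      assume "b - \<theta> \<in> princ adj \<theta>"
      hence "(b - \<theta>) + \<theta> \<in> princ adj \<theta>" using B.princ_self by (rule B.princ_add)
      thus False using A_mem_princ_theta_iff[OF b_mem] bnot by simp
    qed
    hence tt': "\<theta> \<notin> princ adj (b - \<theta>)" using B.max_element_princ_eq[OF mx(2,1)] mx
        B.max_element_princ_eq by blast
    fix i k assume ik: "i \<in> insert j I" "k \<in> insert j I" "i \<noteq> k"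
    consider "i = i0" "k = j" | "i = j" "k = i0" | "i = i0" "k \<in> I - {i0}" | "i = j" "k \<in> I - {i0}"
      | "i \<in> I - {i0}" "k = i0" | "i \<in> I - {i0}" "k = j" | "i \<in> I - {i0}" "k \<in> I - {i0}"
      using ik by blast
    thus "?h k \<notin> princ adj (?h i)"
      by cases (simp_all only: h tt tt' theta_distinct C gen_distinct ik not_False_eq_True)
  next
    fix i assume i: "i \<in> I"
    have gen: "factored adj (insert j I) ?h (?h l)" if "l \<in> insert j I" for l
      using that fin by (intro B.factored_gen) auto
    show "factored adj (insert j I) ?h (g i)"
    proof (cases "i = i0")
      case True
      have "factored adj (insert j I) ?h (inverse u * (?h i0 * ?h j))"
        using gen_eq_conj_product(2) i0
        by (intro B.factored_mult B.factored_unit gen) simp_all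
      thus ?thesis unfolding h True gen_eq_conj_product(1)[symmetric] .
    next
      case False
      thus ?thesis using gen[of i] h(3)[of i] i by simp
    qed
  qed
  moreover have "finite_residue adj (?h i)" if i: "i \<in> insert j I" for i
  proof -
    have "finite_residue A c" using res i0 princ_c unfolding finite_residue_def by auto
    hence r1: "finite_residue adj \<theta>" "finite_residue adj (b - \<theta>)"
      using finite_residue_theta C.finite_residue_theta adj_conj by auto
    have r2: "finite_residue adj (g i)" if "i \<in> I - {i0}"
      using finite_residue_inert[OF g_mem] res that by auto
    consider "i = i0" | "i = j" | "i \<in> I - {i0}" using i by blast
    thus ?thesis by cases (simp_all only: h r1 r2)
  qed
  ultimately show ?thesis unfolding semilocal_finite_def by blast
qed

text \<open>When \<open>g i0\<close> divides \<open>b\<close>, so does \<theta>; hence \<theta> and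
  \<open>b - \<theta>\<close> divide each other, and their product is associated to
  \<open>\<theta>\<^sup>2\<close>.\<close>

lemma semilocal_finite_ramify:
  assumes b: "b \<in> princ A (g i0)" and res: "\<forall>i\<in>I. finite_residue A (g i)"
  shows "semilocal_finite adj I (g(i0 := \<theta>))" "\<exists>v. unit_in adj v \<and> g i0 = v * \<theta>\<^sup>2"
proof -
  interpret C: quadratic A I g b c "b - \<theta>" by (rule quadratic_conj)
  let ?h = "g(i0 := \<theta>)"
  have h: "?h i0 = \<theta>" "i \<in> I - {i0} \<Longrightarrow> ?h i = g i" for i by auto
  have mx: "max_element adj \<theta>" "max_element adj (b - \<theta>)"
    using max_element_theta[OF max_element_c] C.max_element_theta[OF max_element_c] adj_conj by auto
  have "b \<in> princ adj \<theta>" using A_mem_princ_theta_iff[OF b_mem] b princ_c by simp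
  hence "b - \<theta> \<in> princ adj \<theta>" using B.princ_self by (intro B.princ_diff)
  moreover from this have "\<theta> \<in> princ adj (b - \<theta>)" by (rule B.max_element_princ_eq[OF mx(2,1)])
  ultimately obtain w w' where w: "w \<in> adj" "b - \<theta> = \<theta> * w" "w' \<in> adj" "\<theta> = (b - \<theta>) * w'"
    by (auto simp: princ_def)
  have "\<theta> * (w * w') = \<theta> * 1" using w(2,4) by (metis mult.assoc mult.right_neutral)
  hence "w * w' = 1" using max_elementD(2)[OF mx(1)] by simp
  hence "unit_in adj w" using w by (intro B.unit_inI)
  hence v: "unit_in adj (inverse u * w)" using gen_eq_conj_product(2) by (intro B.unit_in_mult)
  have geq: "g i0 = inverse u * w * \<theta>\<^sup>2"
    unfolding gen_eq_conj_product(1) w(2) by (simp add: power2_eq_square mult_ac)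
  show "\<exists>v. unit_in adj v \<and> g i0 = v * \<theta>\<^sup>2" using v geq by blast
  have "semilocal adj I ?h"
  proof (rule semilocal_adjI[OF fin])
    show "max_element adj (?h i)" if "i \<in> I" for i
      using that mx(1) max_element_inert[of i] inert by (cases "i = i0") auto
    show "?h k \<notin> princ adj (?h i)" if "i \<in> I" "k \<in> I" "i \<noteq> k" for i k
      using that theta_distinct gen_distinct[of i k] by (cases "i = i0"; cases "k = i0") auto
    fix i assume i: "i \<in> I"
    have gen: "factored adj I ?h (?h l)" if "l \<in> I" for l
      using that fin by (intro B.factored_gen) auto
    show "factored adj I ?h (g i)"
    proof (cases "i = i0")
      case True
      have "factored adj I ?h (inverse u * w * (?h i0)\<^sup>2)"
        using v i0 by (intro B.factored_mult[OF B.factored_unit] B.factored_power gen)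
      thus ?thesis unfolding h True geq[symmetric] .
    next
      case False
      thus ?thesis using gen[of i] h(2)[of i] i by simp
    qed
  qed
  moreover have "finite_residue adj (?h i)" if i: "i \<in> I" for i
  proof (cases "i = i0")
    case True
    have "finite_residue A c" using res i0 princ_c unfolding finite_residue_def by auto
    thus ?thesis using finite_residue_theta True by simp
  next
    case False
    thus ?thesis using finite_residue_inert[OF g_mem] res i by auto
  qed
  ultimately show "semilocal_finite adj I ?h" unfolding semilocal_finite_def by blast
qed

end

end

text \<open>Chinese remainders combine the local demands: congruence to \<open>g i0\<close> modulo
  its square gives order one at \<open>i0\<close>, and at each other prime \<open>c\<close> is a
  class missed by \<open>x - x\<^sup>2\<close>.\<close>

lemma (in semilocal) exists_constant_term:
  assumes i0: "i0 \<in> I" and res: "\<forall>i\<in>I. finite_residue A (g i)"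
  shows "\<exists>c\<in>A. \<exists>u. unit_in A u \<and> c = u * g i0 \<and>
           (\<forall>i\<in>I - {i0}. \<forall>x\<in>A. x\<^sup>2 - x + c \<notin> princ A (g i))"
proof -
  have "\<forall>i\<in>I. \<exists>c\<in>A. \<forall>x\<in>A. x\<^sup>2 - x + c \<notin> princ A (g i)"
    using no_root_exists max_elementD(3)[OF max_el] res by blast
  then obtain d where d: "\<And>i. i \<in> I \<Longrightarrow> d i \<in> A"
    "\<And>i x. i \<in> I \<Longrightarrow> x \<in> A \<Longrightarrow> x\<^sup>2 - x + d i \<notin> princ A (g i)" by metis
  have "\<exists>c\<in>A. \<forall>i\<in>I. c - (d(i0 := g i0)) i \<in> princ A ((g i)\<^sup>2)"
    using d(1) g_mem by (intro chinese_remainder) auto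
  then obtain c where c: "c \<in> A" "\<And>i. i \<in> I \<Longrightarrow> c - (d(i0 := g i0)) i \<in> princ A ((g i)\<^sup>2)"
    by blast
  have sq: "y \<in> princ A (g i)" if "y \<in> princ A ((g i)\<^sup>2)" "i \<in> I" for y i
    using princ_trans[OF princ_power[OF g_mem princ_self] that(1)] that(2) by simp
  have inert: "x\<^sup>2 - x + c \<notin> princ A (g i)" if i: "i \<in> I - {i0}" and x: "x \<in> A" for i x
  proof
    assume *: "x\<^sup>2 - x + c \<in> princ A (g i)"
    have "c - d i \<in> princ A (g i)" using c(2)[of i] i by (intro sq) auto
    hence "(x\<^sup>2 - x + c) - (c - d i) \<in> princ A (g i)" by (rule princ_diff[OF *])
    also have "(x\<^sup>2 - x + c) - (c - d i) = x\<^sup>2 - x + d i" by simp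
    finally show False using d(2)[of i x] i x by blast
  qed
  obtain w where w: "w \<in> A" "c - g i0 = (g i0)\<^sup>2 * w" using c(2)[OF i0] by (auto simp: princ_def)
  define u where "u = 1 + g i0 * w"
  have ceq: "c = u * g i0" using w(2) by (simp add: u_def algebra_simps power2_eq_square)
  have uA: "u \<in> A" unfolding u_def using w(1) g_mem[OF i0] by (intro closed)
  have u0: "u \<notin> princ A (g i0)"
  proof
    assume "u \<in> princ A (g i0)"
    hence "u - g i0 * w \<in> princ A (g i0)" using princ_multR[OF w(1)] by (rule princ_diff)
    thus False using max_elementD(3)[OF max_el[OF i0]] by (simp add: u_def)
  qed
  have "unit_in A u"
  proof (rule unit_if_no_factor[OF uA])
    show "u \<noteq> 0" using u0 princ_zero by auto
    fix i assume i: "i \<in> I"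
    show "u \<notin> princ A (g i)"
    proof (cases "i = i0")
      case False
      \<comment> \<open>That 0 is not a root modulo \<open>g i\<close> means that \<open>c\<close>
        is prime to \<open>g i\<close>, and so is its factor \<open>u\<close>.\<close>
      have "c \<notin> princ A (g i)" using inert[of i 0] i False zero_mem by simp
      thus ?thesis using princ_mult'[OF g_mem[OF i0], of u "g i"] unfolding ceq by blast
    qed (use u0 in simp)
  qed
  thus ?thesis using c(1) ceq inert by blast
qed

lemma exists_quadratic_root: "\<exists>\<theta>. \<theta>\<^sup>2 = b * \<theta> - (c :: 'k::alg_closed_field)"
proof -
  obtain \<theta> where "poly [:c, - b, 1:] \<theta> = 0"
    using alg_closed_imp_poly_has_root[of "[:c, - b, 1:]"] by auto
  thus ?thesis by (intro exI[of _ \<theta>]) (simp add: algebra_simps power2_eq_square eq_neg_iff_add_eq_0)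
qed

lemma split_step:
  fixes A :: "'k::alg_closed_field set"
  assumes semilocal_finite: "semilocal_finite A I g" and i0: "i0 \<in> I" and j: "j \<notin> I" and u: "unit_in A u"
    and inert: "\<And>i x. i \<in> I - {i0} \<Longrightarrow> x \<in> A \<Longrightarrow> x\<^sup>2 - x + u * g i0 \<notin> princ A (g i)"
    and aniso: "\<And>x y. x \<in> A \<Longrightarrow> y \<in> A \<Longrightarrow> y \<noteq> 0 \<Longrightarrow> x\<^sup>2 + x * y + u * g i0 * y\<^sup>2 \<noteq> 0"
  shows "\<exists>A' g' v. semilocal_finite A' (insert j I) g' \<and> A \<subseteq> A' \<and> (\<forall>z. integral_root A' z \<longrightarrow> integral_root A z) \<and>
     unit_in A' v \<and> g i0 = v * g' i0 * g' j \<and> (\<forall>i\<in>I - {i0}. g' i = g i)"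
proof -
  interpret semilocal A I g using semilocal_finite by (simp add: semilocal_finite_def)
  obtain \<theta> where \<theta>: "\<theta>\<^sup>2 = 1 * \<theta> - u * g i0" using exists_quadratic_root by blast
  interpret Q: quadratic A I g 1 "u * g i0" \<theta>
    using \<theta> aniso u i0 by unfold_locales (auto simp: unit_in_def one_mem mult_mem g_mem)
  have "semilocal_finite Q.adj (insert j I) (g(i0 := \<theta>, j := 1 - \<theta>))"
    using semilocal_finite inert princ_zero
    by (intro Q.semilocal_finite_split[OF i0 u refl _ _ j]) (auto simp: semilocal_finite_def)
  moreover have "g i0 = inverse u * \<theta> * (1 - \<theta>)" "unit_in Q.adj (inverse u)"
    using Q.gen_eq_conj_product[OF i0 u refl] inert by (auto simp: mult.assoc)
  ultimately show ?thesis
    using Q.A_subset_adj Q.integral_root_descend i0 j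
    by (intro exI[of _ Q.adj] exI[of _ "g(i0 := \<theta>, j := 1 - \<theta>)"] exI[of _ "inverse u"]) auto
qed

text \<open>\<open>b\<close> is 0 at \<open>i0\<close>, for ramification, and 1 elsewhere, where the
  polynomial then agrees with the rootless \<open>x\<^sup>2 - x + c\<close>. The prime
  \<open>i1\<close> witnesses irreducibility.\<close>

lemma ramify_step:
  fixes A :: "'k::alg_closed_field set"
  assumes semilocal_finite: "semilocal_finite A I g" and i0: "i0 \<in> I" and i1: "i1 \<in> I" "i1 \<noteq> i0"
  shows "\<exists>A' g' v. semilocal_finite A' I g' \<and> A \<subseteq> A' \<and> (\<forall>z. integral_root A' z \<longrightarrow> integral_root A z) \<and>
     unit_in A' v \<and> g i0 = v * (g' i0)\<^sup>2 \<and> (\<forall>i\<in>I - {i0}. g' i = g i)"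
proof -
  interpret semilocal A I g using semilocal_finite by (simp add: semilocal_finite_def)
  have res: "\<forall>i\<in>I. finite_residue A (g i)" using semilocal_finite by (simp add: semilocal_finite_def)
  obtain c u where c: "c \<in> A" "unit_in A u" "c = u * g i0"
    "\<And>i x. i \<in> I - {i0} \<Longrightarrow> x \<in> A \<Longrightarrow> x\<^sup>2 - x + c \<notin> princ A (g i)"
    using exists_constant_term[OF i0 res] by blast
  have "\<exists>b\<in>A. \<forall>i\<in>I. b - (if i = i0 then 0 else 1) \<in> princ A ((g i)\<^sup>2)"
    by (intro chinese_remainder) (auto intro: zero_mem one_mem)
  then obtain b where b: "b \<in> A" "\<And>i. i \<in> I \<Longrightarrow> b - (if i = i0 then 0 else 1) \<in> princ A ((g i)\<^sup>2)"
    by blast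
  have sq: "y \<in> princ A (g i)" if "y \<in> princ A ((g i)\<^sup>2)" "i \<in> I" for y i
    using princ_trans[OF princ_power[OF g_mem princ_self] that(1)] that(2) by simp
  have b0: "b \<in> princ A (g i0)" using b(2)[OF i0] i0 by (intro sq) auto
  have inert: "x\<^sup>2 - b * x + c \<notin> princ A (g i)" if i: "i \<in> I - {i0}" and x: "x \<in> A" for i x
  proof
    assume *: "x\<^sup>2 - b * x + c \<in> princ A (g i)"
    have "b - 1 \<in> princ A (g i)" using b(2)[of i] i by (intro sq) auto
    hence "(x\<^sup>2 - b * x + c) + x * (b - 1) \<in> princ A (g i)"
      by (intro princ_add[OF *] princ_mult[OF x])
    thus False using c(4)[OF i x] by (simp add: algebra_simps)
  qed
  obtain \<theta> where \<theta>: "\<theta>\<^sup>2 = b * \<theta> - c" using exists_quadratic_root by blast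
  have "i1 \<in> I - {i0}" using i1 by simp
  interpret Q: quadratic A I g b c \<theta>
    using norm_form_anisotropic[OF i1(1) b(1) c(1) inert[OF \<open>i1 \<in> I - {i0}\<close>]] b(1) c(1) \<theta>
    by unfold_locales
  have "semilocal_finite Q.adj I (g(i0 := \<theta>))" "\<exists>v. unit_in Q.adj v \<and> g i0 = v * \<theta>\<^sup>2"
    using Q.semilocal_finite_ramify[OF i0 c(2,3) inert b0 res] by blast+
  then obtain v where "semilocal_finite Q.adj I (g(i0 := \<theta>))" "unit_in Q.adj v" "g i0 = v * \<theta>\<^sup>2" by blast
  thus ?thesis
    using Q.A_subset_adj Q.integral_root_descend
    by (intro exI[of _ Q.adj] exI[of _ "g(i0 := \<theta>)"] exI[of _ v]) auto
qed

text \<open>Splitting and then ramifying only the new factor leaves \<open>i0\<close> unramified, as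
  the discrete valuation rings require, while the square at \<open>j\<close> is what obstructs
  radical ideals.\<close>

lemma spawn_step:
  fixes A :: "'k::alg_closed_field set"
  assumes semilocal_finite: "semilocal_finite A I g" and i0: "i0 \<in> I" and i1: "i1 \<in> I" "i1 \<noteq> i0" and j: "j \<notin> I"
  shows "\<exists>A' g'. semilocal_finite A' (insert j I) g' \<and> A \<subseteq> A' \<and> (\<forall>z. integral_root A' z \<longrightarrow> integral_root A z) \<and>
     (\<forall>i\<in>I. \<exists>v. unit_in A' v \<and> g i = v * g' i * (if i = i0 then (g' j)\<^sup>2 else 1))"
proof -
  interpret semilocal A I g using semilocal_finite by (simp add: semilocal_finite_def)
  have res: "\<forall>i\<in>I. finite_residue A (g i)" using semilocal_finite by (simp add: semilocal_finite_def)
  obtain c u where c: "c \<in> A" "unit_in A u" "c = u * g i0"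
    "\<And>i x. i \<in> I - {i0} \<Longrightarrow> x \<in> A \<Longrightarrow> x\<^sup>2 - x + c \<notin> princ A (g i)"
    using exists_constant_term[OF i0 res] by blast
  have "i1 \<in> I - {i0}" using i1 by simp
  hence "x\<^sup>2 + 1 * x * y + c * y\<^sup>2 \<noteq> 0" if "x \<in> A" "y \<in> A" "y \<noteq> 0" for x y
    using norm_form_anisotropic[OF i1(1) one_mem c(1) _ that] c(4) by simp
  then obtain A1 g1 v1 where 1: "semilocal_finite A1 (insert j I) g1" "A \<subseteq> A1"
    "\<And>z. integral_root A1 z \<Longrightarrow> integral_root A z" "unit_in A1 v1" "g i0 = v1 * g1 i0 * g1 j"
    "\<And>i. i \<in> I - {i0} \<Longrightarrow> g1 i = g i"
    using split_step[OF semilocal_finite i0 j c(2)] c(3,4) by auto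
  \<comment> \<open>In the second extension \<open>i0\<close> itself plays the inert prime.\<close>
  have ji: "j \<in> insert j I" "i0 \<in> insert j I" "i0 \<noteq> j" using i0 j by auto
  obtain A2 g2 v2 where 2: "semilocal_finite A2 (insert j I) g2" "A1 \<subseteq> A2"
    "\<And>z. integral_root A2 z \<Longrightarrow> integral_root A1 z" "unit_in A2 v2" "g1 j = v2 * (g2 j)\<^sup>2"
    "\<And>i. i \<in> insert j I - {j} \<Longrightarrow> g2 i = g1 i"
    using ramify_step[OF 1(1) ji] by blast
  interpret B: semilocal A2 "insert j I" g2 using 2(1) by (simp add: semilocal_finite_def)
  have "\<exists>v. unit_in A2 v \<and> g i = v * g2 i * (if i = i0 then (g2 j)\<^sup>2 else 1)" if i: "i \<in> I" for i
  proof (cases "i = i0")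
    case True
    have "unit_in A2 v1" using 1(4) 2(2) unfolding unit_in_def by blast
    hence "unit_in A2 (v1 * v2)" using 2(4) by (rule B.unit_in_mult)
    moreover have "g i0 = v1 * v2 * g2 i0 * (g2 j)\<^sup>2"
      using 1(5) 2(5) 2(6)[of i0] ji by (simp add: mult_ac)
    ultimately show ?thesis using True by auto
  next
    case False
    have "g i = g2 i" using 1(6)[of i] 2(6)[of i] i False j by auto
    thus ?thesis using B.unit_in_one False by (intro exI[of _ 1]) simp
  qed
  thus ?thesis using 1(2,3) 2(1-3) by (intro exI[of _ A2] exI[of _ g2]) blast
qed

section \<open>The base ring\<close>

lemma field_subring_Ints: "field_subring (\<int> :: 'k::field set)"
  by standard auto

lemma of_int_mem_princ_Ints_iff:
  "(of_int m :: 'k::field_char_0) \<in> princ \<int> (of_int n) \<longleftrightarrow> n dvd m"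
proof -
  have "(of_int m :: 'k) \<in> princ \<int> (of_int n) \<longleftrightarrow> (\<exists>l. (of_int m :: 'k) = of_int (n * l))"
    unfolding princ_def by (auto elim!: Ints_cases)
  thus ?thesis unfolding of_int_eq_iff dvd_def .
qed

context
  fixes p :: nat
  assumes p: "Factorial_Ring.prime p"
begin

lemma bezout_mod_p:
  assumes "\<not> int p dvd m"
  shows "\<exists>y. int p dvd m * y - 1"
proof -
  have "coprime m (int p)" using p assms prime_imp_coprime[of "int p" m]
    by (simp add: coprime_commute)
  then obtain u v where "u * m + v * int p = 1" using bezout_int[of m "int p"] by auto
  hence "m * u - 1 = int p * (- v)" by (simp add: algebra_simps)
  thus ?thesis by (intro exI[of _ u]) simp
qed

lemma max_element_Ints: "max_element (\<int> :: 'k::field_char_0 set) (of_nat p)"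
  unfolding max_element_def
proof (intro conjI ballI impI)
  show "(of_nat p :: 'k) \<in> \<int>" "(of_nat p :: 'k) \<noteq> 0" using p by (auto simp: prime_gt_0_nat)
  have mem: "(of_int m :: 'k) \<in> princ \<int> (of_nat p) \<longleftrightarrow> int p dvd m" for m
    using of_int_mem_princ_Ints_iff[of m "int p"] by simp
  show "(1 :: 'k) \<notin> princ \<int> (of_nat p)"
    using mem[of 1] prime_gt_1_nat[OF p] by simp
  fix x :: 'k assume x: "x \<in> \<int>" "x \<notin> princ \<int> (of_nat p)"
  then obtain m where m: "x = of_int m" by (auto elim: Ints_cases)
  then obtain y where "int p dvd m * y - 1" using bezout_mod_p[of m] mem x by blast
  hence "x * of_int y - 1 \<in> princ \<int> (of_nat p)" using mem[of "m * y - 1"] m by simp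
  thus "\<exists>y\<in>\<int>. x * y - 1 \<in> princ \<int> (of_nat p)" by (intro bexI[of _ "of_int y"]) auto
qed

abbreviation (input) "Zp \<equiv> (int_localized_at p :: 'k::field_char_0 set)"

lemma Zp_eq: "(Zp :: 'k::field_char_0 set) = frac_ring \<int> (\<int> - princ \<int> (of_nat p))"
proof -
  interpret field_subring "\<int> :: 'k set" by (rule field_subring_Ints)
  show ?thesis unfolding int_localized_at_def localization_at_eq_frac_ring
    by (subst genideal_princ) auto
qed

lemma Zp_cases:
  assumes "x \<in> (Zp :: 'k::field_char_0 set)"
  obtains m n where "x = of_int m / of_int n" "\<not> int p dvd n"
proof -
  obtain a s where as: "x = a / s" "a \<in> \<int>" "s \<in> \<int>" "s \<notin> princ \<int> (of_nat p)"
    using assms unfolding Zp_eq frac_ring_def by blast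
  then obtain m n where "a = of_int m" "s = of_int n" by (auto elim!: Ints_cases)
  thus ?thesis using as of_int_mem_princ_Ints_iff[of n "int p", where 'k = 'k] by (intro that[of m n]) simp_all
qed

lemma Zp_memI: "\<not> int p dvd n \<Longrightarrow> (of_int m / of_int n :: 'k::field_char_0) \<in> Zp"
  using of_int_mem_princ_Ints_iff[of n "int p", where 'k = 'k]
  unfolding Zp_eq frac_ring_def
  by (intro CollectI exI[of _ "of_int m"] exI[of _ "of_int n"]) simp

lemma complement_p:
  "\<int> - princ \<int> (of_nat p) \<subseteq> (\<int> :: 'k::field_char_0 set)"
    "(1 :: 'k) \<in> \<int> - princ \<int> (of_nat p)" "(0 :: 'k) \<notin> \<int> - princ \<int> (of_nat p)"
    "\<And>s t :: 'k. s \<in> \<int> - princ \<int> (of_nat p) \<Longrightarrow> t \<in> \<int> - princ \<int> (of_nat p) \<Longrightarrow>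
      s * t \<in> \<int> - princ \<int> (of_nat p)"
proof -
  interpret field_subring "\<int> :: 'k set" by (rule field_subring_Ints)
  show "(1 :: 'k) \<in> \<int> - princ \<int> (of_nat p)" "(0 :: 'k) \<notin> \<int> - princ \<int> (of_nat p)"
    using max_elementD(3)[OF max_element_Ints] princ_zero by auto
  show "s * t \<in> \<int> - princ \<int> (of_nat p)"
    if "s \<in> \<int> - princ \<int> (of_nat p)" "t \<in> \<int> - princ \<int> (of_nat p)" for s t :: 'k
    using that max_element_prime[OF max_element_Ints] by auto
qed auto

lemma field_subring_Zp: "field_subring (Zp :: 'k::field_char_0 set)"
  unfolding Zp_eq
  by (rule field_subring.field_subring_frac_ring[OF field_subring_Ints complement_p])

lemma max_element_Zp: "max_element (Zp :: 'k::field_char_0 set) (of_nat p)"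
  unfolding Zp_eq
  by (rule field_subring.max_element_frac_ring(2)[OF field_subring_Ints complement_p max_element_Ints]) auto

text \<open>The exponent is the multiplicity of \<open>p\<close> in the numerator. Residues are
  represented by the integers below \<open>p\<close>, the one for \<open>m / n\<close> coming from
  an inverse of \<open>n\<close> modulo \<open>p\<close>.\<close>

lemma semilocal_finite_Zp: "semilocal_finite (Zp :: 'k::field_char_0 set) {i} (\<lambda>_. of_nat p)"
proof -
  interpret field_subring "Zp :: 'k set" by (rule field_subring_Zp)
  have "semilocal (Zp :: 'k set) {i} (\<lambda>_. of_nat p)"
  proof (rule semilocalI[OF field_subring_Zp])
    fix x :: 'k assume x: "x \<in> Zp" "x \<noteq> 0"
    then obtain m n where mn: "x = of_int m / of_int n" "\<not> int p dvd n" using Zp_cases by blast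
    have "m \<noteq> 0" using x mn by auto
    moreover have "\<not> is_unit (int p)" using prime_gt_1_nat[OF p] by simp
    ultimately obtain r where r: "m = int p ^ multiplicity (int p) m * r" "\<not> int p dvd r"
      using multiplicity_decompose'[of m "int p"] by blast
    define k where "k = multiplicity (int p) m"
    have n0: "of_int n \<noteq> (0 :: 'k)" "of_int r \<noteq> (0 :: 'k)" using mn(2) r(2) by auto
    hence "unit_in Zp (of_int r / of_int n :: 'k)"
      using Zp_memI[OF mn(2), of r, where 'k = 'k] Zp_memI[OF r(2), of n, where 'k = 'k]
      by (simp add: unit_in_def)
    moreover have "x * 1 = of_int r / of_int n * (\<Prod>i\<in>{i}. of_nat p ^ k)"
      using r(1) unfolding mn(1) k_def[symmetric] by simp
    ultimately show "\<exists>y\<in>Zp. \<exists>u k. unit_in Zp u \<and> x * y = u * (\<Prod>i\<in>{i}. of_nat p ^ k i)"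
      using one_mem by (intro bexI[of _ 1] exI[of _ "of_int r / of_int n"] exI[of _ "\<lambda>_. k"] conjI)
  qed (use max_element_Zp in auto)
  moreover have "finite_residue (Zp :: 'k set) (of_nat p)"
    unfolding finite_residue_def
  proof (intro exI[of _ "of_int ` {0..<int p}"] conjI ballI)
    show "of_int ` {0..<int p} \<subseteq> (Zp :: 'k set)" using of_int_mem by auto
    fix x :: 'k assume "x \<in> Zp"
    then obtain m n where mn: "x = of_int m / of_int n" "\<not> int p dvd n" using Zp_cases by blast
    obtain y where "int p dvd n * y - 1" using bezout_mod_p[OF mn(2)] by blast
    then obtain z where z: "n * y - 1 = int p * z" by (auto simp: dvd_def)
    define r where "r = (m * y) mod int p"
    have r: "r = m * y - int p * ((m * y) div int p)" by (simp add: r_def minus_mult_div_eq_mod)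
    have "m - r * n = m - m * (n * y) + int p * (n * ((m * y) div int p))"
      unfolding r by (simp add: algebra_simps)
    also have "n * y = 1 + int p * z" using z by simp
    also have "m - m * (1 + int p * z) + int p * (n * ((m * y) div int p))
        = int p * (n * ((m * y) div int p) - m * z)" by (simp add: algebra_simps)
    finally have "m - r * n = int p * (n * ((m * y) div int p) - m * z)" .
    hence "(of_int (m - r * n) :: 'k) = of_int (int p * (n * ((m * y) div int p) - m * z))" by simp
    moreover have "of_int n \<noteq> (0 :: 'k)" using mn(2) by auto
    ultimately have x: "x - of_int r = of_nat p * (of_int (n * ((m * y) div int p) - m * z) / of_int n)"
      unfolding mn(1) by (simp add: field_simps)
    have "x - of_int r \<in> princ Zp (of_nat p)" unfolding x by (rule princ_multR[OF Zp_memI[OF mn(2)]])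
    moreover have "r \<in> {0..<int p}" using p by (simp add: r_def prime_gt_0_nat)
    ultimately show "\<exists>r\<in>of_int ` {0..<int p}. x - r \<in> princ Zp (of_nat p)" by blast
  qed auto
  ultimately show ?thesis by (simp add: semilocal_finite_def)
qed

text \<open>The discriminant \<open>1 - 4 p\<close> of \<open>x\<^sup>2 - x + p\<close> is negative.\<close>

lemma Zp_anisotropic:
  assumes "x \<in> (Zp :: 'k::field_char_0 set)" "y \<in> Zp" "y \<noteq> 0"
  shows "x\<^sup>2 + x * y + of_nat p * y\<^sup>2 \<noteq> 0"
proof
  assume *: "x\<^sup>2 + x * y + of_nat p * y\<^sup>2 = 0"
  obtain a s where a: "x = of_int a / of_int s" "\<not> int p dvd s" using Zp_cases assms(1) by blast
  obtain b t where b: "y = of_int b / of_int t" "\<not> int p dvd t" using Zp_cases assms(2) by blast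
  have nz: "of_int s \<noteq> (0 :: 'k)" "of_int t \<noteq> (0 :: 'k)" "b \<noteq> 0" "s \<noteq> 0" using a b assms(3) by auto
  define u v where "u = a * t" and "v = b * s"
  have "(of_int s * of_int t)\<^sup>2 * (x\<^sup>2 + x * y + of_nat p * y\<^sup>2) = of_int (u\<^sup>2 + u * v + int p * v\<^sup>2)"
    using nz by (simp add: a(1) b(1) u_def v_def field_simps power2_eq_square)
  hence "(of_int (u\<^sup>2 + u * v + int p * v\<^sup>2) :: 'k) = 0" using * by simp
  hence "u\<^sup>2 + u * v + int p * v\<^sup>2 = 0" by (simp only: of_int_eq_0_iff)
  \<comment> \<open>Four times the form, with the square completed.\<close>
  hence "(2 * u + v)\<^sup>2 + (4 * int p - 1) * v\<^sup>2 = 0" by (simp add: algebra_simps power2_eq_square)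
  moreover have "4 * int p - 1 > 0" using p prime_gt_0_nat[of p] by simp
  moreover have "v\<^sup>2 > 0" using nz by (simp add: v_def)
  ultimately show False using zero_le_power2[of "2 * u + v"] mult_pos_pos[of "4 * int p - 1" "v\<^sup>2"] by linarith
qed

text \<open>Splitting \<open>p\<close> by \<open>x\<^sup>2 - x + p\<close> provides the first pair
  of primes, so that an inert witness exists from then on.\<close>

lemma exists_base:
  "\<exists>A g. semilocal_finite A {0, 1 :: nat} g \<and> (Zp :: 'k::{alg_closed_field, field_char_0} set) \<subseteq> A \<and>
           (\<forall>z. integral_root A z \<longrightarrow> integral_root Zp z)"
proof -
  have "unit_in (Zp :: 'k set) 1"
    by (rule field_subring.unit_in_one[OF field_subring_Zp])
  from split_step[OF semilocal_finite_Zp[of "0::nat", where 'k = 'k] _ _ this, of 0 1] Zp_anisotropic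
  obtain A g where "semilocal_finite A (insert 1 {0 :: nat}) g" "(Zp :: 'k set) \<subseteq> A"
    "\<forall>z. integral_root A z \<longrightarrow> integral_root Zp z" by auto
  thus ?thesis by (auto simp: insert_commute)
qed

end

section \<open>The schedule and the tower\<close>

text \<open>Index \<open>1\<close> is the spare prime that never spawns and so keeps every quadratic step irreducible.\<close>

context
  fixes h :: "nat \<Rightarrow> nat \<times> 'o::wellorder" and \<beta> :: 'o
begin

text \<open>\<open>h n\<close> is a request, a pair of parent and label, for the index
  \<open>n + 2\<close>, as 0 and 1 are taken; hence the shift by 2. No label lies below that of
  index 1.\<close>

definition sched_lab :: "nat \<Rightarrow> 'o" where
  "sched_lab j = (if j = 0 then \<beta> else if j = 1 then (LEAST x. True) else snd (h (j - 2)))"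

definition sched_par :: "nat \<Rightarrow> nat" where
  "sched_par j = fst (h (j - 2))"

text \<open>A request whose parent is not yet born, or whose label is not smaller than the parent's,
  is ignored. A schedule that repeats its requests infinitely often loses nothing by this.\<close>

primrec sched_ids :: "nat \<Rightarrow> nat set" where
  "sched_ids 0 = {0, 1}"
| "sched_ids (Suc n) = (if fst (h n) \<in> sched_ids n \<and> snd (h n) < sched_lab (fst (h n))
     then insert (n + 2) (sched_ids n) else sched_ids n)"

lemma sched_ids_bounds: "{0, 1} \<subseteq> sched_ids n" "sched_ids n \<subseteq> {..n + 1}"
proof -
  have "{0, 1} \<subseteq> sched_ids n \<and> sched_ids n \<subseteq> {..n + 1}" by (induction n) auto
  thus "{0, 1} \<subseteq> sched_ids n" "sched_ids n \<subseteq> {..n + 1}" by auto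
qed

lemma new_id: "n + 2 \<notin> sched_ids n"
  using sched_ids_bounds(2)[of n] by auto

lemma sched_step:
  assumes "j \<in> sched_ids (Suc n) - sched_ids n"
  shows "j = n + 2" "sched_par j \<in> sched_ids n" "sched_lab j < sched_lab (sched_par j)"
  using assms by (auto simp: sched_par_def sched_lab_def split: if_splits)

text \<open>Dependent choice of a ring with its generators: \<open>P\<close> is the invariant of a
  level, \<open>Q\<close> links consecutive levels. Integrality over the base ring belongs to the
  invariant because it descends one extension at a time.\<close>

lemma exists_tower:
  fixes p :: nat
  assumes p: "Factorial_Ring.prime p"
  shows "\<exists>A :: nat \<Rightarrow> 'k::{alg_closed_field, field_char_0} set. \<exists>g.
    tower A sched_ids g sched_par sched_lab \<and> int_localized_at p \<subseteq> A 0 \<and>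
    (\<forall>n z. integral_root (A n) z \<longrightarrow> integral_root (int_localized_at p) z)"
proof -
  let ?Z = "int_localized_at p :: 'k set"
  define P where "P n U \<longleftrightarrow> semilocal_finite (fst U) (sched_ids n) (snd U) \<and> ?Z \<subseteq> fst U \<and>
    (\<forall>z. integral_root (fst U) z \<longrightarrow> integral_root ?Z z)" for n and U :: "'k set \<times> (nat \<Rightarrow> 'k)"
  define Q where "Q n U U' \<longleftrightarrow> fst U \<subseteq> fst U' \<and>
    (\<forall>i\<in>sched_ids n. \<exists>u. unit_in (fst U') u \<and> snd U i = u * snd U' i *
      (\<Prod>j\<in>{j \<in> sched_ids (Suc n) - sched_ids n. sched_par j = i}. (snd U' j)\<^sup>2))"
    for n and U U' :: "'k set \<times> (nat \<Rightarrow> 'k)"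
  have "\<exists>f. \<forall>n. P n (f n) \<and> Q n (f n) (f (Suc n))"
  proof (rule dependent_nat_choice)
    show "\<exists>U. P 0 U" using exists_base[OF p, where 'k = 'k] unfolding P_def by auto
    fix U n assume U: "P n U"
    hence semilocal_finite: "semilocal_finite (fst U) (sched_ids n) (snd U)" by (simp add: P_def)
    show "\<exists>U'. P (Suc n) U' \<and> Q n U U'"
    proof (cases "fst (h n) \<in> sched_ids n \<and> snd (h n) < sched_lab (fst (h n))")
      case False
      interpret semilocal "fst U" "sched_ids n" "snd U" using semilocal_finite by (simp add: semilocal_finite_def)
      have "sched_ids (Suc n) = sched_ids n" unfolding sched_ids.simps by (rule if_not_P[OF False])
      hence "P (Suc n) U" "Q n U U"
        using U unit_in_one by (auto simp: P_def Q_def intro!: exI[of _ 1])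
      thus ?thesis by blast
    next
      case True
      define i0 where "i0 = fst (h n)"
      have ids: "sched_ids (Suc n) = insert (n + 2) (sched_ids n)"
        unfolding sched_ids.simps by (rule if_P[OF True])
      \<comment> \<open>An honoured request has a label below that of its parent, which is
        impossible for the least label.\<close>
      have "i0 \<noteq> 1"
      proof
        assume "i0 = 1"
        hence "snd (h n) < (LEAST x. True)" using True by (simp add: i0_def sched_lab_def)
        thus False using not_less_Least by blast
      qed
      hence i0: "i0 \<in> sched_ids n" "1 \<in> sched_ids n" "1 \<noteq> i0"
        using True sched_ids_bounds(1)[of n] by (auto simp: i0_def)
      obtain A' g' where *: "semilocal_finite A' (insert (n + 2) (sched_ids n)) g'" "fst U \<subseteq> A'"
        "\<And>z. integral_root A' z \<Longrightarrow> integral_root (fst U) z"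
        "\<And>i. i \<in> sched_ids n \<Longrightarrow> \<exists>v. unit_in A' v \<and>
           snd U i = v * g' i * (if i = i0 then (g' (n + 2))\<^sup>2 else 1)"
        using spawn_step[OF semilocal_finite i0 new_id] by blast
      have "{j \<in> sched_ids (Suc n) - sched_ids n. sched_par j = i} = (if i = i0 then {n + 2} else {})" for i
        using new_id[of n] unfolding ids by (auto simp: sched_par_def i0_def)
      hence "(\<Prod>j\<in>{j \<in> sched_ids (Suc n) - sched_ids n. sched_par j = i}. (g' j)\<^sup>2)
               = (if i = i0 then (g' (n + 2))\<^sup>2 else 1)" for i
        by simp
      hence "Q n U (A', g')" unfolding Q_def using * by simp
      moreover have "P (Suc n) (A', g')" unfolding P_def ids using * U by (auto simp: P_def)
      ultimately show ?thesis by blast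
    qed
  qed
  then obtain f where f: "\<And>n. P n (f n)" "\<And>n. Q n (f n) (f (Suc n))" by blast
  have "tower (\<lambda>n. fst (f n)) sched_ids (\<lambda>n. snd (f n)) sched_par sched_lab"
  proof (rule tower.intro)
    show "semilocal (fst (f n)) (sched_ids n) (snd (f n))" for n
      using f(1)[of n] by (simp add: P_def semilocal_finite_def)
    show "fst (f n) \<subseteq> fst (f (Suc n))" for n using f(2)[of n] by (simp add: Q_def)
    show "sched_ids n \<subseteq> sched_ids (Suc n)" for n by auto
    show "sched_ids 0 \<noteq> {}" by simp
    show "sched_par j \<in> sched_ids n" "sched_lab j < sched_lab (sched_par j)"
      if "j \<in> sched_ids (Suc n) - sched_ids n" for j n using sched_step[OF that] by auto
    show "\<exists>u. unit_in (fst (f (Suc n))) u \<and> snd (f n) i = u * snd (f (Suc n)) i *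
       (\<Prod>j\<in>{j \<in> sched_ids (Suc n) - sched_ids n. sched_par j = i}. (snd (f (Suc n)) j)\<^sup>2)"
      if "i \<in> sched_ids n" for i n using f(2)[of n] that unfolding Q_def by blast
  qed
  thus ?thesis using f(1) unfolding P_def
    by (intro exI[of _ "\<lambda>n. fst (f n)"] exI[of _ "\<lambda>n. snd (f n)"]) blast
qed

end

text \<open>Enumerating triples with an additional natural number makes each pair recur infinitely
  often, in particular after its parent is born.\<close>

lemma exists_schedule:
  fixes \<alpha> :: "'o::wellorder"
  assumes "countable {..<\<alpha>}" "\<beta> < \<alpha>"
  shows "\<exists>h :: nat \<Rightarrow> nat \<times> 'o. \<forall>i \<gamma>. \<gamma> < \<alpha> \<longrightarrow> infinite {n. h n = (i, \<gamma>)}"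
proof -
  let ?S = "(UNIV :: nat set) \<times> (UNIV :: nat set) \<times> {..<\<alpha>}"
  have S: "?S \<noteq> {}" "countable ?S" using assms by auto
  define e where "e = from_nat_into ?S"
  have re: "range e = ?S" unfolding e_def using S by (rule range_from_nat_into)
  have "infinite {n. snd (e n) = (i, \<gamma>)}" if "\<gamma> < \<alpha>" for i \<gamma>
  proof
    assume "finite {n. snd (e n) = (i, \<gamma>)}"
    hence fin: "finite (e ` {n. snd (e n) = (i, \<gamma>)})" by (rule finite_imageI)
    have "(\<lambda>k. (k, i, \<gamma>)) ` UNIV \<subseteq> e ` {n. snd (e n) = (i, \<gamma>)}"
    proof
      fix x assume "x \<in> (\<lambda>k. (k, i, \<gamma>)) ` (UNIV :: nat set)"
      then obtain k where k: "x = (k, i, \<gamma>)" by blast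
      hence "x \<in> range e" unfolding re using that by simp
      then obtain n where "x = e n" by blast
      moreover from this have "snd (e n) = (i, \<gamma>)" using k by (metis snd_conv)
      ultimately show "x \<in> e ` {n. snd (e n) = (i, \<gamma>)}" by blast
    qed
    hence "finite ((\<lambda>k. (k, i, \<gamma>)) ` (UNIV :: nat set))" using fin by (rule finite_subset)
    moreover have "inj (\<lambda>k :: nat. (k, i, \<gamma>))" by (auto intro: injI)
    ultimately show False using finite_imageD infinite_UNIV_nat by blast
  qed
  thus ?thesis by (intro exI[of _ "\<lambda>n. snd (e n)"]) blast
qed

section \<open>The transfinite sequence of critical ideals\<close>

context tower
begin

text \<open>At a successor of \<delta> the critical ideals are those with infinitely many children
  of label at least \<delta>, and \<open>many\<close> provides these exactly for labels above
  \<delta>. The assumptions speak of ordinals strictly below \<alpha>; \<alpha> itself is reached by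
  one last successor step.\<close>

lemma Crit_iter_eq:
  assumes root: "\<And>\<gamma>. \<gamma> < \<alpha> \<Longrightarrow> \<exists>i\<in>I 0. \<gamma> \<le> lab i"
    and many: "\<And>i \<gamma>. i \<in> ids \<Longrightarrow> \<gamma> < \<alpha> \<Longrightarrow> \<gamma> < lab i \<Longrightarrow>
      infinite {j \<in> ids - I 0. par j = i \<and> \<gamma> \<le> lab j}"
    and "\<gamma> < \<alpha> \<or> is_succ_of \<alpha> \<beta> \<and> \<gamma> = \<alpha>"
  shows "Crit_iter D \<gamma> = max_at ` {i \<in> ids. \<gamma> \<le> lab i}"
  using assms(3)
proof (induction \<gamma> rule: less_induct)
  case (less \<gamma>)
  have below: "\<delta> < \<alpha>" if "\<delta> < \<gamma>" for \<delta>
    using that less(2) by (auto simp: is_succ_of_def)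
  have IH: "Crit_iter D \<delta> = max_at ` {i \<in> ids. \<delta> \<le> lab i}" if "\<delta> < \<gamma>" for \<delta>
    using less(1)[OF that] below[OF that] by blast
  consider "\<forall>\<delta>. \<gamma> \<le> \<delta>" | \<delta> where "is_succ_of \<gamma> \<delta>"
    | "\<not> (\<forall>\<delta>. \<gamma> \<le> \<delta>)" "\<not> (\<exists>\<delta>. is_succ_of \<gamma> \<delta>)" by blast
  thus ?case
  proof cases
    case 1
    thus ?thesis using Crit_iter_zero[of \<gamma> D] Max_ideals_D by auto
  next
    case (2 \<delta>)
    have lt: "\<delta> < \<gamma>" using 2 by (simp add: is_succ_of_def)
    have succ: "\<gamma> \<le> x \<longleftrightarrow> \<delta> < x" for x
      using 2 less_le_trans[OF lt, of x] unfolding is_succ_of_def by (meson not_le)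
    \<comment> \<open>A child of label at least \<delta> already forces
      \<open>\<delta> < lab i\<close>, as labels drop; the converse is \<open>many\<close>.\<close>
    have inf: "infinite {j \<in> ids - I 0. par j = i \<and> \<delta> \<le> lab j} \<longleftrightarrow> \<delta> < lab i" if i: "i \<in> ids" for i
    proof
      assume "infinite {j \<in> ids - I 0. par j = i \<and> \<delta> \<le> lab j}"
      hence "{j \<in> ids - I 0. par j = i \<and> \<delta> \<le> lab j} \<noteq> {}" by (rule infinite_imp_nonempty)
      then obtain j where j: "j \<in> ids - I 0" "par j = i" "\<delta> \<le> lab j" by blast
      obtain n where "j \<in> I (Suc n) - I n" using birth[OF j(1)] by blast
      thus "\<delta> < lab i" using lab_par[of j n] j(2,3) by auto
    qed (use many[OF i below[OF lt]] in blast)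
    have "Crit_iter D \<gamma> = crit_step D (max_at ` {i \<in> ids. \<delta> \<le> lab i})"
      using Crit_iter_succ[OF 2, of D] IH[OF lt] by simp
    also have "\<dots> = max_at ` {i \<in> ids. \<delta> \<le> lab i \<and> infinite {j \<in> ids - I 0. par j = i \<and> \<delta> \<le> lab j}}"
      by (rule crit_step_max_at[OF root[OF below[OF lt]]])
    also have "{i \<in> ids. \<delta> \<le> lab i \<and> infinite {j \<in> ids - I 0. par j = i \<and> \<delta> \<le> lab j}} = {i \<in> ids. \<gamma> \<le> lab i}"
      using inf succ by auto
    finally show ?thesis .
  next
    case 3
    then obtain \<delta>0 where \<delta>0: "\<delta>0 < \<gamma>" by (auto simp: not_le)
    \<comment> \<open>Below a limit there is no largest ordinal, so a label that is at least every
      \<delta> below \<gamma> is at least \<gamma>.\<close>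
    have dense: "\<exists>\<delta><\<gamma>. x < \<delta>" if "x < \<gamma>" for x
      using 3(2) that by (auto simp: is_succ_of_def)
    have "Crit_iter D \<gamma> = (\<Inter>\<delta>\<in>{..<\<gamma>}. Crit_iter D \<delta>)"
      by (rule Crit_iter_limit[OF \<delta>0 3(2)])
    also have "\<dots> = (\<Inter>\<delta>\<in>{..<\<gamma>}. max_at ` {i \<in> ids. \<delta> \<le> lab i})"
      by (intro INF_cong refl IH) simp
    \<comment> \<open>Images commute with this nonempty intersection because \<open>max_at\<close>
      is injective on \<open>ids\<close>.\<close>
    also have "\<dots> = max_at ` (\<Inter>\<delta>\<in>{..<\<gamma>}. {i \<in> ids. \<delta> \<le> lab i})"
      using \<delta>0 by (intro image_INT[OF max_at_inj, symmetric]) auto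
    also have "(\<Inter>\<delta>\<in>{..<\<gamma>}. {i \<in> ids. \<delta> \<le> lab i}) = {i \<in> ids. \<gamma> \<le> lab i}"
    proof (intro subset_antisym subsetI)
      fix i assume i: "i \<in> (\<Inter>\<delta>\<in>{..<\<gamma>}. {i \<in> ids. \<delta> \<le> lab i})"
      have "\<not> lab i < \<gamma>"
      proof
        assume "lab i < \<gamma>"
        then obtain \<delta> where "\<delta> < \<gamma>" "lab i < \<delta>" using dense by blast
        thus False using i by (auto simp: not_le[symmetric])
      qed
      thus "i \<in> {i \<in> ids. \<gamma> \<le> lab i}" using i \<delta>0 by (auto simp: not_less)
    qed auto
    finally show ?thesis .
  qed
qed

end

theorem corollary5p8:
  fixes p :: nat and \<alpha> :: "'o::wellorder"
  assumes "Factorial_Ring.prime p"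
    and Qbar: "\<And>x :: 'q::{alg_closed_field, field_char_0}. algebraic x"
    and "countable {..<\<alpha>}"
    and "\<exists>\<beta>. is_succ_of \<alpha> \<beta>"
  shows "\<exists>F :: 'q set.
           subfield F ring_of_type_algebra \<and>
           almost_dedekind (integral_closure_in (int_localized_at p) F) \<and>
           has_SP_rank (integral_closure_in (int_localized_at p) F) \<alpha> \<and>
           countable (Max_ideals (ring_on (integral_closure_in (int_localized_at p) F)))"
proof -
  obtain \<beta> where \<beta>: "is_succ_of \<alpha> \<beta>" using assms(4) by blast
  have \<beta>\<alpha>: "\<beta> < \<alpha>" and le_\<beta>: "\<And>\<gamma>. \<gamma> < \<alpha> \<Longrightarrow> \<gamma> \<le> \<beta>"
    using \<beta> by (auto simp: is_succ_of_def not_less[symmetric])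
  obtain h :: "nat \<Rightarrow> nat \<times> 'o" where h: "\<And>i \<gamma>. \<gamma> < \<alpha> \<Longrightarrow> infinite {n. h n = (i, \<gamma>)}"
    using exists_schedule[OF assms(3) \<beta>\<alpha>] by blast
  obtain A :: "nat \<Rightarrow> 'q set" and g where
    T: "tower A (sched_ids h \<beta>) g (sched_par h) (sched_lab h \<beta>)" and
    ZA: "int_localized_at p \<subseteq> A 0" and
    int: "\<And>n z. integral_root (A n) z \<Longrightarrow> integral_root (int_localized_at p) z"
    using exists_tower[OF assms(1), of h \<beta>] by blast
  interpret tower A "sched_ids h \<beta>" g "sched_par h" "sched_lab h \<beta>" by (rule T)
  \<comment> \<open>\<open>D\<close> is integrally closed because its levels are, and integral over
    the base ring because integrality descends through every level.\<close>
  have closure: "integral_closure_in (int_localized_at p) (quotient_field D) = D"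
  proof
    show "integral_closure_in (int_localized_at p) (quotient_field D) \<subseteq> D"
    proof
      fix x assume "x \<in> integral_closure_in (int_localized_at p) (quotient_field D)"
      then obtain q where q: "x \<in> quotient_field D" "lead_coeff q = 1"
        "\<And>i. coeff q i \<in> int_localized_at p" "poly q x = 0"
        unfolding integral_closure_in_def by blast
      show "x \<in> D" using q ZA by (intro integrally_closed_D[of x q]) auto
    qed
    show "D \<subseteq> integral_closure_in (int_localized_at p) (quotient_field D)"
    proof
      fix x assume x: "x \<in> D"
      then obtain n where "x \<in> A n" by (auto simp: D_def)
      hence "integral_root (int_localized_at p) x"
        using integral_root_self[OF L.field_subring_axioms] int by blast
      thus "x \<in> integral_closure_in (int_localized_at p) (quotient_field D)"
        using x D.subset_quotient_field unfolding integral_closure_in_def integral_root_def by blast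
    qed
  qed
  have lab0: "sched_lab h \<beta> 0 = \<beta>" "0 \<in> sched_ids h \<beta> 0" by (simp_all add: sched_lab_def)
  \<comment> \<open>Following an index back to level 0 can only raise the label, and there the
    labels are \<beta> and the least element.\<close>
  have lab_le: "sched_lab h \<beta> i \<le> \<beta>" if i: "i \<in> ids" for i
  proof -
    obtain n where "i \<in> sched_ids h \<beta> n" using i by (auto simp: ids_def)
    then obtain j where "j \<in> sched_ids h \<beta> 0" "sched_lab h \<beta> i \<le> sched_lab h \<beta> j"
      using ancestor[of 0 n i] by blast
    moreover have "(LEAST x :: 'o. True) \<le> \<beta>" by (rule Least_le) simp
    ultimately show ?thesis by (auto simp: sched_lab_def)
  qed
  have root: "\<exists>i\<in>sched_ids h \<beta> 0. \<gamma> \<le> sched_lab h \<beta> i" if "\<gamma> < \<alpha>" for \<gamma>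
    using lab0 le_\<beta>[OF that] by (intro bexI[of _ 0]) auto
  have many: "infinite {j \<in> ids - sched_ids h \<beta> 0. sched_par h j = i \<and> \<gamma> \<le> sched_lab h \<beta> j}"
    if i: "i \<in> ids" "\<gamma> < \<alpha>" "\<gamma> < sched_lab h \<beta> i" for i \<gamma>
  proof
    assume fin: "finite {j \<in> ids - sched_ids h \<beta> 0. sched_par h j = i \<and> \<gamma> \<le> sched_lab h \<beta> j}"
    obtain m where m: "i \<in> sched_ids h \<beta> m" using i(1) by (auto simp: ids_def)
    \<comment> \<open>The index \<open>i\<close> exists from level \<open>m\<close> on, so each
      request \<open>(i, \<gamma>)\<close> made at a time \<open>n \<ge> m\<close> is honoured and
      creates the child \<open>n + 2\<close>.\<close>
    have "(\<lambda>n. n + 2) ` ({n. h n = (i, \<gamma>)} - {..<m}) \<subseteq>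
        {j \<in> ids - sched_ids h \<beta> 0. sched_par h j = i \<and> \<gamma> \<le> sched_lab h \<beta> j}"
    proof
      fix j assume "j \<in> (\<lambda>n. n + 2) ` ({n. h n = (i, \<gamma>)} - {..<m})"
      then obtain n where n: "j = n + 2" "h n = (i, \<gamma>)" "\<not> n < m" by auto
      have "m \<le> n" using n(3) by simp
      have "i \<in> sched_ids h \<beta> n" using index_mono[OF \<open>m \<le> n\<close>] m by blast
      hence "j \<in> sched_ids h \<beta> (Suc n)" using n(1,2) i(3) by simp
      hence "j \<in> ids" unfolding ids_def by blast
      thus "j \<in> {j \<in> ids - sched_ids h \<beta> 0. sched_par h j = i \<and> \<gamma> \<le> sched_lab h \<beta> j}"
        using n(1,2) by (simp add: sched_par_def sched_lab_def)
    qed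
    hence "finite ((\<lambda>n. n + 2) ` ({n. h n = (i, \<gamma>)} - {..<m}))" using fin by (rule finite_subset)
    hence "finite ({n. h n = (i, \<gamma>)} - {..<m})" by (rule finite_imageD) (auto intro: inj_onI)
    thus False using h[OF i(2), of i] by simp
  qed
  have Crit: "Crit_iter D \<gamma> = max_at ` {i \<in> ids. \<gamma> \<le> sched_lab h \<beta> i}" if "\<gamma> < \<alpha> \<or> \<gamma> = \<alpha>" for \<gamma>
  proof (rule Crit_iter_eq[OF root many])
    show "\<gamma> < \<alpha> \<or> is_succ_of \<alpha> \<beta> \<and> \<gamma> = \<alpha>" using that \<beta> by blast
  qed
  have "has_SP_rank D \<alpha>"
    unfolding has_SP_rank_def
  proof (intro conjI allI impI)
    have "{i \<in> ids. \<alpha> \<le> sched_lab h \<beta> i} = {}"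
      using le_less_trans[OF lab_le \<beta>\<alpha>] by (auto simp: not_le)
    thus "Crit_iter D \<alpha> = {}" using Crit[of \<alpha>] by simp
    fix \<gamma> assume \<gamma>: "\<gamma> < \<alpha>"
    then obtain i where "i \<in> sched_ids h \<beta> 0" "\<gamma> \<le> sched_lab h \<beta> i" using root by blast
    hence "i \<in> {i \<in> ids. \<gamma> \<le> sched_lab h \<beta> i}" unfolding ids_def by blast
    thus "Crit_iter D \<gamma> \<noteq> {}" using Crit[of \<gamma>] \<gamma> by blast
  qed
  moreover have "countable (Max_ideals (ring_on D))" unfolding Max_ideals_D by simp
  ultimately show ?thesis
    using D.subfield_quotient_field almost_dedekind_D closure
    by (intro exI[of _ "quotient_field D"]) simp
qed

end
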